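(* There is an algorithm that, given a group $\Gamma\le\langle(1,2,\dots,n)\rangle$ (a subgroup of the cyclic group generated by the $n$-cycle $(1,2,\dots,n)$) and disjoint sets $I_0,I_1\subseteq[n]$, runs in $O(n^2\,\mathrm{ord}(\Gamma))$ time, decides whether $\mathcal X_\Gamma\cap F(I_0,I_1)=\emptyset$, and, if this set is non-empty, computes the complete set of fixings of $\mathcal X_\Gamma\cap F(I_0,I_1)$, i.e. the sets $J_b=\{i\in[n] : x_i=b\text{ for all }x\in\mathcal X_\Gamma\cap F(I_0,I_1)\}$ for $b\in\{0,1\}$.
   Context: $[n]=\{1,\dots,n\}$. A permutation $\gamma$ of $[n]$ acts on $x\in\mathbb R^n$ by $\gamma(x)=(x_{\gamma^{-1}(1)},\dots,x_{\gamma^{-1}(n)})$. $x\succeq y$ means that $x$ is lexicographically not smaller than $y$. $\mathcal X_\gamma=\{x\in\{0,1\}^n : x\succeq\gamma(x)\}$ and $\mathcal X_\Gamma=\bigcap_{\gamma\in\Gamma}\mathcal X_\gamma$. For disjoint $I_0,I_1\subseteq[n]$, $F(I_0,I_1)=\{x\in\{0,1\}^n : x_i=0 \text{ for } i\in I_0,\ x_i=1\text{ for } i\in I_1\}$. $\mathrm{ord}(\Gamma)$ is the number of elements of $\Gamma$ (so $\mathrm{ord}(\Gamma)\le n$). Time is counted in elementary operations (random access machine). *)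

theory Defs
  imports "HOL-Algebra.Sym_Groups" "HOL-Library.FuncSet" "HOL-Library.Fun_Lexorder"
begin

section \<open>Binary vectors, permutation action, fixings\<close>

definition binary_cube :: "nat \<Rightarrow> (nat \<Rightarrow> nat) set" where
  "binary_cube n = {1..n} \<rightarrow>\<^sub>E {0, 1}"

definition perm_act :: "nat \<Rightarrow> (nat \<Rightarrow> nat) \<Rightarrow> (nat \<Rightarrow> nat) \<Rightarrow> nat \<Rightarrow> nat" where
  "perm_act n \<gamma> x = (\<lambda>i\<in>{1..n}. x (inv' \<gamma> i))"

text \<open>
  All vectors involved are extensional, so they agree outside \<open>{1..n}\<close> and \<^const>\<open>less_fun\<close>
  is exactly the strict lexicographic order on the entries \<open>1, \<dots>, n\<close>.
\<close>

definition lex_ge :: "(nat \<Rightarrow> nat) \<Rightarrow> (nat \<Rightarrow> nat) \<Rightarrow> bool" where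
  "lex_ge x y \<longleftrightarrow> \<not> less_fun x y"

definition X_perm :: "nat \<Rightarrow> (nat \<Rightarrow> nat) \<Rightarrow> (nat \<Rightarrow> nat) set" where
  "X_perm n \<gamma> = {x \<in> binary_cube n. lex_ge x (perm_act n \<gamma> x)}"

definition X_group :: "nat \<Rightarrow> (nat \<Rightarrow> nat) set \<Rightarrow> (nat \<Rightarrow> nat) set" where
  "X_group n \<Gamma> = (\<Inter>\<gamma>\<in>\<Gamma>. X_perm n \<gamma>)"

definition face :: "nat \<Rightarrow> nat set \<Rightarrow> nat set \<Rightarrow> (nat \<Rightarrow> nat) set" where
  "face n I0 I1 = {x \<in> binary_cube n. (\<forall>i\<in>I0. x i = 0) \<and> (\<forall>i\<in>I1. x i = 1)}"

definition fixings :: "nat \<Rightarrow> nat \<Rightarrow> (nat \<Rightarrow> nat) set \<Rightarrow> nat set" where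
  "fixings n b S = {i \<in> {1..n}. \<forall>x\<in>S. x i = b}"

text \<open>The cycle \<open>1 \<mapsto> 2 \<mapsto> \<dots> \<mapsto> n \<mapsto> 1\<close>.\<close>

abbreviation full_cycle :: "nat \<Rightarrow> nat \<Rightarrow> nat" where
  "full_cycle n \<equiv> cycle_of_list [1..<Suc n]"


section \<open>Random access machines\<close>

text \<open>
  A machine has registers, which a program addresses directly, and a random access memory,
  which it addresses indirectly through registers. \<open>Sub\<close> is truncated subtraction.
  A program halts when the program counter leaves it; every executed instruction costs one
  time unit. Since arithmetic is on \<^typ>\<open>nat\<close>, the word length is not limited by the
  machine itself; \<open>words_le\<close> expresses that a given configuration respects a bound on it.
\<close>

datatype instr =
    Const nat nat
  | Copy nat nat
  | Inc nat
  | Add nat nat nat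
  | Sub nat nat nat
  | Load nat nat
  | Store nat nat
  | Jump nat
  | JumpLess nat nat nat

record config =
  pc :: nat
  reg :: "nat \<Rightarrow> nat"
  mem :: "nat \<Rightarrow> nat"

definition set_reg :: "nat \<Rightarrow> nat \<Rightarrow> config \<Rightarrow> config" where
  "set_reg r v c = c\<lparr>pc := Suc (pc c), reg := (reg c)(r := v)\<rparr>"

fun exec_instr :: "instr \<Rightarrow> config \<Rightarrow> config" where
  "exec_instr (Const r k) c = set_reg r k c"
| "exec_instr (Copy r s) c = set_reg r (reg c s) c"
| "exec_instr (Inc r) c = set_reg r (Suc (reg c r)) c"
| "exec_instr (Add r s t) c = set_reg r (reg c s + reg c t) c"
| "exec_instr (Sub r s t) c = set_reg r (reg c s - reg c t) c"
| "exec_instr (Load r s) c = set_reg r (mem c (reg c s)) c"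
| "exec_instr (Store r s) c =
     c\<lparr>pc := Suc (pc c), mem := (mem c)(reg c r := reg c s)\<rparr>"
| "exec_instr (Jump l) c = c\<lparr>pc := l\<rparr>"
| "exec_instr (JumpLess r s l) c =
     c\<lparr>pc := (if reg c r < reg c s then l else Suc (pc c))\<rparr>"

definition halted :: "instr list \<Rightarrow> config \<Rightarrow> bool" where
  "halted P c \<longleftrightarrow> length P \<le> pc c"

definition step :: "instr list \<Rightarrow> config \<Rightarrow> config" where
  "step P c = (if halted P c then c else exec_instr (P ! pc c) c)"

definition run :: "instr list \<Rightarrow> nat \<Rightarrow> config \<Rightarrow> config" where
  "run P t c = (step P ^^ t) c"

definition init_config :: "nat list \<Rightarrow> config" where
  "init_config xs = \<lparr>pc = 0, reg = (\<lambda>_. 0), mem = (\<lambda>a. if a < length xs then xs ! a else 0)\<rparr>"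

definition words_le :: "nat \<Rightarrow> config \<Rightarrow> bool" where
  "words_le w c \<longleftrightarrow> (\<forall>r. reg c r \<le> w) \<and> (\<forall>a. mem c a \<le> w)"

definition outputs :: "config \<Rightarrow> nat list \<Rightarrow> bool" where
  "outputs c ys \<longleftrightarrow> (\<forall>a < length ys. mem c a = ys ! a)"


section \<open>Encoding of instances and results\<close>

definition char_list :: "nat \<Rightarrow> nat set \<Rightarrow> nat list" where
  "char_list n I = map (\<lambda>i. of_bool (i \<in> I)) [1..<Suc n]"

text \<open>
  The group is given by a list \<open>gs\<close> of generators, each one by its table of images
  \<open>\<gamma>(1), \<dots>, \<gamma>(n)\<close>.
\<close>

definition encode_instance ::
    "nat \<Rightarrow> (nat \<Rightarrow> nat) list \<Rightarrow> nat set \<Rightarrow> nat set \<Rightarrow> nat list" where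
  "encode_instance n gs I0 I1 =
     [n, length gs] @ concat (map (\<lambda>g. map g [1..<Suc n]) gs) @ char_list n I0 @ char_list n I1"

text \<open>The first output word is the decision; the fixings follow in the non-empty case.\<close>

definition encode_result :: "nat \<Rightarrow> (nat \<Rightarrow> nat) set \<Rightarrow> nat list" where
  "encode_result n S =
     (if S = {} then [0] else 1 # char_list n (fixings n 0 S) @ char_list n (fixings n 1 S))"

end

theory Submission
  imports Defs
begin

text \<open>
  The group consists of the rotations by multiples of some \<open>d\<close>, so its constraints say that the
  word \<open>x\<close> is lexicographically maximal among these rotations. Fixing one more entry to either
  value reduces the complete set of fixings to \<open>2 n\<close> emptiness tests, and each of them takes time
  \<open>O (n ord(\<Gamma>))\<close>. In such a test, let \<open>W\<close> be the greedy lexicographic lower bound of all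
  solutions. If a solution first differs from \<open>W\<close> at \<open>k\<close>, then the word \<open>c k\<close> that agrees with
  \<open>W\<close> before \<open>k\<close>, has a one at \<open>k\<close> and as few ones as possible afterwards is a solution, too. So only
  these \<open>n + 1\<close> words (including \<open>W\<close> itself) have to be tested. For a fixed rotation by \<open>p\<close>, the
  first position \<open>q\<close> with \<open>W q \<noteq> W (q - p)\<close> decides the comparison for all \<open>k \<ge> p\<close> at once, except
  for \<open>k = q\<close>, which is compared entry by entry.
\<close>

text \<open>The obstacle is the time limit of a single test. Comparing \<open>n + 1\<close> words
  entry by entry with ord(\<Gamma>) rotations takes \<open>n ^ 2\<close> ord(\<Gamma>) steps, a
  factor \<open>n\<close> too many, so each rotation can afford only one full comparison. Rotations
  by \<open>p > k\<close> need none: the rotated \<open>c k\<close> begins with \<open>k + 1\<close>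
  entries of \<open>y p\<close>, and \<open>W\<close> dominates \<open>y p\<close> while
  \<open>c k\<close> exceeds \<open>W\<close> at \<open>k\<close>. For \<open>p \<le> k < q\<close>
  the added one turns up in the rotated word at \<open>k - p\<close>, before anything else differs,
  and \<open>c k\<close> fails. For \<open>k > q\<close> the comparison ends inside the common
  prefix of \<open>c k\<close> and \<open>W\<close>, so its outcome does not depend on
  \<open>k\<close>. For \<open>k = q\<close>, with \<open>W q = 0\<close> and
  \<open>W (q - p) = 1\<close>, the added one repairs the mismatch and the comparison goes on into
  the tail; hence the exception. Computing \<open>W\<close> stays within the limit because one flag
  per rotation records whether it still agrees with \<open>W\<close>, so that each pair of a
  position and a rotation takes constant time.\<close>

declare upt_Suc [simp del]

section \<open>Structured programs\<close>

text \<open>The first argument of \<open>While\<close> bounds the number of iterations. It only serves the cost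
  analysis and leaves no trace in the compiled program.\<close>

datatype com =
    Do instr
  | Seq com com  (infixr ";;" 60)
  | If nat nat com com
  | While nat nat nat com

fun clen :: "com \<Rightarrow> nat" where
  "clen (Do i) = 1"
| "clen (c1 ;; c2) = clen c1 + clen c2"
| "clen (If r s c1 c2) = clen c1 + clen c2 + 2"
| "clen (While N r s c) = clen c + 3"

fun compile :: "nat \<Rightarrow> com \<Rightarrow> instr list" where
  "compile b (Do i) = [i]"
| "compile b (c1 ;; c2) = compile b c1 @ compile (b + clen c1) c2"
| "compile b (If r s c1 c2) =
     JumpLess r s (b + 2 + clen c2) # compile (b + 1) c2 @
     Jump (b + 2 + clen c2 + clen c1) # compile (b + 2 + clen c2) c1"
| "compile b (While N r s c) =
     JumpLess r s (b + 2) # Jump (b + 3 + clen c) # compile (b + 2) c @ [Jump b]"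

fun cost :: "com \<Rightarrow> nat" where
  "cost (Do i) = 1"
| "cost (c1 ;; c2) = cost c1 + cost c2"
| "cost (If r s c1 c2) = max (cost c1) (cost c2) + 2"
| "cost (While N r s c) = N * (cost c + 2) + 2"

text \<open>The theorem asks for one program for all inputs, whereas the loop bounds depend on
  \<open>n\<close> and ord(\<Gamma>). Commands that agree after erasing the bounds compile to the
  same code, so each input can be analysed with bounds of its own.\<close>

fun strip :: "com \<Rightarrow> com" where
  "strip (Do i) = Do i"
| "strip (c1 ;; c2) = strip c1 ;; strip c2"
| "strip (If r s c1 c2) = If r s (strip c1) (strip c2)"
| "strip (While N r s c) = While 0 r s (strip c)"

lemma length_compile [simp]: "length (compile b c) = clen c"
  by (induction b c rule: compile.induct) auto

lemma clen_strip [simp]: "clen (strip c) = clen c"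
  by (induction c) auto

lemma compile_strip: "compile b (strip c) = compile b c"
  by (induction b c rule: compile.induct) auto

text \<open>Only additions and constants can make a word exceed its predecessors by more than one, so
  it suffices to bound their results by \<open>B\<close>.\<close>

fun wp_instr ::
    "nat \<Rightarrow> instr \<Rightarrow> ((nat \<Rightarrow> nat) \<Rightarrow> (nat \<Rightarrow> nat) \<Rightarrow> bool) \<Rightarrow> (nat \<Rightarrow> nat) \<Rightarrow> (nat \<Rightarrow> nat) \<Rightarrow> bool" where
  "wp_instr B (Const r k) Q R M \<longleftrightarrow> k \<le> B \<and> Q (R(r := k)) M"
| "wp_instr B (Copy r s) Q R M \<longleftrightarrow> Q (R(r := R s)) M"
| "wp_instr B (Inc r) Q R M \<longleftrightarrow> Q (R(r := Suc (R r))) M"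
| "wp_instr B (Add r s t) Q R M \<longleftrightarrow> R s + R t \<le> B \<and> Q (R(r := R s + R t)) M"
| "wp_instr B (Sub r s t) Q R M \<longleftrightarrow> Q (R(r := R s - R t)) M"
| "wp_instr B (Load r s) Q R M \<longleftrightarrow> Q (R(r := M (R s))) M"
| "wp_instr B (Store r s) Q R M \<longleftrightarrow> Q R (M(R r := R s))"
| "wp_instr B (Jump l) Q R M \<longleftrightarrow> False"
| "wp_instr B (JumpLess r s l) Q R M \<longleftrightarrow> False"

text \<open>A loop is unrolled \<open>N\<close> times, after which its guard has to fail. So
  \<open>wp\<close> includes termination within the annotated bounds, and this is what makes
  \<open>cost\<close> an upper bound for the running time in \<open>wp_sound\<close>.\<close>

fun wp ::
    "nat \<Rightarrow> com \<Rightarrow> ((nat \<Rightarrow> nat) \<Rightarrow> (nat \<Rightarrow> nat) \<Rightarrow> bool) \<Rightarrow> (nat \<Rightarrow> nat) \<Rightarrow> (nat \<Rightarrow> nat) \<Rightarrow> bool" where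
  "wp B (Do i) Q R M = wp_instr B i Q R M"
| "wp B (c1 ;; c2) Q R M = wp B c1 (wp B c2 Q) R M"
| "wp B (If r s c1 c2) Q R M = (if R r < R s then wp B c1 Q R M else wp B c2 Q R M)"
| "wp B (While N r s c) Q R M =
     ((\<lambda>X R M. if R r < R s then wp B c X R M else Q R M) ^^ N)
       (\<lambda>R M. \<not> R r < R s \<and> Q R M) R M"

declare wp.simps(4) [simp del]

lemma wp_mono:
  assumes "wp B c Q R M" "\<And>R M. Q R M \<Longrightarrow> Q' R M"
  shows "wp B c Q' R M"
  using assms
proof (induction c arbitrary: Q Q' R M)
  case (Do i)
  then show ?case by (cases i) auto
next
  case (Seq c1 c2)
  show ?case
    using Seq.prems(1) Seq.IH(1)[of "wp B c2 Q" R M "wp B c2 Q'"] Seq.IH(2)[of Q _ _ Q'] Seq.prems(2)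
    by auto
next
  case (If r s c1 c2)
  then show ?case by (auto split: if_splits)
next
  case (While N r s c)
  have "((\<lambda>X R M. if R r < R s then wp B c X R M else Q R M) ^^ k) (\<lambda>R M. \<not> R r < R s \<and> Q R M) R M
    \<Longrightarrow> ((\<lambda>X R M. if R r < R s then wp B c X R M else Q' R M) ^^ k) (\<lambda>R M. \<not> R r < R s \<and> Q' R M) R M"
    for k R M
  proof (induction k arbitrary: R M)
    case 0
    then show ?case using While.prems(2) by auto
  next
    case (Suc k)
    show ?case
    proof (cases "R r < R s")
      case True
      with Suc.prems have "wp B c (((\<lambda>X R M. if R r < R s then wp B c X R M else Q R M) ^^ k)
          (\<lambda>R M. \<not> R r < R s \<and> Q R M)) R M"
        by (simp only: funpow.simps comp_apply if_True)
      from While.IH[OF this Suc.IH] show ?thesis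
        using True by (simp only: funpow.simps comp_apply if_True)
    qed (use Suc.prems While.prems(2) in simp)
  qed
  then show ?case using While.prems(1) unfolding wp.simps by blast
qed

lemma wp_while:
  assumes "I R M" and "f R M \<le> N"
    and body: "\<And>R M. I R M \<Longrightarrow> R r < R s \<Longrightarrow> wp B c (\<lambda>R' M'. I R' M' \<and> f R' M' < f R M) R M"
    and exit: "\<And>R M. I R M \<Longrightarrow> \<not> R r < R s \<Longrightarrow> Q R M"
  shows "wp B (While N r s c) Q R M"
proof -
  let ?F = "\<lambda>X R M. if R r < R s then wp B c X R M else Q R M"
  \<comment> \<open>If the guard held with measure 0, the body would have to make the measure
    negative, that is, to establish an unsatisfiable postcondition. No command does so. Hence the
    guard fails once the bound is used up.\<close>
  have no: False if "I R M" "R r < R s" "f R M = 0" for R M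
  proof -
    have "wp B c (\<lambda>R' M'. False) R M"
      using body[OF that(1,2)] that(3) by (auto intro: wp_mono)
    moreover have "\<not> wp B c (\<lambda>R' M'. False) R M" for R M
    proof (induction c arbitrary: R M)
      case (Do i)
      then show ?case by (cases i) auto
    next
      case (Seq c1 c2)
      have "wp B c1 (\<lambda>R' M'. False) R M" if "wp B c1 (wp B c2 (\<lambda>R' M'. False)) R M"
        using that by (rule wp_mono) (use Seq.IH(2) in auto)
      then show ?case using Seq.IH(1) by auto
    next
      case (While N r s c)
      have "\<not> ((\<lambda>X R M. if R r < R s then wp B c X R M else False) ^^ k) (\<lambda>R M. False) R M" for k R M
      proof (induction k arbitrary: R M)
        case (Suc k)
        have "wp B c (\<lambda>R' M'. False) R M"
          if "wp B c (((\<lambda>X R M. if R r < R s then wp B c X R M else False) ^^ k) (\<lambda>R M. False)) R M"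
          using that by (rule wp_mono) (use Suc.IH in auto)
        then have "\<not> wp B c (((\<lambda>X R M. if R r < R s then wp B c X R M else False) ^^ k) (\<lambda>R M. False)) R M"
          using While by blast
        then show ?case by (simp only: funpow.simps comp_apply if_False not_False_eq_True split: if_split_asm) simp
      qed simp
      then show ?case by (simp add: wp.simps(4))
    qed auto
    ultimately show False by blast
  qed
  have "I R M \<Longrightarrow> f R M \<le> k \<Longrightarrow> (?F ^^ k) (\<lambda>R M. \<not> R r < R s \<and> Q R M) R M" for k
  proof (induction k arbitrary: R M)
    case 0
    then show ?case using no exit by fastforce
  next
    case (Suc k)
    show ?case
    proof (cases "R r < R s")
      case True
      have "wp B c ((?F ^^ k) (\<lambda>R M. \<not> R r < R s \<and> Q R M)) R M"
        using body[OF Suc.prems(1) True]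
        by (rule wp_mono) (use Suc in auto)
      then show ?thesis using True by simp
    qed (use Suc.prems exit in auto)
  qed
  then show ?thesis using assms(1,2) by (simp add: wp.simps(4))
qed

section \<open>Compilation to random access machines\<close>

definition code_at :: "instr list \<Rightarrow> nat \<Rightarrow> instr list \<Rightarrow> bool" where
  "code_at P b xs \<longleftrightarrow> (\<exists>pre post. P = pre @ xs @ post \<and> length pre = b)"

lemma code_at_append:
  assumes "code_at P b (xs @ ys)"
  shows "code_at P b xs \<and> code_at P (b + length xs) ys"
proof -
  obtain pre post where "P = pre @ (xs @ ys) @ post" "length pre = b"
    using assms unfolding code_at_def by blast
  then have "P = pre @ xs @ (ys @ post)" "P = (pre @ xs) @ ys @ post" "length (pre @ xs) = b + length xs"
    by auto
  then show ?thesis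
    using \<open>length pre = b\<close> unfolding code_at_def by blast
qed

lemma code_at_Cons:
  assumes "code_at P b (x # xs)"
  shows "b < length P \<and> P ! b = x \<and> code_at P (Suc b) xs"
proof -
  obtain pre post where P: "P = pre @ x # xs @ post" "length pre = b"
    using assms unfolding code_at_def by auto
  then have "P = (pre @ [x]) @ xs @ post" "length (pre @ [x]) = Suc b"
    by auto
  then have "code_at P (Suc b) xs"
    unfolding code_at_def by blast
  with P show ?thesis by auto
qed

text \<open>Letting the bound on words grow by one per step turns every time bound into a word
  bound: starting below \<open>V\<close>, a run of \<open>t\<close> steps stays below
  \<open>V + t\<close>. Beyond the sums checked by \<open>wp_instr\<close>, no invariant has to
  mention the size of words.\<close>

definition reaches :: "instr list \<Rightarrow> nat \<Rightarrow> nat \<Rightarrow> config \<Rightarrow> config \<Rightarrow> bool" where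
  "reaches P V t c c' \<longleftrightarrow> run P t c = c' \<and> (\<forall>s\<le>t. words_le (V + s) (run P s c))"

lemma run_add: "run P (s + t) c = run P t (run P s c)"
  unfolding run_def by (subst add.commute, simp only: funpow_add comp_apply)

lemma reaches_trans:
  assumes "reaches P V t a b" "reaches P (V + t) t' b c"
  shows "reaches P V (t + t') a c"
proof -
  have "words_le (V + s) (run P s a)" if "s \<le> t + t'" for s
  proof (cases "s \<le> t")
    case False
    then have "s = t + (s - t)" "s - t \<le> t'" using that by auto
    moreover have "run P (t + (s - t)) a = run P (s - t) b"
      using assms(1) by (simp only: run_add reaches_def)
    moreover have "words_le (V + t + (s - t)) (run P (s - t) b)"
      using assms(2) \<open>s - t \<le> t'\<close> unfolding reaches_def by blast
    ultimately show ?thesis by (metis add.assoc)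
  qed (use assms in \<open>auto simp: reaches_def\<close>)
  then show ?thesis using assms by (auto simp: reaches_def run_add)
qed

lemma reaches_step:
  assumes "pc c < length P" "exec_instr (P ! pc c) c = c'" "words_le V c" "words_le (Suc V) c'"
  shows "reaches P V 1 c c'"
  using assms by (auto simp: reaches_def run_def step_def halted_def le_Suc_eq)

lemma words_le_mono: "words_le V c \<Longrightarrow> V \<le> V' \<Longrightarrow> words_le V' c"
  unfolding words_le_def by (meson le_trans)

lemma words_le_pc [simp]:
  "words_le V \<lparr>pc = p, reg = R, mem = M\<rparr> \<longleftrightarrow> (\<forall>r. R r \<le> V) \<and> (\<forall>a. M a \<le> V)"
  by (simp add: words_le_def)

lemma reaches_words: "reaches P V t c c' \<Longrightarrow> words_le (V + t) c'"
  unfolding reaches_def by auto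

lemma reaches_instr:
  assumes "wp_instr B i Q R M" "code_at P b (i # xs)" "B \<le> V"
    and "words_le V \<lparr>pc = b, reg = R, mem = M\<rparr>"
  shows "\<exists>R' M'. Q R' M' \<and>
    reaches P V 1 \<lparr>pc = b, reg = R, mem = M\<rparr> \<lparr>pc = Suc b, reg = R', mem = M'\<rparr>"
proof -
  let ?c = "\<lparr>pc = b, reg = R, mem = M\<rparr>"
  let ?c' = "exec_instr i ?c"
  have *: "Q (reg ?c') (mem ?c')" "pc ?c' = Suc b" "words_le (Suc V) ?c'"
    using assms(1,3,4) by (cases i; auto simp: set_reg_def le_SucI trans_le_add1 le_diff_conv)+
  have "?c' = \<lparr>pc = Suc b, reg = reg ?c', mem = mem ?c'\<rparr>"
    using *(2) by simp
  then show ?thesis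
    using * assms(4) code_at_Cons[OF assms(2)] reaches_step[of ?c P ?c' V]
    by (metis config.select_convs(1))
qed

lemma reaches_Jump:
  assumes "code_at P b (Jump l # xs)" "words_le V \<lparr>pc = b, reg = R, mem = M\<rparr>"
  shows "reaches P V 1 \<lparr>pc = b, reg = R, mem = M\<rparr> \<lparr>pc = l, reg = R, mem = M\<rparr>"
  using assms code_at_Cons[OF assms(1)] by (intro reaches_step) (auto simp: le_SucI)

lemma reaches_JumpLess:
  assumes "code_at P b (JumpLess r s l # xs)" "words_le V \<lparr>pc = b, reg = R, mem = M\<rparr>"
  shows "reaches P V 1 \<lparr>pc = b, reg = R, mem = M\<rparr>
    \<lparr>pc = (if R r < R s then l else Suc b), reg = R, mem = M\<rparr>"
  using assms code_at_Cons[OF assms(1)] by (intro reaches_step) (auto simp: le_SucI)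

text \<open>Soundness of the body is a hypothesis here, so that the induction can run over the
  number \<open>k\<close> of unrollings. It generalises over \<open>V\<close>, because each round
  starts with a larger word bound.\<close>

lemma reaches_While:
  assumes IH: "\<And>Q R M b V. wp B c Q R M \<Longrightarrow> code_at P b (compile b c) \<Longrightarrow> B \<le> V \<Longrightarrow>
      words_le V \<lparr>pc = b, reg = R, mem = M\<rparr> \<Longrightarrow>
      \<exists>t R' M'. t \<le> cost c \<and> Q R' M' \<and>
        reaches P V t \<lparr>pc = b, reg = R, mem = M\<rparr> \<lparr>pc = b + clen c, reg = R', mem = M'\<rparr>"
    and code_at: "code_at P b (compile b (While N r s c))"
    and "((\<lambda>X R M. if R r < R s then wp B c X R M else Q R M) ^^ k)
           (\<lambda>R M. \<not> R r < R s \<and> Q R M) R M"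
    and "B \<le> V" "words_le V \<lparr>pc = b, reg = R, mem = M\<rparr>"
  shows "\<exists>t R' M'. t \<le> k * (cost c + 2) + 2 \<and> Q R' M' \<and>
    reaches P V t \<lparr>pc = b, reg = R, mem = M\<rparr> \<lparr>pc = b + (clen c + 3), reg = R', mem = M'\<rparr>"
proof -
  let ?F = "\<lambda>X R M. if R r < R s then wp B c X R M else Q R M"
  note prems2 = code_at[unfolded compile.simps]
  note code = code_at_Cons[OF prems2]
  note code' = code_at_Cons[OF code[THEN conjunct2, THEN conjunct2]]
  note code'' = code_at_append[OF code'[THEN conjunct2, THEN conjunct2]]
  have exit: "\<exists>t R' M'. t \<le> 2 \<and> Q R' M' \<and>
      reaches P V t \<lparr>pc = b, reg = R, mem = M\<rparr> \<lparr>pc = b + (clen c + 3), reg = R', mem = M'\<rparr>"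
    if "\<not> R r < R s" "Q R M" "words_le V \<lparr>pc = b, reg = R, mem = M\<rparr>" for R M V
  proof -
    note j = reaches_JumpLess[OF prems2 that(3)]
    note j' = reaches_Jump[OF code[THEN conjunct2, THEN conjunct2] reaches_words[OF j, simplified that(1) if_False]]
    have "reaches P V (1 + 1) \<lparr>pc = b, reg = R, mem = M\<rparr> \<lparr>pc = b + (clen c + 3), reg = R, mem = M\<rparr>"
      using reaches_trans[OF j[simplified that(1) if_False] j'] by (simp only: ac_simps)
    then show ?thesis using that(2) by (metis one_add_one order_refl)
  qed
  from assms(3-) show ?thesis
  proof (induction k arbitrary: R M V)
    case 0
    then have "\<not> R r < R s" "Q R M" by auto
    from exit[OF this 0(3)] show ?case by (simp only: mult_0 add_0)
  next
    case (Suc k)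
    show ?case
    proof (cases "R r < R s")
      case False
      then have "Q R M" using Suc.prems(1) by simp
      from exit[OF False this Suc.prems(3)] show ?thesis by (meson le_add2 le_trans)
    next
      case True
      note j = reaches_JumpLess[OF prems2 Suc.prems(3)]
      obtain t R1 M1 where 1: "t \<le> cost c" "(?F ^^ k) (\<lambda>R M. \<not> R r < R s \<and> Q R M) R1 M1"
        "reaches P (V + 1) t \<lparr>pc = b + 2, reg = R, mem = M\<rparr> \<lparr>pc = b + 2 + clen c, reg = R1, mem = M1\<rparr>"
        using IH[of "(?F ^^ k) (\<lambda>R M. \<not> R r < R s \<and> Q R M)" R M "b + 2" "V + 1"]
          Suc.prems True code'' reaches_words[OF j] by auto
      have "code_at P (b + 2 + clen c) [Jump b]"
        using code'' by simp
      note 2 = reaches_Jump[OF this reaches_words[OF 1(3)]]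
      have 3: "reaches P V (1 + t + 1) \<lparr>pc = b, reg = R, mem = M\<rparr> \<lparr>pc = b, reg = R1, mem = M1\<rparr>"
        using reaches_trans[OF reaches_trans[OF j[simplified True if_True] 1(3)]] 2 by (simp only: add.assoc)
      obtain t' R' M' where 4: "t' \<le> k * (cost c + 2) + 2" "Q R' M'"
        "reaches P (V + (1 + t + 1)) t' \<lparr>pc = b, reg = R1, mem = M1\<rparr>
           \<lparr>pc = b + (clen c + 3), reg = R', mem = M'\<rparr>"
        using Suc.IH[OF 1(2), of "V + (1 + t + 1)"] Suc.prems(2) reaches_words[OF 3] by auto
      have "1 + t + 1 + t' \<le> Suc k * (cost c + 2) + 2"
        using 1(1) 4(1) by simp
      then show ?thesis
        using 4(2) reaches_trans[OF 3 4(3)] by blast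
    qed
  qed
qed

lemma wp_sound:
  assumes "wp B c Q R M" "code_at P b (compile b c)" "B \<le> V"
    and "words_le V \<lparr>pc = b, reg = R, mem = M\<rparr>"
  shows "\<exists>t R' M'. t \<le> cost c \<and> Q R' M' \<and>
    reaches P V t \<lparr>pc = b, reg = R, mem = M\<rparr> \<lparr>pc = b + clen c, reg = R', mem = M'\<rparr>"
  using assms
proof (induction c arbitrary: Q R M b V)
  case (Do i)
  from reaches_instr[OF Do(1)[unfolded wp.simps] Do(2)[unfolded compile.simps] Do(3,4)]
  show ?case unfolding clen.simps cost.simps Suc_eq_plus1 by blast
next
  case (Seq c1 c2)
  note code = code_at_append[OF Seq.prems(2)[unfolded compile.simps]]
  obtain t1 R1 M1 where 1: "t1 \<le> cost c1" "wp B c2 Q R1 M1"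
      "reaches P V t1 \<lparr>pc = b, reg = R, mem = M\<rparr> \<lparr>pc = b + clen c1, reg = R1, mem = M1\<rparr>"
    using Seq.IH(1)[of "wp B c2 Q" R M b V] Seq.prems code by auto
  obtain t2 R2 M2 where 2: "t2 \<le> cost c2" "Q R2 M2"
      "reaches P (V + t1) t2 \<lparr>pc = b + clen c1, reg = R1, mem = M1\<rparr>
         \<lparr>pc = b + clen c1 + clen c2, reg = R2, mem = M2\<rparr>"
    using Seq.IH(2)[OF 1(2), of "b + clen c1" "V + t1"] code Seq.prems(3) reaches_words[OF 1(3)] by auto
  have "t1 + t2 \<le> cost (c1 ;; c2)"
    using 1(1) 2(1) by simp
  then show ?case
    using 2(2) reaches_trans[OF 1(3) 2(3)] unfolding clen.simps add.assoc by blast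
next
  case (If r s c1 c2)
  let ?c = "\<lambda>p. \<lparr>pc = p, reg = R, mem = M\<rparr>"
  note code = code_at_Cons[OF If.prems(2)[unfolded compile.simps]]
  note code' = code_at_append[OF code[THEN conjunct2, THEN conjunct2]]
  note code'' = code_at_Cons[OF code'[THEN conjunct2]]
  note j = reaches_JumpLess[OF If.prems(2)[unfolded compile.simps] If.prems(4)]
  show ?case
  proof (cases "R r < R s")
    case True
    obtain t R' M' where *: "t \<le> cost c1" "Q R' M'"
      "reaches P (V + 1) t (?c (b + 2 + clen c2)) \<lparr>pc = b + 2 + clen c2 + clen c1, reg = R', mem = M'\<rparr>"
      using If.IH(1)[of Q R M "b + 2 + clen c2" "V + 1"] If.prems code'' True reaches_words[OF j] by auto
    note reaches_trans[OF j[simplified True if_True] *(3)]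
    then have "reaches P V (1 + t) (?c b) \<lparr>pc = b + clen (If r s c1 c2), reg = R', mem = M'\<rparr>"
      by (simp only: clen.simps ac_simps)
    moreover have "1 + t \<le> cost (If r s c1 c2)"
      using *(1) by simp
    ultimately show ?thesis
      using *(2) by blast
  next
    case False
    obtain t R' M' where *: "t \<le> cost c2" "Q R' M'"
      "reaches P (V + 1) t (?c (Suc b)) \<lparr>pc = b + 1 + clen c2, reg = R', mem = M'\<rparr>"
      using If.IH(2)[of Q R M "b + 1" "V + 1"] If.prems code' False reaches_words[OF j] by auto
    have "code_at P (b + 1 + clen c2) (Jump (b + 2 + clen c2 + clen c1) # compile (b + 2 + clen c2) c1)"
      using code' by simp
    from reaches_Jump[OF this reaches_words[OF *(3)]]
    have "reaches P (V + (1 + t)) 1 \<lparr>pc = b + 1 + clen c2, reg = R', mem = M'\<rparr>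
       \<lparr>pc = b + 2 + clen c2 + clen c1, reg = R', mem = M'\<rparr>"
      by (simp only: add.assoc)
    note reaches_trans[OF reaches_trans[OF j[simplified False if_False] *(3)] this]
    then have "reaches P V (1 + t + 1) (?c b) \<lparr>pc = b + clen (If r s c1 c2), reg = R', mem = M'\<rparr>"
      by (simp only: clen.simps ac_simps)
    moreover have "1 + t + 1 \<le> cost (If r s c1 c2)"
      using *(1) by simp
    ultimately show ?thesis
      using *(2) by blast
  qed
next
  case (While N r s c)
  from reaches_While[OF While.IH While.prems(2) While.prems(1)[unfolded wp.simps] While.prems(3,4)]
  show ?case unfolding cost.simps clen.simps .
qed

section \<open>Words that are lexicographically maximal among their rotations\<close>

definition lexge :: "nat \<Rightarrow> (nat \<Rightarrow> nat) \<Rightarrow> (nat \<Rightarrow> nat) \<Rightarrow> bool" where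
  "lexge n x y \<longleftrightarrow> (\<forall>i<n. (\<forall>j<i. x j = y j) \<longrightarrow> y i \<le> x i)"

text \<open>For \<open>p + i < 2 * n\<close> this is the index modulo \<open>n\<close>, in the form
  in which the machine computes it: one comparison and one subtraction.\<close>

definition rot :: "nat \<Rightarrow> nat \<Rightarrow> (nat \<Rightarrow> nat) \<Rightarrow> nat \<Rightarrow> nat" where
  "rot n p x i = x (if p + i < n then p + i else p + i - n)"

definition shifts :: "nat \<Rightarrow> nat \<Rightarrow> nat set" where
  "shifts n d = {p. d dvd p \<and> 0 < p \<and> p < n}"

definition lexmax_box ::
    "nat \<Rightarrow> nat \<Rightarrow> (nat \<Rightarrow> nat) \<Rightarrow> (nat \<Rightarrow> nat) \<Rightarrow> (nat \<Rightarrow> nat) set" where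
  "lexmax_box n d l h = {x. (\<forall>i<n. l i \<le> x i \<and> x i \<le> h i) \<and> (\<forall>p\<in>shifts n d. lexge n x (rot n p x))}"

lemma lexgeD: "lexge n x y \<Longrightarrow> i < n \<Longrightarrow> (\<And>j. j < i \<Longrightarrow> x j = y j) \<Longrightarrow> y i \<le> x i"
  unfolding lexge_def by blast

lemma not_lexge:
  assumes "\<not> lexge n x y"
  obtains i where "i < n" "x i < y i" "\<And>j. j < i \<Longrightarrow> x j = y j"
  using assms unfolding lexge_def by (auto simp: not_le)

lemma lexge_first_diff:
  assumes "i < n" "\<And>j. j < i \<Longrightarrow> x j = y j" "x i \<noteq> y i"
  shows "lexge n x y \<longleftrightarrow> y i < x i"
proof
  assume "lexge n x y"
  then show "y i < x i" using assms lexgeD[of n x y i] by fastforce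
next
  assume *: "y i < x i"
  show "lexge n x y"
  proof (rule ccontr)
    assume "\<not> lexge n x y"
    then obtain i' where i': "i' < n" "x i' < y i'" "\<And>j. j < i' \<Longrightarrow> x j = y j"
      by (rule not_lexge) auto
    then show False using assms * by (cases i i' rule: linorder_cases) auto
  qed
qed

text \<open>The greedy word \<open>W\<close> is the lexicographically least word that every solution has to dominate:
  each entry is the least one compatible with the forced ones of the rotations that still agree
  with it. A rotation by \<open>p\<close> contributes the lower bound \<open>l\<close> before it wraps around and \<open>W\<close> itself
  afterwards.\<close>

locale greedy =
  fixes n d :: nat and l h W :: "nat \<Rightarrow> nat"
  assumes l_le_h: "\<And>i. i < n \<Longrightarrow> l i \<le> h i"
    and h_le_1: "\<And>i. i < n \<Longrightarrow> h i \<le> 1"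
    and W_le_1: "\<And>i. i < n \<Longrightarrow> W i \<le> 1"
    and W_eq_1: "\<And>i. i < n \<Longrightarrow> W i = 1 \<longleftrightarrow> l i = 1 \<or>
      (\<exists>p\<in>shifts n d. (\<forall>j<i. (if p + j < n then l (p + j) else W (p + j - n)) = W j) \<and>
        (if p + i < n then l (p + i) else W (p + i - n)) = 1)"
begin

definition y :: "nat \<Rightarrow> nat \<Rightarrow> nat" where
  "y p i = (if p + i < n then l (p + i) else W (p + i - n))"

lemma W_eq_1_iff:
  "i < n \<Longrightarrow> W i = 1 \<longleftrightarrow> l i = 1 \<or> (\<exists>p\<in>shifts n d. (\<forall>j<i. y p j = W j) \<and> y p i = 1)"
  using W_eq_1[of i] by (simp only: y_def)

definition c :: "nat \<Rightarrow> nat \<Rightarrow> nat" where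
  "c k i = (if i < k then W i else if i = k then 1 else l i)"

text \<open>A solution that leaves \<open>W\<close> at \<open>k\<close> lies above it, so it has a
  one where \<open>W\<close> has a zero. The value \<open>k = n\<close> stands for \<open>W\<close>
  itself.\<close>

definition cand :: "nat \<Rightarrow> bool" where
  "cand k \<longleftrightarrow> (\<forall>i<k. W i \<le> h i) \<and> (k < n \<longrightarrow> W k = 0 \<and> h k = 1)"

lemma l_le_1: "i < n \<Longrightarrow> l i \<le> 1"
  using l_le_h h_le_1 le_trans by blast

lemma l_le_W: "i < n \<Longrightarrow> l i \<le> W i"
  using l_le_1[of i] W_eq_1[of i] by (cases "l i = 1") auto

lemma y_le_1: "p < n \<Longrightarrow> i < n \<Longrightarrow> y p i \<le> 1"
  using l_le_1 W_le_1 by (auto simp: y_def)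

text \<open>Agreement before \<open>i\<close> is exactly the condition under which the rotation by
  \<open>p\<close> may raise \<open>W i\<close>, so \<open>y p i = 1\<close> forces
  \<open>W i = 1\<close>.\<close>

lemma lexge_W_y:
  assumes "p \<in> shifts n d" "i < n" "\<And>j. j < i \<Longrightarrow> W j = y p j"
  shows "y p i \<le> W i"
proof (cases "y p i = 1")
  case True
  moreover have "\<forall>j<i. y p j = W j" using assms(3) by simp
  ultimately have "W i = 1" using assms(1) W_eq_1_iff[OF assms(2)] by blast
  then show ?thesis using True by simp
next
  case False
  then show ?thesis using y_le_1[of p i] assms(1,2) unfolding shifts_def by auto
qed

lemma shifts_less: "p \<in> shifts n d \<Longrightarrow> 0 < p \<and> p < n"
  by (simp add: shifts_def)

text \<open>If the rotation by \<open>p\<close> is responsible for \<open>W i = 1\<close>, then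
  \<open>rot n p x\<close> lies pointwise above \<open>y p\<close> up to \<open>i\<close>: before
  the wrap because of the lower bound \<open>l\<close>, afterwards because \<open>x\<close> equals
  \<open>W\<close> there. Since \<open>y p\<close> agrees with \<open>W\<close>, hence with
  \<open>x\<close>, before \<open>i\<close>, the lexicographic constraint squeezes
  \<open>rot n p x\<close> to equality there and bounds its entry at \<open>i\<close> by
  \<open>x i\<close>.\<close>

lemma solution_ge_W:
  assumes x: "x \<in> lexmax_box n d l h" and i: "i < n" and eq: "\<And>j. j < i \<Longrightarrow> x j = W j"
  shows "W i \<le> x i"
proof (cases "W i = 1")
  case True
  have box: "\<And>i. i < n \<Longrightarrow> l i \<le> x i" and
    ge: "\<And>p. p \<in> shifts n d \<Longrightarrow> lexge n x (rot n p x)"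
    using x by (auto simp: lexmax_box_def)
  from True W_eq_1_iff[OF i] consider "l i = 1"
    | p where "p \<in> shifts n d" "\<forall>j<i. y p j = W j" "y p i = 1" by blast
  then show ?thesis
  proof cases
    case 1
    then show ?thesis using box[OF i] True by simp
  next
    case 2
    note p = shifts_less[OF 2(1)]
    have y_le: "y p j \<le> rot n p x j" if "j \<le> i" for j
      using p i that box[of "p + j"] eq[of "p + j - n"] by (auto simp: rot_def y_def)
    have "x j = rot n p x j" if "j < i" for j
      using that
    proof (induction j rule: less_induct)
      case (less j)
      have "rot n p x j \<le> x j"
        using lexgeD[OF ge[OF 2(1)], of j] less i by auto
      moreover have "x j \<le> rot n p x j"
        using y_le[of j] 2(2) less.prems eq[OF less.prems] by simp
      ultimately show ?case by simp
    qed
    then have "rot n p x i \<le> x i"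
      using lexgeD[OF ge[OF 2(1)] i] by auto
    then show ?thesis using y_le[of i] 2(3) True by linarith
  qed
next
  case False
  then show ?thesis using W_le_1[OF i] by linarith
qed

lemma c_in_box:
  assumes "cand k" "i < n"
  shows "l i \<le> c k i \<and> c k i \<le> h i"
proof -
  consider "i < k" | "i = k" | "k < i" by linarith
  then show ?thesis
    using assms l_le_W l_le_1[OF assms(2)] l_le_h by cases (auto simp: c_def cand_def)
qed

lemma c_le_1: "cand k \<Longrightarrow> i < n \<Longrightarrow> c k i \<le> 1"
  using c_in_box h_le_1 le_trans by blast

text \<open>Before the wrap the positions \<open>p + i\<close> lie beyond \<open>k\<close>, where
  \<open>c k\<close> is \<open>l\<close>; after it they lie strictly below \<open>k\<close>, where
  it is \<open>W\<close>.\<close>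

lemma rot_c_eq_y:
  assumes "p \<in> shifts n d" "k < p" "i \<le> k" "k < n"
  shows "rot n p (c k) i = y p i"
  using assms shifts_less[OF assms(1)] by (auto simp: rot_def c_def y_def)

text \<open>On its first \<open>k + 1\<close> entries the rotation equals \<open>y p\<close>, which \<open>W\<close> dominates and thus \<open>c k\<close>
  exceeds.\<close>

lemma lexge_c_late:
  assumes "cand k" "k < n" "p \<in> shifts n d" "k < p"
  shows "lexge n (c k) (rot n p (c k))"
proof (rule ccontr)
  assume "\<not> ?thesis"
  then obtain i where i: "i < n" "c k i < rot n p (c k) i"
      "\<And>j. j < i \<Longrightarrow> c k j = rot n p (c k) j"
    by (rule not_lexge) auto
  have r: "rot n p (c k) j = y p j" if "j \<le> k" for j
    using rot_c_eq_y[OF assms(3,4) that assms(2)] .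
  have W0: "W k = 0" using assms(1,2) by (simp add: cand_def)
  show False
  proof (cases "i < k")
    case True
    have "W j = y p j" if "j < i" for j
      using i(3)[OF that] r[of j] that True by (simp add: c_def)
    from lexge_W_y[OF assms(3) i(1) this] show False
      using i(2) r[of i] True by (simp add: c_def)
  next
    case False
    have *: "W j = y p j" if "j < k" for j
      using i(3)[of j] r[of j] that False by (simp add: c_def)
    have "y p k \<le> W k" by (rule lexge_W_y[OF assms(3,2) *])
    then have "rot n p (c k) k = 0" using r[of k] W0 by simp
    moreover have "c k k = 1" by (simp add: c_def)
    ultimately show False using i(2) i(3)[of k] False by (cases "i = k") auto
  qed
qed

text \<open>Lowering the tail of \<open>x\<close> preserves all constraints. Rotations by more than
  \<open>k\<close> are covered by \<open>lexge_c_late\<close>. For \<open>p \<le> k\<close>, the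
  pointwise bound \<open>c k \<le> x\<close>, with equality up to \<open>k\<close>, pushes any
  violation beyond \<open>k\<close>; the period \<open>p\<close> of \<open>c k\<close> before it
  then moves it to a rotation by more than \<open>k\<close>, or else determines \<open>x\<close>
  completely.\<close>

lemma c_solution:
  assumes x: "x \<in> lexmax_box n d l h" and k: "k < n"
    and eq: "\<And>j. j < k \<Longrightarrow> x j = W j" and neq: "x k \<noteq> W k"
  shows "cand k" and "\<forall>p\<in>shifts n d. lexge n (c k) (rot n p (c k))"
proof -
  have box: "\<And>i. i < n \<Longrightarrow> l i \<le> x i \<and> x i \<le> h i" and
    ge: "\<And>p. p \<in> shifts n d \<Longrightarrow> lexge n x (rot n p x)"
    using x by (auto simp: lexmax_box_def)
  have xk: "x k = 1" "W k = 0" "h k = 1"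
    using solution_ge_W[OF x k eq] neq box[OF k] h_le_1[OF k] W_le_1[OF k] by auto
  show cand: "cand k"
    using xk eq box k unfolding cand_def by (metis less_trans)
  have c_le_x: "c k i \<le> x i" if "i < n" for i
    using that eq box xk by (auto simp: c_def)
  have c_eq_x: "c k i = x i" if "i \<le> k" for i
    using that eq xk by (auto simp: c_def)
  show "\<forall>p\<in>shifts n d. lexge n (c k) (rot n p (c k))"
  proof (rule ballI, rule ccontr)
    fix p assume p: "p \<in> shifts n d" and "\<not> lexge n (c k) (rot n p (c k))"
    then obtain i where i: "i < n" "c k i < rot n p (c k) i"
        "\<And>j. j < i \<Longrightarrow> c k j = rot n p (c k) j"
      by (auto elim: not_lexge)
    note p' = shifts_less[OF p]
    have "p \<le> k"
      using lexge_c_late[OF cand k p] \<open>\<not> lexge n (c k) (rot n p (c k))\<close> by linarith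
    have rot_le: "rot n p (c k) j \<le> rot n p x j" if "j < n" for j
      using c_le_x[of "p + j"] c_le_x[of "p + j - n"] that p' by (auto simp: rot_def)
    \<comment> \<open>The chain is \<open>x j = c k j \<le> rot n p (c k) j \<le> rot n p x j \<le>
      x j\<close>; its last inequality needs agreement before \<open>j\<close>, hence the
      induction.\<close>
    have x_rot: "x j = rot n p x j" if "j \<le> k" "j \<le> i" for j
      using that
    proof (induction j rule: less_induct)
      case (less j)
      have "rot n p x j \<le> x j"
        using lexgeD[OF ge[OF p], of j] less i(1) by auto
      moreover have "c k j \<le> rot n p (c k) j"
        using i less.prems by (cases "j = i") auto
      ultimately show ?case
        using rot_le[of j] c_eq_x[OF less.prems(1)] less.prems i(1) by linarith
    qed
    have "k < i"
    proof (rule ccontr)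
      assume "\<not> k < i"
      then show False
        using x_rot[of i] rot_le[OF i(1)] i(2) c_eq_x[of i] by simp
    qed
    have ci: "c k i = 0" "rot n p (c k) i = 1"
    proof -
      have "p + i - n < n" using p' i(1) by linarith
      then have "rot n p (c k) i \<le> 1"
        using c_le_1[OF cand, of "p + i"] c_le_1[OF cand, of "p + i - n"] by (auto simp: rot_def)
      then show "c k i = 0" "rot n p (c k) i = 1" using i(2) by linarith+
    qed
    have step: "c k (if p + j < n then p + j else p + j - n) = c k j" if "j < i" for j
      using i(3)[OF that] by (simp add: rot_def)
    \<comment> \<open>\<open>p + q\<close> is the least multiple of \<open>p\<close> beyond \<open>k\<close>. Up to \<open>i\<close> the word \<open>c k\<close> has period \<open>p\<close>, so
      a violation by the rotation by \<open>p\<close> shifts to one by the rotation by \<open>p + q\<close>.\<close>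
    define q where "q = p * (k div p)"
    have q: "q \<le> k" "k < q + p" "p dvd q"
      using p' mult_div_mod_eq[of p k] mod_less_divisor[of p k] unfolding q_def by (linarith+, simp)
    have chain: "c k (q + t) = c k t" if "q + t \<le> i" for t
    proof -
      have "c k (p * m + t) = c k t" if "p * m + t \<le> i" for m
        using that
      proof (induction m)
        case (Suc m)
        then have "p * m + t < i" "p * m + t + p < n" using i(1) p' by (auto simp: algebra_simps)
        then show ?case using step[of "p * m + t"] Suc by (simp add: algebra_simps)
      qed simp
      then show ?thesis using that unfolding q_def by blast
    qed
    show False
    proof (cases "p + q < n")
      case True
      have q': "p + q \<in> shifts n d"
        using True p q(3) p' unfolding shifts_def by (auto intro: dvd_trans)
      define T where "T = i - q"
      have T: "q + T = i" using \<open>k < i\<close> q unfolding T_def by simp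
      have rotq: "rot n (p + q) (c k) t = rot n p (c k) (q + t)" for t
        by (simp add: rot_def add.assoc)
      have before: "rot n (p + q) (c k) t = c k t" if "t < T" for t
        using i(3)[of "q + t"] chain[of t] that T rotq by simp
      have at: "rot n (p + q) (c k) T = 1" "c k T = 0"
        using ci rotq[of T] chain[of T] T by auto
      from lexge_c_late[OF cand k q'] q have "lexge n (c k) (rot n (p + q) (c k))" by simp
      from lexgeD[OF this, of T] show False
        using before at T i(1) by auto
    next
      case False
      \<comment> \<open>Now \<open>n \<le> p + k\<close>, so every position beyond \<open>k\<close>
        is one period after a position up to \<open>k\<close>. Both words have this period, hence
        they coincide and \<open>x\<close> would violate its own constraint.\<close>
      have x_eq_c: "x j = c k j" if j: "j < n" for j
      proof (cases "j \<le> k")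
        case True
        then show ?thesis using c_eq_x by simp
      next
        case F: False
        then have "p \<le> j" "j - p \<le> k" using \<open>p \<le> k\<close> q j False by auto
        then have "x j = rot n p x (j - p)" "c k j = rot n p (c k) (j - p)"
          using j by (auto simp: rot_def)
        then show ?thesis
          using x_rot[of "j - p"] i(3)[of "j - p"] c_eq_x[of "j - p"] \<open>j - p \<le> k\<close> \<open>k < i\<close> by simp
      qed
      have "rot n p x j = rot n p (c k) j" if "j < n" for j
        using x_eq_c that p' by (auto simp: rot_def)
      moreover have "rot n p x i \<le> x i"
        using calculation x_eq_c i(1,3) by (intro lexgeD[OF ge[OF p]]) auto
      ultimately show False
        using i(1,2) x_eq_c by simp
    qed
  qed
qed

lemma c_n: "i < n \<Longrightarrow> c n i = W i"
  by (simp add: c_def)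

theorem lexmax_box_nonempty_iff:
  "lexmax_box n d l h \<noteq> {} \<longleftrightarrow>
   (\<exists>k\<le>n. cand k \<and> (\<forall>p\<in>shifts n d. p \<le> k \<longrightarrow> lexge n (c k) (rot n p (c k))))"
proof
  assume "lexmax_box n d l h \<noteq> {}"
  then obtain x where x: "x \<in> lexmax_box n d l h" by blast
  show "\<exists>k\<le>n. cand k \<and> (\<forall>p\<in>shifts n d. p \<le> k \<longrightarrow> lexge n (c k) (rot n p (c k)))"
  proof (cases "\<exists>k<n. x k \<noteq> W k")
    case True
    then obtain k where "k < n" "x k \<noteq> W k" "\<And>j. j < k \<Longrightarrow> x j = W j"
      using exists_least_iff[of "\<lambda>k. k < n \<and> x k \<noteq> W k"] by (metis less_trans)
    from c_solution[OF x this(1,3,2)] \<open>k < n\<close> show ?thesis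
      by (intro exI[of _ k]) auto
  next
    case False
    have "cand n"
      using x False by (auto simp: cand_def lexmax_box_def)
    moreover have "lexge n (c n) (rot n p (c n))" if p: "p \<in> shifts n d" for p
    proof -
      have "lexge n x (rot n p x)" using x p by (auto simp: lexmax_box_def)
      moreover have "\<forall>i<n. c n i = x i \<and> rot n p (c n) i = rot n p x i"
        using False c_n shifts_less[OF p] by (auto simp: rot_def)
      ultimately show ?thesis unfolding lexge_def by (metis less_trans)
    qed
    ultimately show ?thesis by auto
  qed
next
  assume "\<exists>k\<le>n. cand k \<and> (\<forall>p\<in>shifts n d. p \<le> k \<longrightarrow> lexge n (c k) (rot n p (c k)))"
  then obtain k where k: "k \<le> n" "cand k" "\<forall>p\<in>shifts n d. p \<le> k \<longrightarrow> lexge n (c k) (rot n p (c k))"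
    by blast
  have "lexge n (c k) (rot n p (c k))" if "p \<in> shifts n d" for p
    using k lexge_c_late[OF k(2) _ that] shifts_less[OF that] that by (cases "p \<le> k") auto
  then have "c k \<in> lexmax_box n d l h"
    using c_in_box[OF k(2)] by (auto simp: lexmax_box_def)
  then show "lexmax_box n d l h \<noteq> {}" by blast
qed

lemma rot_c_overlap:
  assumes "p + i < k" "k \<le> n"
  shows "rot n p (c k) i = W (p + i)"
  using assms by (simp add: rot_def c_def)

text \<open>At \<open>k - p\<close> the rotated word shows the added one, while \<open>c k\<close>
  still has \<open>W (k - p) = W k = 0\<close>.\<close>

lemma not_lexge_c_before_mismatch:
  assumes "cand k" "0 < p" "p \<le> k" "k < n" and eq: "\<And>j. p \<le> j \<Longrightarrow> j \<le> k \<Longrightarrow> W j = W (j - p)"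
  shows "\<not> lexge n (c k) (rot n p (c k))"
proof
  assume ge: "lexge n (c k) (rot n p (c k))"
  have "c k j = rot n p (c k) j" if "j < k - p" for j
  proof -
    have "p + j < k" using that by linarith
    then show ?thesis
      using eq[of "p + j"] rot_c_overlap[of p j k] assms(4) by (simp add: c_def)
  qed
  from lexgeD[OF ge _ this] have "rot n p (c k) (k - p) \<le> c k (k - p)"
    using assms(4) by simp
  moreover have "rot n p (c k) (k - p) = 1"
    using assms(3,4) by (simp add: rot_def c_def)
  moreover have "c k (k - p) = W k"
    using assms(2,3) eq[of k] by (simp add: c_def)
  ultimately show False
    using assms(1,4) by (simp add: cand_def)
qed

text \<open>Up to \<open>q - p\<close> both words only read entries of \<open>W\<close> before
  \<open>k\<close>, so the first difference is \<open>W (q - p)\<close> against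
  \<open>W q\<close>.\<close>

lemma lexge_c_after_mismatch:
  assumes "0 < p" "p \<le> q" "q < k" "k \<le> n"
    and eq: "\<And>j. p \<le> j \<Longrightarrow> j < q \<Longrightarrow> W j = W (j - p)" and neq: "W q \<noteq> W (q - p)"
  shows "lexge n (c k) (rot n p (c k)) \<longleftrightarrow> W q = 0"
proof -
  have r: "rot n p (c k) j = W (p + j)" "c k j = W j" if "j \<le> q - p" for j
  proof -
    have "p + j < k" "j < k" using that assms(2,3) by linarith+
    then show "rot n p (c k) j = W (p + j)" "c k j = W j"
      using rot_c_overlap[of p j k] assms(4) by (simp_all add: c_def)
  qed
  have "c k j = rot n p (c k) j" if "j < q - p" for j
    using r[of j] eq[of "p + j"] that by simp
  moreover have "c k (q - p) \<noteq> rot n p (c k) (q - p)"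
    using r[of "q - p"] neq assms(2) by simp
  ultimately have "lexge n (c k) (rot n p (c k)) \<longleftrightarrow> rot n p (c k) (q - p) < c k (q - p)"
    using assms(3,4) by (intro lexge_first_diff) auto
  moreover have "rot n p (c k) (q - p) = W q" "c k (q - p) = W (q - p)"
    using r[of "q - p"] assms(2) by simp_all
  moreover have "W q \<le> 1" "W (q - p) \<le> 1"
    using W_le_1[of q] W_le_1[of "q - p"] assms(3,4) by simp_all
  ultimately show ?thesis
    using neq by linarith
qed

end

section \<open>Subgroups of the group generated by the full cycle\<close>

definition rotation :: "nat \<Rightarrow> nat \<Rightarrow> nat \<Rightarrow> nat" where
  "rotation n k = full_cycle n ^^ k"

lemma rotation_0 [simp]: "rotation n 0 = id"
  by (simp add: rotation_def)

lemma rotation_1: "rotation n 1 = full_cycle n"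
  by (simp add: rotation_def)

lemma rotation_n [simp]: "rotation n n = id"
  using cycle_is_id_root[of "[1..<Suc n]"] by (simp add: rotation_def)

lemma rotation_add: "rotation n (a + b) = rotation n a \<circ> rotation n b"
  by (simp add: rotation_def funpow_add)

lemma rotation_apply:
  assumes "i < n"
  shows "rotation n k (Suc i) = Suc ((k + i) mod n)"
proof -
  have "map (rotation n k) [1..<Suc n] ! i = rotate k [1..<Suc n] ! i"
    unfolding rotation_def by (subst cyclic_rotation) simp_all
  moreover have "(k + i) mod n < n" using assms by simp
  ultimately show ?thesis
    using assms by (simp add: nth_rotate)
qed

lemma rotation_permutes: "rotation n k permutes {1..n}"
proof (induction k)
  case (Suc k)
  have "full_cycle n permutes {1..n}"
    using cycle_permutes[of "[1..<Suc n]"] by (simp only: set_upt atLeastLessThanSuc_atLeastAtMost)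
  with Suc show ?case
    unfolding rotation_def funpow.simps by (rule permutes_compose)
qed (simp only: rotation_0 permutes_id)

lemma inv_rotation:
  assumes "k \<le> n"
  shows "inv' (rotation n k) = rotation n (n - k)"
proof (rule inv_unique_comp)
  show "rotation n k \<circ> rotation n (n - k) = id" "rotation n (n - k) \<circ> rotation n k = id"
    using assms by (simp_all flip: rotation_add)
qed

lemma rotation_mod: "rotation n (k mod n) = rotation n k"
proof -
  have "rotation n (n * j) = id" for j
    by (induction j) (simp_all add: rotation_add)
  then have "rotation n (n * (k div n) + k mod n) = rotation n (k mod n)"
    by (simp only: rotation_add id_comp)
  then show ?thesis by simp
qed

text \<open>A generator that rotates by \<open>k\<close> has \<open>1\<close> mapped to \<open>k + 1\<close>; the number \<open>n + 1 - (k + 1)\<close> is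
  congruent to \<open>- k\<close> modulo \<open>n\<close> and, unlike \<open>k\<close>, never \<open>0\<close>.\<close>

fun period :: "nat \<Rightarrow> (nat \<Rightarrow> nat) list \<Rightarrow> nat \<Rightarrow> nat" where
  "period n gs 0 = n"
| "period n gs (Suc r) = gcd (period n gs r) (n + 1 - (gs ! r) 1)"

lemma period_dvd_n: "period n gs r dvd n"
  by (induction r) (auto intro: dvd_trans)

lemma period_dvd: "r < s \<Longrightarrow> period n gs s dvd n + 1 - (gs ! r) 1"
  by (induction s) (auto simp: less_Suc_eq intro: dvd_trans)

text \<open>Euclid's algorithm on natural numbers only uses
  \<open>a mod b = a - (a div b) * b\<close>, so sums and non-negative differences suffice. It is
  applied to the exponents of the rotations in \<Gamma> and avoids negative Bezout
  coefficients.\<close>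

lemma closed_gcd:
  fixes A :: "nat set"
  assumes zero: "0 \<in> A" and add: "\<And>a b. a \<in> A \<Longrightarrow> b \<in> A \<Longrightarrow> a + b \<in> A"
    and diff: "\<And>a b. a \<in> A \<Longrightarrow> b \<in> A \<Longrightarrow> b \<le> a \<Longrightarrow> a - b \<in> A"
  shows "a \<in> A \<Longrightarrow> b \<in> A \<Longrightarrow> gcd a b \<in> A"
proof (induction a b rule: gcd_nat_induct)
  case (step a b)
  have "k * b \<in> A" for k
    using step.prems zero add by (induction k) auto
  from diff[OF step.prems(1) this[of "a div b"]] have "a mod b \<in> A"
    by (simp add: minus_div_mult_eq_mod)
  then show ?case using step gcd_red_nat[of a b] by simp
qed simp

context
  fixes n :: nat and \<Gamma> :: "(nat \<Rightarrow> nat) set" and gs :: "(nat \<Rightarrow> nat) list"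
  assumes n: "1 \<le> n" and subgroup: "subgroup \<Gamma> (sym_group n)"
    and cyclic: "\<Gamma> \<subseteq> generate (sym_group n) {full_cycle n}"
    and gen: "generate (sym_group n) (set gs) = \<Gamma>"
begin

text \<open>A power of the cycle is determined by the image of 1. Therefore the program reads only
  the first entry of each generator table.\<close>

private lemma powers:
  assumes "g \<in> \<Gamma>"
  shows "1 \<le> g 1" "g 1 \<le> n" "g = rotation n (g 1 - 1)"
proof -
  have "\<exists>k. g = rotation n k"
    using subsetD[OF cyclic assms]
  proof (induction rule: generate.induct)
    case one
    then show ?case by (intro exI[of _ 0]) (simp add: sym_group_one)
  next
    case (incl h)
    then show ?case by (intro exI[of _ 1]) (simp only: rotation_1 singleton_iff)
  next
    case (inv h)
    have "h = rotation n 1" using inv by (simp only: rotation_1 singleton_iff)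
    moreover have "h \<in> carrier (sym_group n)"
      using rotation_permutes[of n 1] calculation by (simp add: sym_group_carrier)
    ultimately show ?case using inv_rotation[OF n] by auto
  next
    case (eng h1 h2)
    then show ?case unfolding sym_group_mult by (metis rotation_add)
  qed
  then obtain k where k: "g = rotation n k" by blast
  then have "g 1 = Suc (k mod n)" using rotation_apply[of 0 n k] n by simp
  moreover have "k mod n < n" using n by simp
  ultimately show "1 \<le> g 1" "g 1 \<le> n" "g = rotation n (g 1 - 1)"
    using n k rotation_mod[of n k] mod_less_divisor[of n k] by (auto simp: Suc_le_eq)
qed

lemma generator_image_bounds: "r < length gs \<Longrightarrow> 1 \<le> (gs ! r) 1 \<and> (gs ! r) 1 \<le> n"
  using powers[of "gs ! r"] generate.incl[of "gs ! r" "set gs"] gen by auto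

private lemma exponents_diff:
  assumes "rotation n a \<in> \<Gamma>" "rotation n b \<in> \<Gamma>" "b \<le> a"
  shows "rotation n (a - b) \<in> \<Gamma>"
proof -
  have carrier: "rotation n b \<in> carrier (sym_group n)"
    using rotation_permutes by (simp add: sym_group_carrier)
  have "rotation n a = rotation n (a - b) \<circ> rotation n b"
    using assms(3) by (simp flip: rotation_add)
  moreover have "rotation n b \<circ> inv' (rotation n b) = id"
    using permutes_inv_o(1)[OF rotation_permutes] .
  ultimately have "rotation n (a - b) = rotation n a \<circ> inv' (rotation n b)"
    by (simp only: comp_assoc comp_id)
  then show ?thesis
    using subgroup.m_closed[OF subgroup assms(1) subgroup.m_inv_closed[OF subgroup assms(2)]] carrier
    by (simp add: sym_group_mult)
qed

private lemma period_exponent: "r \<le> length gs \<Longrightarrow> rotation n (period n gs r) \<in> \<Gamma>"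
proof (induction r)
  case 0
  then show ?case
    using subgroup.one_closed[OF subgroup] by (simp only: period.simps rotation_n sym_group_one)
next
  case (Suc r)
  have id: "id \<in> \<Gamma>" using subgroup.one_closed[OF subgroup] by (simp add: sym_group_one)
  have g: "gs ! r \<in> \<Gamma>" using Suc.prems generate.incl[of "gs ! r" "set gs"] gen by auto
  \<comment> \<open>This is the inverse of the generator, obtained as the exponent \<open>n\<close>
    of the identity minus the exponent of the generator.\<close>
  have "rotation n (n - ((gs ! r) 1 - 1)) \<in> \<Gamma>"
    using exponents_diff[of n "(gs ! r) 1 - 1"] powers[OF g] g id
    by (simp add: rotation_n)
  moreover have "n - ((gs ! r) 1 - 1) = n + 1 - (gs ! r) 1"
    using powers(1)[OF g] by simp
  ultimately have "rotation n (n + 1 - (gs ! r) 1) \<in> \<Gamma>" by simp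
  moreover have "rotation n (period n gs r) \<in> \<Gamma>" using Suc by simp
  ultimately have "gcd (period n gs r) (n + 1 - (gs ! r) 1) \<in> {k. rotation n k \<in> \<Gamma>}"
  proof (intro closed_gcd)
    fix a b assume ab: "a \<in> {k. rotation n k \<in> \<Gamma>}" "b \<in> {k. rotation n k \<in> \<Gamma>}"
    then show "a + b \<in> {k. rotation n k \<in> \<Gamma>}"
      using subgroup.m_closed[OF subgroup] by (simp only: mem_Collect_eq rotation_add sym_group_mult)
    show "a - b \<in> {k. rotation n k \<in> \<Gamma>}" if "b \<le> a"
      using ab that exponents_diff by blast
  qed (simp_all only: mem_Collect_eq rotation_0 id)
  then show ?case by simp
qed

lemma group_eq_powers: "\<Gamma> = {rotation n k | k. period n gs (length gs) dvd k}"
proof (intro Set.equalityI subsetI)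
  let ?d = "period n gs (length gs)"
  fix g assume "g \<in> {rotation n k | k. ?d dvd k}"
  then obtain k where "g = rotation n k" "?d dvd k" by blast
  moreover from this(2) obtain j where "k = ?d * j" by (rule dvdE)
  ultimately have "g = rotation n (?d * j)" by simp
  moreover have "rotation n (?d * j) \<in> \<Gamma>"
  proof (induction j)
    case 0
    then show ?case
      using subgroup.one_closed[OF subgroup] by (simp only: mult_0_right rotation_0 sym_group_one)
  next
    case (Suc j)
    then show ?case
      using subgroup.m_closed[OF subgroup period_exponent[OF order_refl] Suc]
      by (simp only: sym_group_mult mult_Suc_right rotation_add)
  qed
  ultimately show "g \<in> \<Gamma>" by simp
next
  let ?d = "period n gs (length gs)"
  have dvd: "?d dvd h 1 - 1" if h: "h \<in> set gs" for h
  proof -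
    have "?d dvd n + 1 - h 1"
      using h period_dvd[of _ "length gs" n gs] by (auto simp: in_set_conv_nth)
    moreover have "h \<in> \<Gamma>" using h generate.incl[of h "set gs"] gen by auto
    then have "h 1 - 1 = n - (n + 1 - h 1)" using powers(1,2)[of h] by linarith
    ultimately show ?thesis by (simp only: period_dvd_n dvd_diff_nat)
  qed
  fix g assume "g \<in> \<Gamma>"
  then have "g \<in> generate (sym_group n) (set gs)" using gen by simp
  then show "g \<in> {rotation n k | k. ?d dvd k}"
  proof (induction rule: generate.induct)
    case one
    show ?case
      by (intro CollectI exI[of _ 0] conjI dvd_0_right) (simp only: sym_group_one rotation_0)
  next
    case (incl h)
    then have "h \<in> \<Gamma>" using generate.incl[of h "set gs"] gen by auto
    from powers(3)[OF this] dvd[OF incl] show ?case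
      by (intro CollectI exI[of _ "h 1 - 1"] conjI)
  next
    case (inv h)
    then have h: "h \<in> \<Gamma>" using generate.incl[of h "set gs"] gen by auto
    have "h \<in> carrier (sym_group n)"
      using subgroup.mem_carrier[OF subgroup h] .
    then have "inv\<^bsub>sym_group n\<^esub> h = inv' h" by (rule sym_group_inv_equality)
    also have "\<dots> = inv' (rotation n (h 1 - 1))"
      using powers(3)[OF h] by (rule arg_cong)
    also have "\<dots> = rotation n (n - (h 1 - 1))"
      using powers(2)[OF h] by (intro inv_rotation) simp
    finally have "inv\<^bsub>sym_group n\<^esub> h = rotation n (n - (h 1 - 1))" .
    moreover have "?d dvd n - (h 1 - 1)"
      using dvd[OF inv] period_dvd_n by (rule dvd_diff_nat[rotated])
    ultimately show ?case
      by (intro CollectI exI[of _ "n - (h 1 - 1)"] conjI)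
  next
    case (eng h1 h2)
    then obtain a b where "h1 = rotation n a" "?d dvd a" "h2 = rotation n b" "?d dvd b" by blast
    then have "h1 \<otimes>\<^bsub>sym_group n\<^esub> h2 = rotation n (a + b)" "?d dvd a + b"
      by (simp_all only: sym_group_mult rotation_add dvd_add)
    then show ?case by blast
  qed
qed

text \<open>Loops over the multiples of the period below \<open>n\<close> thereby have at most
  ord(\<Gamma>) rounds, which is where the order enters the running time.\<close>

lemma card_group: "card \<Gamma> * period n gs (length gs) = n"
proof -
  let ?d = "period n gs (length gs)"
  let ?f = "\<lambda>j. rotation n (j * ?d)"
  have d: "?d dvd n" "0 < ?d" using period_dvd_n[of n gs "length gs"] n by (auto intro: Nat.gr0I)
  have lt: "j * ?d < n" if "j < n div ?d" for j
    using that d by (metis dvd_div_mult_self mult_less_mono1)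
  have "\<Gamma> = ?f ` {..<n div ?d}"
  proof (intro Set.equalityI subsetI)
    fix g assume "g \<in> \<Gamma>"
    then obtain k where k: "g = rotation n k" "?d dvd k" using group_eq_powers by auto
    then have "?d dvd k mod n" using d by (simp add: dvd_mod)
    then obtain j where j: "k mod n = j * ?d" by (metis dvd_div_mult_self)
    have "j * ?d < n" using j[symmetric] n by simp
    then have "j < n div ?d" using d by (metis dvd_div_mult_self mult_less_cancel2)
    then show "g \<in> ?f ` {..<n div ?d}"
      using k j rotation_mod[of n k] by (intro image_eqI[of _ _ j]) simp_all
  qed (use group_eq_powers in auto)
  moreover have "inj_on ?f {..<n div ?d}"
  proof (rule inj_onI)
    fix a b assume ab: "a \<in> {..<n div ?d}" "b \<in> {..<n div ?d}" "?f a = ?f b"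
    then have "(a * ?d) mod n = (b * ?d) mod n"
      using rotation_apply[of 0 n "a * ?d"] rotation_apply[of 0 n "b * ?d"] n by simp
    then show "a = b" using ab lt d by simp
  qed
  ultimately have "card \<Gamma> = n div ?d" by (simp add: card_image)
  then show ?thesis using d by simp
qed

text \<open>Distinctness keeps the loop over the generators within ord(\<Gamma>) rounds and the
  input within \<open>O(n ord(\<Gamma>))\<close> words.\<close>

lemma length_le_card: "distinct gs \<Longrightarrow> length gs \<le> card \<Gamma>"
proof -
  assume "distinct gs"
  then have "length gs = card (set gs)" by (simp add: distinct_card)
  moreover have "set gs \<subseteq> \<Gamma>" using generate.incl[of _ "set gs"] gen by blast
  moreover have "0 < card \<Gamma>" using card_group n by (cases "card \<Gamma>") auto
  then have "finite \<Gamma>" by (simp add: card_gt_0_iff)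
  ultimately show ?thesis by (simp add: card_mono)
qed

text \<open>The action uses the inverse permutation, so the exponent \<open>k\<close> compares
  \<open>x\<close> with its rotation by \<open>n - k\<close>. As \<open>d\<close> divides
  \<open>n\<close>, both run through the same multiples of \<open>d\<close>; only
  \<open>k = 0\<close> has no counterpart, and its constraint is trivial.\<close>

lemma X_group_iff:
  assumes x: "x \<in> binary_cube n"
  shows "x \<in> X_group n \<Gamma> \<longleftrightarrow>
    (\<forall>p\<in>shifts n (period n gs (length gs)). lexge n (\<lambda>i. x (Suc i)) (rot n p (\<lambda>i. x (Suc i))))"
proof -
  let ?d = "period n gs (length gs)"
  let ?x = "\<lambda>i. x (Suc i)"
  have lex: "lex_ge x (perm_act n (rotation n k) x) \<longleftrightarrow> lexge n ?x (rot n (n - k) ?x)"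
    if k: "k \<le> n" for k
  proof -
    let ?y = "perm_act n (rotation n k) x"
    have out: "?y i = x i" if "i \<notin> {1..n}" for i
      using that x by (auto simp: perm_act_def binary_cube_def PiE_def extensional_def restrict_def)
    have inside: "?y (Suc i) = rot n (n - k) ?x i" if i: "i < n" for i
    proof -
      have "(n - k + i) mod n = (if n - k + i < n then n - k + i else n - k + i - n)"
        using i k by (auto simp: mod_if)
      then show ?thesis
        using i rotation_apply[OF i, of "n - k"] inv_rotation[OF k]
        by (simp add: perm_act_def rot_def)
    qed
    \<comment> \<open>Index 0 lies outside \<open>{1..n}\<close>, where both vectors agree, so the
      change to words indexed from 0 keeps the first difference.\<close>
    have split: "(\<forall>j<Suc i. x j = ?y j) \<longleftrightarrow> (\<forall>j<i. ?x j = ?y (Suc j))" for i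
      using out[of 0] by (auto simp: less_Suc_eq_0_disj)
    have "less_fun x ?y \<longleftrightarrow> (\<exists>i<n. ?x i < ?y (Suc i) \<and> (\<forall>j<i. ?x j = ?y (Suc j)))"
    proof
      assume "less_fun x ?y"
      then obtain k' where k': "x k' < ?y k'" "\<forall>j<k'. x j = ?y j" by (auto simp: less_fun_def)
      then have "k' \<in> {1..n}" using out[of k'] by force
      then obtain i where "k' = Suc i" "i < n" by (cases k') auto
      then show "\<exists>i<n. ?x i < ?y (Suc i) \<and> (\<forall>j<i. ?x j = ?y (Suc j))"
        using k' split by blast
    next
      assume "\<exists>i<n. ?x i < ?y (Suc i) \<and> (\<forall>j<i. ?x j = ?y (Suc j))"
      then show "less_fun x ?y" unfolding less_fun_def using split by blast
    qed
    also have "\<dots> \<longleftrightarrow> (\<exists>i<n. ?x i < rot n (n - k) ?x i \<and> (\<forall>j<i. ?x j = rot n (n - k) ?x j))"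
    proof (intro ex_cong1 conj_cong refl)
      fix i assume "i < n"
      then have "\<forall>j\<le>i. ?y (Suc j) = rot n (n - k) ?x j" using inside by auto
      then show "?x i < ?y (Suc i) \<longleftrightarrow> ?x i < rot n (n - k) ?x i"
        "(\<forall>j<i. ?x j = ?y (Suc j)) \<longleftrightarrow> (\<forall>j<i. ?x j = rot n (n - k) ?x j)"
        by (metis order_refl, metis less_imp_le)
    qed
    finally show ?thesis
      unfolding lex_ge_def lexge_def not_less[symmetric] by blast
  qed
  have d: "?d dvd n" by (rule period_dvd_n)
  have triv: "lexge n ?x (rot n n ?x)" by (simp add: lexge_def rot_def)
  have "x \<in> X_group n \<Gamma> \<longleftrightarrow> (\<forall>k. ?d dvd k \<longrightarrow> lex_ge x (perm_act n (rotation n k) x))"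
    using x by (subst group_eq_powers) (auto simp: X_group_def X_perm_def)
  also have "\<dots> \<longleftrightarrow> (\<forall>k<n. ?d dvd k \<longrightarrow> lex_ge x (perm_act n (rotation n k) x))"
  proof (intro iffI allI impI)
    fix k assume *: "\<forall>k<n. ?d dvd k \<longrightarrow> lex_ge x (perm_act n (rotation n k) x)" "?d dvd k"
    then have "?d dvd k mod n" "k mod n < n" using d n by (simp_all add: dvd_mod)
    with *(1) have "lex_ge x (perm_act n (rotation n (k mod n)) x)" by blast
    then show "lex_ge x (perm_act n (rotation n k) x)"
      by (simp only: rotation_mod)
  qed auto
  also have "\<dots> \<longleftrightarrow> (\<forall>p\<in>shifts n ?d. lexge n ?x (rot n p ?x))"
  proof (intro iffI allI ballI impI)
    fix p assume *: "\<forall>k<n. ?d dvd k \<longrightarrow> lex_ge x (perm_act n (rotation n k) x)"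
      and p: "p \<in> shifts n ?d"
    then have "n - p < n" "?d dvd n - p" "n - p \<le> n" "n - (n - p) = p"
      using d n by (auto simp: shifts_def dvd_diff_nat)
    then show "lexge n ?x (rot n p ?x)" using * lex by metis
  next
    fix k assume *: "\<forall>p\<in>shifts n ?d. lexge n ?x (rot n p ?x)" and k: "k < n" "?d dvd k"
    show "lex_ge x (perm_act n (rotation n k) x)"
    proof (cases "k = 0")
      case True
      then show ?thesis using lex[of 0] triv by simp
    next
      case False
      then have "n - k \<in> shifts n ?d" using k d by (auto simp: shifts_def dvd_diff_nat)
      then show ?thesis using * lex[of k] k by simp
    qed
  qed
  finally show ?thesis .
qed

end

section \<open>The emptiness test\<close>

text \<open>The condition for \<open>W i\<close> mentions \<open>W\<close> itself, but only at
  \<open>p + j - n\<close> with \<open>j \<le> i\<close> and \<open>p < n\<close>, that is, before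
  \<open>i\<close>. Building prefixes makes this recursion primitive.\<close>

primrec greedy_prefix :: "nat \<Rightarrow> nat \<Rightarrow> (nat \<Rightarrow> nat) \<Rightarrow> nat \<Rightarrow> nat \<Rightarrow> nat" where
  "greedy_prefix n d l 0 = (\<lambda>_. 0)"
| "greedy_prefix n d l (Suc i) = (let V = greedy_prefix n d l i in V(i := of_bool (l i = 1 \<or>
     (\<exists>p\<in>shifts n d. (\<forall>j<i. (if p + j < n then l (p + j) else V (p + j - n)) = V j) \<and>
        (if p + i < n then l (p + i) else V (p + i - n)) = 1))))"

definition greedy_word :: "nat \<Rightarrow> nat \<Rightarrow> (nat \<Rightarrow> nat) \<Rightarrow> nat \<Rightarrow> nat" where
  "greedy_word n d l i = greedy_prefix n d l (Suc i) i"

lemma greedy_prefix_eq: "i < k \<Longrightarrow> greedy_prefix n d l k i = greedy_word n d l i"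
proof (induction k)
  case (Suc k)
  show ?case
  proof (cases "i = k")
    case False
    then have "greedy_prefix n d l (Suc k) i = greedy_prefix n d l k i"
      by (simp only: greedy_prefix.simps Let_def fun_upd_other not_False_eq_True)
    with Suc False show ?thesis by simp
  qed (simp only: greedy_word_def)
qed simp

lemma greedy_word_rec:
  "greedy_word n d l i = of_bool (l i = 1 \<or>
     (\<exists>p\<in>shifts n d.
       (\<forall>j<i. (if p + j < n then l (p + j) else greedy_word n d l (p + j - n)) = greedy_word n d l j) \<and>
       (if p + i < n then l (p + i) else greedy_word n d l (p + i - n)) = 1))"
proof -
  have *: "(if p + j < n then l (p + j) else greedy_prefix n d l i (p + j - n)) =
      (if p + j < n then l (p + j) else greedy_word n d l (p + j - n))"
    if "p \<in> shifts n d" "j \<le> i" for p j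
  proof (cases "p + j < n")
    case False
    then have "p + j - n < i" using that by (auto simp: shifts_def)
    then show ?thesis by (simp add: greedy_prefix_eq)
  qed simp
  have "(\<exists>p\<in>shifts n d.
        (\<forall>j<i. (if p + j < n then l (p + j) else greedy_prefix n d l i (p + j - n)) = greedy_prefix n d l i j) \<and>
        (if p + i < n then l (p + i) else greedy_prefix n d l i (p + i - n)) = 1) \<longleftrightarrow>
      (\<exists>p\<in>shifts n d.
       (\<forall>j<i. (if p + j < n then l (p + j) else greedy_word n d l (p + j - n)) = greedy_word n d l j) \<and>
       (if p + i < n then l (p + i) else greedy_word n d l (p + i - n)) = 1)"
  proof (intro bex_cong refl arg_cong2[where f = "(\<and>)"] all_cong)
    fix p j assume "p \<in> shifts n d" "j < i"
    then show "((if p + j < n then l (p + j) else greedy_prefix n d l i (p + j - n)) = greedy_prefix n d l i j) =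
      ((if p + j < n then l (p + j) else greedy_word n d l (p + j - n)) = greedy_word n d l j)"
      using *[of p j] greedy_prefix_eq[of j i] by simp
  next
    fix p assume "p \<in> shifts n d"
    then show "((if p + i < n then l (p + i) else greedy_prefix n d l i (p + i - n)) = 1) =
      ((if p + i < n then l (p + i) else greedy_word n d l (p + i - n)) = 1)"
      using *[of p i] by simp
  qed
  then show ?thesis
    unfolding greedy_word_def[of n d l i] by (simp only: greedy_prefix.simps Let_def fun_upd_same)
qed

lemma greedy_greedy_word:
  assumes "\<And>i. i < n \<Longrightarrow> l i \<le> h i" "\<And>i. i < n \<Longrightarrow> h i \<le> 1"
  shows "greedy n d l h (greedy_word n d l)"
proof
  fix i assume "i < n"
  show "greedy_word n d l i \<le> 1"
    by (subst greedy_word_rec) simp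
  show "greedy_word n d l i = 1 \<longleftrightarrow> l i = 1 \<or>
      (\<exists>p\<in>shifts n d.
       (\<forall>j<i. (if p + j < n then l (p + j) else greedy_word n d l (p + j - n)) = greedy_word n d l j) \<and>
       (if p + i < n then l (p + i) else greedy_word n d l (p + i - n)) = 1)"
    by (subst greedy_word_rec) (simp only: of_bool_eq_1_iff)
qed (use assms in auto)

section \<open>Rules for counting loops\<close>

lemma wp_for:
  assumes "I i R M" "i \<le> u" "u - i \<le> N"
    and "\<And>i R M. I i R M \<Longrightarrow> R r = i \<and> R s = u"
    and "\<And>i R M. I i R M \<Longrightarrow> i < u \<Longrightarrow> wp B c (I (Suc i)) R M"
    and "\<And>R M. I u R M \<Longrightarrow> Q R M"
  shows "wp B (While N r s c) Q R M"
proof (rule wp_while[where I = "\<lambda>R M. R r \<le> u \<and> I (R r) R M" and f = "\<lambda>R M. u - R r"])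
  show "R r \<le> u \<and> I (R r) R M" "u - R r \<le> N" using assms(1-3) assms(4)[OF assms(1)] by auto
  show "Q R M" if "R r \<le> u \<and> I (R r) R M" "\<not> R r < R s" for R M
    using that assms(4)[of "R r" R M] assms(6)[of R M] by (cases "R r = u") auto
  show "wp B c (\<lambda>R' M'. (R' r \<le> u \<and> I (R' r) R' M') \<and> u - R' r < u - R r) R M"
    if "R r \<le> u \<and> I (R r) R M" "R r < R s" for R M
  proof -
    have "R r < u" using that assms(4)[of "R r" R M] by simp
    from assms(5)[OF conjunct2[OF that(1)] this] show ?thesis
    proof (rule wp_mono)
      fix R' M' assume *: "I (Suc (R r)) R' M'"
      then have "R' r = Suc (R r)" using assms(4) by blast
      with * \<open>R r < u\<close> show "(R' r \<le> u \<and> I (R' r) R' M') \<and> u - R' r < u - R r" by auto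
    qed
  qed
qed

text \<open>The counter takes the values \<open>d, 2 * d, ..., m * d\<close>. Because
  \<open>n = m * d\<close> it stops exactly at \<open>n\<close>, so the exit condition is the
  invariant \<open>I n\<close>. The number \<open>j\<close> of the current multiple yields the
  variant.\<close>

lemma wp_for_shifts:
  assumes "n = m * d" "0 < d" "0 < m" "m \<le> N"
    and "I d R M"
    and "\<And>p R M. I p R M \<Longrightarrow> R r = p \<and> R s = n"
    and "\<And>p R M. I p R M \<Longrightarrow> p \<in> shifts n d \<Longrightarrow> wp B c (I (p + d)) R M"
    and "\<And>R M. I n R M \<Longrightarrow> Q R M"
  shows "wp B (While N r s c) Q R M"
proof -
  define J where "J R M \<longleftrightarrow> (\<exists>j. 1 \<le> j \<and> j \<le> m \<and> I (j * d) R M)" for R M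
  have val: "R r = j * d" "R s = n" if "I (j * d) R M" for j R M
    using assms(6)[OF that] by auto
  have init: "J R M" unfolding J_def using assms(3,5) by (intro exI[of _ 1]) simp
  have bound: "m - R r div d \<le> N" using assms(4) by linarith
  have exit: "Q R M" if "J R M" "\<not> R r < R s" for R M
  proof -
    from that(1)[unfolded J_def] obtain j where j: "1 \<le> j" "j \<le> m" "I (j * d) R M" by (elim exE conjE)
    have "n \<le> j * d" using that(2) val[OF j(3)] by linarith
    then have "m \<le> j" using assms(1,2) by simp
    then have "j * d = n" using j(2) assms(1) by simp
    with j(3) have "I n R M" by (simp only:)
    then show ?thesis by (rule assms(8))
  qed
  have body: "wp B c (\<lambda>R' M'. J R' M' \<and> m - R' r div d < m - R r div d) R M"
    if "J R M" "R r < R s" for R M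
  proof -
    from that(1)[unfolded J_def] obtain j where j: "1 \<le> j" "j \<le> m" "I (j * d) R M" by (elim exE conjE)
    have lt: "j * d < n" using that(2) val[OF j(3)] by linarith
    then have "j < m" unfolding assms(1) by simp
    have "j * d \<in> shifts n d" using lt j(1) assms(2) by (simp add: shifts_def)
    from assms(7)[OF j(3) this] show ?thesis
    proof (rule wp_mono)
      fix R' M' assume "I (j * d + d) R' M'"
      moreover have "j * d + d = Suc j * d" by simp
      ultimately have I: "I (Suc j * d) R' M'" by (simp only:)
      have "R' r div d = Suc j"
        unfolding val(1)[OF I] using assms(2) by (intro nonzero_mult_div_cancel_right) simp
      moreover have "R r div d = j"
        unfolding val(1)[OF j(3)] using assms(2) by (intro nonzero_mult_div_cancel_right) simp
      ultimately have "m - R' r div d < m - R r div d" using \<open>j < m\<close> by linarith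
      with I \<open>j < m\<close> show "J R' M' \<and> m - R' r div d < m - R r div d"
        unfolding J_def by (intro conjI exI[of _ "Suc j"]) simp_all
    qed
  qed
  from init bound body exit show ?thesis by (rule wp_while)
qed

lemma shifts_less_add:
  assumes "p \<in> shifts n d" "q \<in> shifts n d"
  shows "q < p + d \<longleftrightarrow> q < p \<or> q = p"
proof -
  have "d dvd p" "d dvd q" "0 < d" using assms by (auto simp: shifts_def intro: Nat.gr0I)
  then obtain a b where "p = d * a" "q = d * b" by (auto elim!: dvdE)
  moreover have "d * b < d * a + d \<longleftrightarrow> d * b < d * Suc a" by (simp only: mult_Suc_right add.commute)
  ultimately show ?thesis using \<open>0 < d\<close> by (simp only: mult_less_cancel1 mult_cancel1) auto
qed

lemma shifts_ge: "p \<in> shifts n d \<Longrightarrow> d \<le> p"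
  by (auto simp: shifts_def dvd_imp_le)

text \<open>
  Registers: 0 and 17 hold the constants 0 and 1; 2, 3 and 12 hold \<open>n\<close>, \<open>d\<close> and \<open>n + 1\<close>; 4 to 11
  hold the base addresses of the arrays of entries fixed to 0, of entries fixed to 1, of \<open>W\<close>, of the
  rotations that still agree with \<open>W\<close>, of the admissible \<open>k\<close>, of \<open>c k\<close>, and of the two results;
  13 to 15 belong to the main loop; 16 holds the number of generators; 20 and above are scratch
  registers, where 23 is reserved for addresses and 28 returns the result of the test.
  The array of \<open>W\<close> follows immediately that of the entries fixed to 1, so that the rotated word
  \<open>y p\<close> can be read off without a case distinction.
\<close>

abbreviation skip :: com where "skip \<equiv> Do (Copy 23 23)"

abbreviation ld :: "nat \<Rightarrow> nat \<Rightarrow> nat \<Rightarrow> com" where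
  "ld r b i \<equiv> Do (Add 23 b i) ;; Do (Load r 23)"

abbreviation st :: "nat \<Rightarrow> nat \<Rightarrow> nat \<Rightarrow> com" where
  "st b i r \<equiv> Do (Add 23 b i) ;; Do (Store 23 r)"

definition act_init :: "nat \<Rightarrow> com" where
  "act_init m = Do (Copy 21 3) ;; While m 21 2 (st 7 21 17 ;; Do (Add 21 21 3))"

text \<open>Both words are bits, so \<open>22 < 25\<close> says at once that the maximum is still 0
  and that the rotation is active.\<close>

definition greedy_max :: "nat \<Rightarrow> com" where
  "greedy_max m = Do (Copy 21 3) ;; While m 21 2
     (Do (Add 24 21 20) ;; ld 24 5 24 ;; ld 25 7 21 ;;
      If 22 25 (If 22 24 (Do (Copy 22 24)) skip) skip ;; Do (Add 21 21 3))"

text \<open>The flag need not be consulted: an active rotation has \<open>y p i \<le> W i\<close> by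
  \<open>lexge_W_y\<close>, so it disagrees only if it is smaller, and clearing the flag of an
  inactive one changes nothing.\<close>

definition greedy_drop :: "nat \<Rightarrow> com" where
  "greedy_drop m = Do (Copy 21 3) ;; While m 21 2
     (Do (Add 24 21 20) ;; ld 24 5 24 ;; If 24 22 (st 7 21 0) skip ;; Do (Add 21 21 3))"

definition greedy_prog :: "nat \<Rightarrow> nat \<Rightarrow> com" where
  "greedy_prog n m = act_init m ;; Do (Copy 20 0) ;; While n 20 2
     (ld 22 5 20 ;; greedy_max m ;; st 6 20 22 ;; greedy_drop m ;; Do (Inc 20))"

text \<open>Register 28 records whether \<open>W\<close> has respected \<open>h\<close> so far. At
  the end this is the flag of the candidate \<open>n\<close>.\<close>

definition cand_prog :: "nat \<Rightarrow> com" where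
  "cand_prog n = Do (Copy 28 17) ;; Do (Copy 20 0) ;; While n 20 2
     (ld 24 6 20 ;; ld 25 4 20 ;;
      If 24 17 (If 25 17 (Do (Copy 22 28)) (Do (Copy 22 0)))
        (Do (Copy 22 0) ;; If 25 17 skip (Do (Copy 28 0))) ;;
      st 8 20 22 ;; Do (Inc 20)) ;;
   st 8 2 28"

lemma wp_ld: "wp B (ld r b i ;; c) Q R M \<longleftrightarrow>
    R b + R i \<le> B \<and> wp B c Q (R(23 := R b + R i, r := M (R b + R i))) M"
  by simp

lemma wp_st: "r \<noteq> 23 \<Longrightarrow> wp B (st b i r) Q R M \<longleftrightarrow>
    R b + R i \<le> B \<and> Q (R(23 := R b + R i)) (M(R b + R i := R r))"
  by simp

section \<open>Correctness of the greedy word and of the candidate flags\<close>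

locale oracle_ctx =
  fixes n d m aB B :: nat and X M0 :: "nat \<Rightarrow> nat"
  assumes nm: "n = m * d" and d: "0 < d" and m: "0 < m" and B: "aB + 9 * n + 2 \<le> B"
    and bits: "\<And>i. i < n \<Longrightarrow> M0 (aB + n + i) + M0 (aB + i) \<le> 1"
begin

definition l :: "nat \<Rightarrow> nat" where "l i = M0 (aB + n + i)"
definition h :: "nat \<Rightarrow> nat" where "h i = 1 - M0 (aB + i)"
definition W :: "nat \<Rightarrow> nat" where "W = greedy_word n d l"

sublocale greedy n d l h W
  unfolding W_def
  by (rule greedy_greedy_word) (use bits in \<open>fastforce simp: l_def h_def\<close>, simp add: h_def)

text \<open>This doubles as a frame condition. Only the scratch area from \<open>aB + 2 * n\<close>
  to \<open>aB + 6 * n\<close> is written, so the bounds below it and the results above it survive a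
  test, as do the registers 13 to 15 of the caller, kept in \<open>X\<close>.\<close>

definition base :: "(nat \<Rightarrow> nat) \<Rightarrow> (nat \<Rightarrow> nat) \<Rightarrow> bool" where
  "base R M \<longleftrightarrow> R 0 = 0 \<and> R 17 = 1 \<and> R 2 = n \<and> R 3 = d \<and> R 4 = aB \<and> R 5 = aB + n \<and>
     R 6 = aB + 2 * n \<and> R 7 = aB + 3 * n \<and> R 8 = aB + 4 * n \<and> R 9 = aB + 5 * n + 1 \<and>
     R 10 = aB + 6 * n + 1 \<and> R 11 = aB + 7 * n + 1 \<and> R 12 = n + 1 \<and>
     R 13 = X 13 \<and> R 14 = X 14 \<and> R 15 = X 15 \<and>
     (\<forall>a. a < aB + 2 * n \<or> aB + 6 * n + 1 \<le> a \<longrightarrow> M a = M0 a)"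

lemma d_le_n: "d \<le> n"
  using nm m by simp

lemma shifts_all_add:
  "p \<in> shifts n d \<Longrightarrow> (\<forall>q\<in>shifts n d. q < p + d \<longrightarrow> P q) \<longleftrightarrow> (\<forall>q\<in>shifts n d. q < p \<longrightarrow> P q) \<and> P p"
  using shifts_less_add[of p n d] by blast

lemma shifts_ex_add:
  "p \<in> shifts n d \<Longrightarrow> (\<exists>q\<in>shifts n d. q < p + d \<and> P q) \<longleftrightarrow> (\<exists>q\<in>shifts n d. q < p \<and> P q) \<or> P p"
  using shifts_less_add[of p n d] by blast

lemma not_shift_less_d: "q \<in> shifts n d \<Longrightarrow> \<not> q < d"
  using shifts_ge[of q n d] by simp

lemma base_upd_reg:
  "base R M \<Longrightarrow> 20 \<le> r \<Longrightarrow> base (R(r := v)) M"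
  by (simp add: base_def)

lemma base_upd_mem:
  "base R M \<Longrightarrow> aB + 2 * n \<le> a \<Longrightarrow> a < aB + 6 * n + 1 \<Longrightarrow> base R (M(a := v))"
  by (auto simp: base_def)

lemma base_regs:
  "base R M \<Longrightarrow> R 0 = 0 \<and> R 17 = 1 \<and> R 2 = n \<and> R 3 = d \<and> R 4 = aB \<and> R 5 = aB + n \<and>
     R 6 = aB + 2 * n \<and> R 7 = aB + 3 * n \<and> R 8 = aB + 4 * n \<and> R 9 = aB + 5 * n + 1 \<and> R 12 = n + 1"
  by (simp add: base_def)

lemma wp_act_init:
  assumes "base R M"
  shows "wp B (act_init m) (\<lambda>R M. base R M \<and> (\<forall>p\<in>shifts n d. M (aB + 3 * n + p) = 1)) R M"
proof -
  let ?I = "\<lambda>p R M. R 21 = p \<and> base R M \<and> (\<forall>q\<in>shifts n d. q < p \<longrightarrow> M (aB + 3 * n + q) = 1)"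
  have "wp B (While m 21 2 (st 7 21 17 ;; Do (Add 21 21 3)))
      (\<lambda>R M. base R M \<and> (\<forall>p\<in>shifts n d. M (aB + 3 * n + p) = 1)) (R(21 := d)) M"
  proof (rule wp_for_shifts[where I = ?I, OF nm d m order_refl])
    show "?I d (R(21 := d)) M"
      using assms by (simp add: base_upd_reg not_shift_less_d)
  next
    fix p R M assume I: "?I p R M" and p: "p \<in> shifts n d"
    note r = base_regs[OF conjunct1[OF conjunct2[OF I]]]
    have "p < n" using p by (simp add: shifts_def)
    then show "wp B (st 7 21 17 ;; Do (Add 21 21 3)) (?I (p + d)) R M"
      using I r B d_le_n by (simp add: base_upd_reg base_upd_mem shifts_all_add[OF p])
  next
    fix p R M assume I: "?I p R M"
    then show "R 21 = p \<and> R 2 = n" using base_regs by blast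
  next
    fix R M assume I: "?I n R M"
    then show "base R M \<and> (\<forall>p\<in>shifts n d. M (aB + 3 * n + p) = 1)" by (simp add: shifts_def)
  qed
  then show ?thesis
    using base_regs[OF assms] by (simp add: act_init_def)
qed

definition greedy_state :: "nat \<Rightarrow> (nat \<Rightarrow> nat) \<Rightarrow> (nat \<Rightarrow> nat) \<Rightarrow> bool" where
  "greedy_state i R M \<longleftrightarrow> base R M \<and> R 20 = i \<and> (\<forall>j<i. M (aB + 2 * n + j) = W j) \<and>
     (\<forall>p\<in>shifts n d. M (aB + 3 * n + p) = of_bool (\<forall>j<i. y p j = W j))"

lemma M0_l: "base R M \<Longrightarrow> i < n \<Longrightarrow> M (aB + n + i) = l i"
  by (simp add: base_def l_def)

lemma M0_a: "base R M \<Longrightarrow> i < n \<Longrightarrow> M (aB + i) = M0 (aB + i)"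
  by (simp add: base_def)

text \<open>An address beyond the array of \<open>l\<close> hits the entry \<open>p + i - n\<close>
  of \<open>W\<close>, which precedes \<open>i\<close> and is already computed.\<close>

lemma read_y:
  assumes "base R M" "\<forall>j<i. M (aB + 2 * n + j) = W j" "p \<in> shifts n d" "i < n"
  shows "M (aB + n + (p + i)) = y p i"
proof (cases "p + i < n")
  case True
  then show ?thesis using M0_l[OF assms(1) True] by (simp add: y_def)
next
  case False
  have "aB + n + (p + i) = aB + 2 * n + (p + i - n)" "p + i - n < i"
    using False assms(3,4) by (auto simp: shifts_def)
  then show ?thesis using assms(2) False by (simp only: y_def if_False)
qed

lemma greedy_state_upd: "greedy_state i R M \<Longrightarrow> 21 \<le> r \<Longrightarrow> greedy_state i (R(r := v)) M"
  by (auto simp: greedy_state_def base_upd_reg)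

lemma wp_greedy_max:
  assumes "greedy_state i R M" "i < n" "R 22 = l i"
  shows "wp B (greedy_max m) (\<lambda>R M. greedy_state i R M \<and> R 22 = W i) R M"
proof -
  let ?w = "\<lambda>p. of_bool (l i = 1 \<or> (\<exists>q\<in>shifts n d. q < p \<and> (\<forall>j<i. y q j = W j) \<and> y q i = 1)) :: nat"
  let ?I = "\<lambda>p R M. R 21 = p \<and> greedy_state i R M \<and> R 22 = ?w p"
  have "wp B (While m 21 2
     (Do (Add 24 21 20) ;; ld 24 5 24 ;; ld 25 7 21 ;;
      If 22 25 (If 22 24 (Do (Copy 22 24)) skip) skip ;; Do (Add 21 21 3)))
      (\<lambda>R M. greedy_state i R M \<and> R 22 = W i) (R(21 := d)) M"
  proof (rule wp_for_shifts[where I = ?I, OF nm d m order_refl])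
    have "R 22 = ?w d"
      using assms(3) l_le_1[OF assms(2)] not_shift_less_d by (cases "l i = 1") auto
    then show "?I d (R(21 := d)) M"
      using assms by (simp add: greedy_state_def base_upd_reg)
  next
    fix p R M assume I: "?I p R M" and p: "p \<in> shifts n d"
    then have G: "base R M" "R 20 = i" "\<forall>j<i. M (aB + 2 * n + j) = W j"
      "\<forall>p\<in>shifts n d. M (aB + 3 * n + p) = of_bool (\<forall>j<i. y p j = W j)" "R 21 = p" "R 22 = ?w p"
      by (simp_all add: greedy_state_def)
    note r = base_regs[OF G(1)]
    have pn: "p < n" using p by (simp add: shifts_def)
    define A where "A \<longleftrightarrow> (\<forall>j<i. y p j = W j)"
    have A: "M (aB + 3 * n + p) = of_bool A" using G(4) p by (simp add: A_def)
    have Y: "M (aB + n + (p + i)) = y p i" by (rule read_y[OF G(1,3) p assms(2)])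
    have Y1: "y p i \<le> 1" by (rule y_le_1[OF pn assms(2)])
    define v where "v = (if R 22 < of_bool A \<and> R 22 < y p i then y p i else R 22)"
    have "?w (p + d) = of_bool (R 22 = 1 \<or> A \<and> y p i = 1)"
      unfolding shifts_ex_add[OF p] A_def G(6) by simp
    moreover have "R 22 \<le> 1" unfolding G(6) by simp
    ultimately have v: "v = ?w (p + d)"
      using Y1 unfolding v_def by (cases A; cases "R 22 = 0"; cases "y p i = 0") auto
    have S: "greedy_state i R M" using I by simp
    show "wp B (Do (Add 24 21 20) ;; ld 24 5 24 ;; ld 25 7 21 ;;
      If 22 25 (If 22 24 (Do (Copy 22 24)) skip) skip ;; Do (Add 21 21 3)) (?I (p + d)) R M"
    proof (cases "R 22 < of_bool A \<and> R 22 < y p i")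
      case True
      then have "?w (p + d) = y p i" using v by (simp add: v_def)
      then show ?thesis
        using True r B d_le_n pn assms(2) G(2,5) Y A by (simp add: greedy_state_upd S)
    next
      case False
      then have "?w (p + d) = R 22" using v by (simp only: v_def if_False)
      then show ?thesis
        using False r B d_le_n pn assms(2) G(2,5) Y A by (simp add: greedy_state_upd S)
    qed
  next
    fix p R M assume I: "?I p R M"
    then show "R 21 = p \<and> R 2 = n" using base_regs unfolding greedy_state_def by blast
  next
    fix R M assume I: "?I n R M"
    then have "R 22 = W i"
      using W_eq_1_iff[OF assms(2)] W_le_1[OF assms(2)] by (cases "W i = 1") (auto simp: shifts_def)
    then show "greedy_state i R M \<and> R 22 = W i" using I by simp
  qed
  moreover have "R 3 = d" using assms(1) base_regs unfolding greedy_state_def by blast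
  ultimately show ?thesis by (simp add: greedy_max_def)
qed

lemma wp_greedy_drop:
  assumes "base R M" "R 20 = i" "\<forall>j<Suc i. M (aB + 2 * n + j) = W j" "i < n" "R 22 = W i"
    and act: "\<forall>p\<in>shifts n d. M (aB + 3 * n + p) = of_bool (\<forall>j<i. y p j = W j)"
  shows "wp B (greedy_drop m) (\<lambda>R M. base R M \<and> R 20 = i \<and> (\<forall>j<Suc i. M (aB + 2 * n + j) = W j) \<and>
     (\<forall>p\<in>shifts n d. M (aB + 3 * n + p) = of_bool (\<forall>j<Suc i. y p j = W j))) R M"
    (is "wp B _ ?Q R M")
proof -
  let ?a = "\<lambda>p q. of_bool ((\<forall>j<i. y q j = W j) \<and> (q < p \<longrightarrow> y q i = W i)) :: nat"
  let ?I = "\<lambda>p R M. R 21 = p \<and> base R M \<and> R 20 = i \<and> R 22 = W i \<and>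
      (\<forall>j<Suc i. M (aB + 2 * n + j) = W j) \<and> (\<forall>q\<in>shifts n d. M (aB + 3 * n + q) = ?a p q)"
  let ?c = "Do (Add 24 21 20) ;; ld 24 5 24 ;; If 24 22 (st 7 21 0) skip ;; Do (Add 21 21 3)"
  have "wp B (While m 21 2 ?c) ?Q (R(21 := d)) M"
  proof (rule wp_for_shifts[where I = ?I, OF nm d m order_refl])
    show "?I d (R(21 := d)) M"
      using assms not_shift_less_d by (simp add: base_upd_reg)
  next
    fix p R M assume I: "?I p R M" and p: "p \<in> shifts n d"
    then have G: "base R M" "R 20 = i" "\<forall>j<i. M (aB + 2 * n + j) = W j" "R 21 = p" "R 22 = W i"
      "M (aB + 3 * n + p) = ?a p p" "\<forall>j<Suc i. M (aB + 2 * n + j) = W j"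
      "\<forall>q\<in>shifts n d. M (aB + 3 * n + q) = ?a p q"
      by simp_all
    note r = base_regs[OF G(1)]
    have pn: "p < n" using p by (simp add: shifts_def)
    have Y: "M (aB + n + (p + i)) = y p i" by (rule read_y[OF G(1,3) p assms(4)])
    have Yle: "y p i \<le> W i" if "\<forall>j<i. y p j = W j"
      using lexge_W_y[OF p assms(4)] that by simp
    have a: "?a (p + d) q = (if q = p then of_bool ((\<forall>j<i. y q j = W j) \<and> y q i = W i) else ?a p q)"
      if "q \<in> shifts n d" for q
      using shifts_less_add[OF p that] d by auto
    show "wp B ?c (?I (p + d)) R M"
    proof (cases "y p i < W i")
      case True
      have M': "\<forall>q\<in>shifts n d. (M(aB + 3 * n + p := 0)) (aB + 3 * n + q) = ?a (p + d) q"
      proof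
        fix q assume q: "q \<in> shifts n d"
        show "(M(aB + 3 * n + p := 0)) (aB + 3 * n + q) = ?a (p + d) q"
          unfolding a[OF q] using G(8) q True by simp
      qed
      have W': "\<forall>j<Suc i. (M(aB + 3 * n + p := 0)) (aB + 2 * n + j) = W j"
        using G(7) assms(4) by simp
      have "base R (M(aB + 3 * n + p := 0))"
        using G(1) pn by (intro base_upd_mem) simp_all
      then show ?thesis
        using True r B d_le_n pn assms(4) G(2,4,5) Y M' W' by (simp add: base_upd_reg del: fun_upd_apply add: fun_upd_same fun_upd_other)
    next
      case False
      have M': "\<forall>q\<in>shifts n d. M (aB + 3 * n + q) = ?a (p + d) q"
      proof
        fix q assume q: "q \<in> shifts n d"
        show "M (aB + 3 * n + q) = ?a (p + d) q"
        proof (cases "q = p")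
          case True
          then show ?thesis
            unfolding a[OF q] using G(6) Yle False by (cases "\<forall>j<i. y p j = W j") auto
        next
          case False
          then show ?thesis unfolding a[OF q] using G(8) q by simp
        qed
      qed
      then show ?thesis
        using False r B d_le_n pn assms(4) G Y by (simp add: base_upd_reg)
    qed
  next
    fix p R M assume I: "?I p R M"
    then show "R 21 = p \<and> R 2 = n" using base_regs by blast
  next
    fix R M assume I: "?I n R M"
    have "?a n p = of_bool (\<forall>j<Suc i. y p j = W j)" if "p \<in> shifts n d" for p
      using that by (auto simp: shifts_def less_Suc_eq)
    then show "?Q R M" using I by simp
  qed
  moreover have "R 3 = d" using assms(1) base_regs by blast
  ultimately show ?thesis by (simp add: greedy_drop_def)
qed

definition has_W :: "(nat \<Rightarrow> nat) \<Rightarrow> (nat \<Rightarrow> nat) \<Rightarrow> bool" where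
  "has_W R M \<longleftrightarrow> base R M \<and> (\<forall>j<n. M (aB + 2 * n + j) = W j)"

lemma wp_greedy_prog:
  assumes "base R M"
  shows "wp B (greedy_prog n m) has_W R M"
proof -
  let ?c = "ld 22 5 20 ;; greedy_max m ;; st 6 20 22 ;; greedy_drop m ;; Do (Inc 20)"
  have loop: "wp B (While n 20 2 ?c) has_W (R(20 := 0)) M"
    if "base R M" "\<forall>p\<in>shifts n d. M (aB + 3 * n + p) = 1" for R M
  proof (rule wp_for[where I = greedy_state and i = 0 and u = n])
    show "greedy_state 0 (R(20 := 0)) M"
      using that by (simp add: greedy_state_def base_upd_reg)
    fix i R M assume I: "greedy_state i R M"
    then show "R 20 = i \<and> R 2 = n" using base_regs unfolding greedy_state_def by blast
    assume i: "i < n"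
    have I': "base R M" "R 20 = i" using I by (simp_all add: greedy_state_def)
    note r = base_regs[OF I'(1)]
    have 1: "wp B (greedy_max m) (\<lambda>R M. greedy_state i R M \<and> R 22 = W i)
        (R(23 := aB + n + i, 22 := l i)) M"
      by (rule wp_greedy_max) (use I i in \<open>simp_all add: greedy_state_upd\<close>)
    have 2: "wp B (st 6 20 22 ;; greedy_drop m ;; Do (Inc 20)) (greedy_state (Suc i)) R M"
      if G: "greedy_state i R M" "R 22 = W i" for R M
    proof -
      let ?M = "M(aB + 2 * n + i := W i)" and ?R = "R(23 := aB + 2 * n + i)"
      have G': "base R M" "R 20 = i" "\<forall>j<i. M (aB + 2 * n + j) = W j"
        "\<forall>p\<in>shifts n d. M (aB + 3 * n + p) = of_bool (\<forall>j<i. y p j = W j)"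
        using G(1) by (simp_all add: greedy_state_def)
      have "wp B (greedy_drop m) (\<lambda>R M. base R M \<and> R 20 = i \<and> (\<forall>j<Suc i. M (aB + 2 * n + j) = W j) \<and>
        (\<forall>p\<in>shifts n d. M (aB + 3 * n + p) = of_bool (\<forall>j<Suc i. y p j = W j))) ?R ?M"
      proof (rule wp_greedy_drop)
        show "base ?R ?M"
          using G'(1) i by (intro base_upd_mem base_upd_reg) simp_all
        show "\<forall>j<Suc i. ?M (aB + 2 * n + j) = W j"
          using G'(3) by (simp add: less_Suc_eq)
        show "\<forall>p\<in>shifts n d. ?M (aB + 3 * n + p) = of_bool (\<forall>j<i. y p j = W j)"
          using G'(4) i by simp
      qed (use G G' i in simp_all)
      then have "wp B (greedy_drop m ;; Do (Inc 20)) (greedy_state (Suc i)) ?R ?M"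
        unfolding wp.simps
        by (rule wp_mono) (simp add: greedy_state_def base_upd_reg)
      then show ?thesis
        using base_regs[OF G'(1)] G'(2) G(2) B i by simp
    qed
    have "wp B (greedy_max m ;; st 6 20 22 ;; greedy_drop m ;; Do (Inc 20)) (greedy_state (Suc i))
        (R(23 := aB + n + i, 22 := l i)) M"
      unfolding wp.simps(2)[of B "greedy_max m"] using 1 by (rule wp_mono) (use 2 in blast)
    then show "wp B ?c (greedy_state (Suc i)) R M"
      using r I'(2) i B M0_l[OF I'(1) i] by (simp only: wp_ld) simp
  next
    fix R M assume "greedy_state n R M"
    then show "has_W R M" by (simp add: greedy_state_def has_W_def)
  qed simp_all
  have "wp B (act_init m ;; Do (Copy 20 0) ;; While n 20 2 ?c) has_W R M"
    unfolding wp.simps(2)[of B "act_init m"]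
    using wp_act_init[OF assms]
  proof (rule wp_mono)
    fix R M assume *: "base R M \<and> (\<forall>p\<in>shifts n d. M (aB + 3 * n + p) = 1)"
    then have "R 0 = 0" using base_regs by blast
    with loop[of R M] * show "wp B (Do (Copy 20 0) ;; While n 20 2 ?c) has_W R M" by simp
  qed
  then show ?thesis by (simp only: greedy_prog_def)
qed

lemma has_W_upd_reg: "has_W R M \<Longrightarrow> 20 \<le> r \<Longrightarrow> has_W (R(r := v)) M"
  by (simp add: has_W_def base_upd_reg)

lemma has_W_upd_mem:
  "has_W R M \<Longrightarrow> aB + 3 * n \<le> a \<Longrightarrow> a < aB + 6 * n + 1 \<Longrightarrow> has_W R (M(a := v))"
  by (simp add: has_W_def base_upd_mem)

lemma has_W_regs:
  "has_W R M \<Longrightarrow> R 0 = 0 \<and> R 17 = 1 \<and> R 2 = n \<and> R 3 = d \<and> R 4 = aB \<and> R 5 = aB + n \<and>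
     R 6 = aB + 2 * n \<and> R 7 = aB + 3 * n \<and> R 8 = aB + 4 * n \<and> R 9 = aB + 5 * n + 1 \<and> R 12 = n + 1"
  unfolding has_W_def using base_regs by blast

lemma wp_cand_prog:
  assumes "has_W R M"
  shows "wp B (cand_prog n) (\<lambda>R M. has_W R M \<and> (\<forall>k\<le>n. M (aB + 4 * n + k) = of_bool (cand k))) R M"
    (is "wp B _ ?Q R M")
proof -
  define I where "I k R M \<longleftrightarrow> R 20 = k \<and> has_W R M \<and> R 28 = of_bool (\<forall>j<k. W j \<le> h j) \<and>
     (\<forall>j<k. M (aB + 4 * n + j) = of_bool (cand j))" for k :: nat and R M
  let ?c = "ld 24 6 20 ;; ld 25 4 20 ;;
      If 24 17 (If 25 17 (Do (Copy 22 28)) (Do (Copy 22 0)))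
        (Do (Copy 22 0) ;; If 25 17 skip (Do (Copy 28 0))) ;;
      st 8 20 22 ;; Do (Inc 20)"
  have "wp B (While n 20 2 ?c ;; st 8 2 28) ?Q (R(28 := 1, 20 := 0)) M"
    unfolding wp.simps(2)[of B "While _ _ _ _"]
  proof (rule wp_for[where I = I and i = 0 and u = n])
    show "I 0 (R(28 := 1, 20 := 0)) M"
      using assms by (simp add: I_def has_W_upd_reg)
    fix k R M assume "I k R M"
    then have I: "R 20 = k" "has_W R M" "R 28 = of_bool (\<forall>j<k. W j \<le> h j)"
      "\<forall>j<k. M (aB + 4 * n + j) = of_bool (cand j)"
      by (simp_all add: I_def)
    then show "R 20 = k \<and> R 2 = n" using has_W_regs by blast
    assume k: "k < n"
    have hW: "has_W R M" using I by simp
    note r = has_W_regs[OF hW]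
    have Wk: "M (aB + 2 * n + k) = W k" using hW k by (simp add: has_W_def)
    have ak: "M (aB + k) = M0 (aB + k)" using hW M0_a k unfolding has_W_def by blast
    have upd: "has_W R' (M(aB + 4 * n + k := v))" if "has_W R' M" for v R'
      using that k by (intro has_W_upd_mem) simp_all
    define g where "g \<longleftrightarrow> (\<forall>j<k. W j \<le> h j)"
    have g': "(\<forall>j<Suc k. W j \<le> h j) \<longleftrightarrow> g \<and> W k \<le> h k"
      unfolding g_def by (auto simp: less_Suc_eq)
    have cand: "cand k \<longleftrightarrow> g \<and> W k = 0 \<and> h k = 1"
      using k unfolding cand_def g_def by simp
    have arr: "\<forall>j<Suc k. (M(aB + 4 * n + k := of_bool (cand k))) (aB + 4 * n + j) = of_bool (cand j)"
      using I by (simp add: less_Suc_eq)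
    have step: "I (Suc k) (R'(20 := Suc k)) (M(aB + 4 * n + k := v))"
      if "has_W R' M" "R' 28 = of_bool (g \<and> W k \<le> h k)" "v = of_bool (cand k)" for R' v
      unfolding I_def g' using that arr upd by (simp add: has_W_upd_reg)
    have W1: "W k \<le> 1" by (rule W_le_1[OF k])
    have a1: "M0 (aB + k) \<le> 1" using bits[OF k] by simp
    have R28: "R 28 = of_bool g" using I by (simp add: g_def)
    show "wp B ?c (I (Suc k)) R M"
    proof (cases "W k < 1"; cases "M0 (aB + k) < 1")
      assume c: "W k < 1" "M0 (aB + k) < 1"
      then have "h k = 1" by (simp add: h_def)
      show ?thesis
        using r B k I(1) Wk ak c by simp (intro step; use c \<open>h k = 1\<close> hW R28 cand in \<open>simp add: has_W_upd_reg\<close>)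
    next
      assume c: "W k < 1" "\<not> M0 (aB + k) < 1"
      then have "h k = 0" by (simp add: h_def)
      show ?thesis
        using r B k I(1) Wk ak c by simp (intro step; use c \<open>h k = 0\<close> hW R28 cand in \<open>simp add: has_W_upd_reg\<close>)
    next
      assume c: "\<not> W k < 1" "M0 (aB + k) < 1"
      then have "h k = 1" by (simp add: h_def)
      show ?thesis
        using r B k I(1) Wk ak c by simp (intro step; use c \<open>h k = 1\<close> hW R28 cand W1 in \<open>simp add: has_W_upd_reg\<close>)
    next
      assume c: "\<not> W k < 1" "\<not> M0 (aB + k) < 1"
      then have "h k = 0" by (simp add: h_def)
      show ?thesis
        using r B k I(1) Wk ak c by simp (intro step; use c \<open>h k = 0\<close> hW R28 cand W1 in \<open>simp add: has_W_upd_reg\<close>)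
    qed
  next
    fix R M assume "I n R M"
    then have I: "R 20 = n" "has_W R M" "R 28 = of_bool (\<forall>j<n. W j \<le> h j)"
      "\<forall>j<n. M (aB + 4 * n + j) = of_bool (cand j)"
      by (simp_all add: I_def)
    then have hW: "has_W R M" by simp
    have "has_W R (M(aB + 4 * n + n := R 28))"
      using hW by (intro has_W_upd_mem) simp_all
    moreover have "R 28 = of_bool (cand n)" using I by (simp add: cand_def)
    moreover have "\<forall>k\<le>n. (M(aB + 4 * n + n := of_bool (cand n))) (aB + 4 * n + k) = of_bool (cand k)"
      using I by (auto simp: le_less)
    ultimately have "?Q (R(23 := aB + 4 * n + n)) (M(aB + 4 * n + n := R 28))"
      by (simp only: has_W_upd_reg simp_thms)
    moreover have "R 8 = aB + 4 * n" using has_W_regs[OF hW] by blast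
    ultimately show "wp B (st 8 2 28) ?Q R M"
      using I(1) has_W_regs[OF hW] B by (simp only: wp_st) simp
  qed simp_all
  then show ?thesis
    using has_W_regs[OF assms] by (simp add: cand_prog_def)
qed

end

section \<open>Testing all candidates against one rotation\<close>

lemma wp_Seq: "wp B (c1 ;; c2) Q = wp B c1 (wp B c2 Q)"
  by (intro ext) simp

text \<open>Candidates passed on the way to the first mismatch are cleared, as
  \<open>not_lexge_c_before_mismatch\<close> demands. Lowering the limit in register 27 ends the
  loop and leaves \<open>q\<close> in register 26; \<open>q = n\<close> means that there is no
  mismatch.\<close>

definition scan_prog :: "nat \<Rightarrow> com" where
  "scan_prog n = Do (Copy 26 21) ;; Do (Copy 29 0) ;; Do (Copy 27 2) ;; While n 26 27
     (ld 24 6 26 ;; ld 25 6 29 ;;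
      If 24 25 (Do (Copy 27 26)) (If 25 24 (Do (Copy 27 26))
        (st 8 26 0 ;; Do (Inc 26) ;; Do (Inc 29))))"

text \<open>This serves the case \<open>W q = 1\<close>: all \<open>k > q\<close> fail by
  \<open>lexge_c_after_mismatch\<close>, and \<open>q\<close> is no candidate because
  \<open>W q\<close> is not 0.\<close>

definition fill_prog :: "nat \<Rightarrow> com" where
  "fill_prog n = While (n + 1) 26 12 (st 8 26 0 ;; Do (Inc 26))"

definition build_prog :: "nat \<Rightarrow> com" where
  "build_prog n = Do (Copy 20 0) ;; While n 20 2
     (If 20 26 (ld 24 6 20) (If 26 20 (ld 24 5 20) (Do (Copy 24 17))) ;;
      st 9 20 24 ;; Do (Inc 20))"

text \<open>The loop limit in register 27 doubles as an exit flag: it becomes 0 as soon as the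
  comparison is decided.\<close>

definition compare_prog :: "nat \<Rightarrow> com" where
  "compare_prog n = Do (Copy 20 0) ;; Do (Copy 28 17) ;; Do (Copy 27 2) ;; While n 20 27
     (Do (Add 30 21 20) ;; If 30 2 skip (Do (Sub 30 30 2)) ;;
      ld 24 9 20 ;; ld 25 9 30 ;;
      If 24 25 (Do (Copy 28 0) ;; Do (Copy 27 0))
        (If 25 24 (Do (Copy 27 0)) (Do (Inc 20))))"

text \<open>If \<open>W q = 0\<close>, the candidates beyond \<open>q\<close> pass and only
  \<open>c q\<close> has to be built and compared. Without a mismatch, \<open>q = n\<close> and
  register 22 stays 0, so the same branch compares \<open>c n\<close>, which is
  \<open>W\<close>.\<close>

definition shift_body :: "nat \<Rightarrow> com" where
  "shift_body n = scan_prog n ;; Do (Copy 22 0) ;; If 26 2 (ld 22 6 26) skip ;;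
     If 0 22 (fill_prog n) (build_prog n ;; compare_prog n ;; If 28 17 (st 8 26 0) skip) ;;
     Do (Add 21 21 3)"

definition final_prog :: "nat \<Rightarrow> com" where
  "final_prog n = Do (Copy 28 0) ;; Do (Copy 20 0) ;; While (n + 1) 20 12
     (ld 24 8 20 ;; If 0 24 (Do (Copy 28 17)) skip ;; Do (Inc 20))"

definition oracle_prog :: "nat \<Rightarrow> nat \<Rightarrow> com" where
  "oracle_prog n m = greedy_prog n m ;; cand_prog n ;;
     (Do (Copy 21 3) ;; While m 21 2 (shift_body n)) ;; final_prog n"

context oracle_ctx
begin

lemma wp_scan_prog:
  assumes "has_W R M" "R 21 = p" "p \<in> shifts n d"
  shows "wp B (scan_prog n) (\<lambda>R' M'. has_W R' M' \<and> R' 21 = p \<and> p \<le> R' 26 \<and> R' 26 \<le> n \<and>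
      (\<forall>j. p \<le> j \<and> j < R' 26 \<longrightarrow> W j = W (j - p)) \<and>
      (R' 26 < n \<longrightarrow> W (R' 26) \<noteq> W (R' 26 - p)) \<and>
      (\<forall>k\<le>n. M' (aB + 4 * n + k) = (if p \<le> k \<and> k < R' 26 then 0 else M (aB + 4 * n + k)))) R M"
proof -
  define I where "I R' M' \<longleftrightarrow> has_W R' M' \<and> R' 21 = p \<and> R' 29 = R' 26 - p \<and> p \<le> R' 26 \<and>
      R' 26 \<le> R' 27 \<and> R' 27 \<le> n \<and>
      (\<forall>j. p \<le> j \<and> j < R' 26 \<longrightarrow> W j = W (j - p)) \<and>
      (R' 27 < n \<longrightarrow> R' 26 = R' 27 \<and> W (R' 26) \<noteq> W (R' 26 - p)) \<and>
      (\<forall>k\<le>n. M' (aB + 4 * n + k) = (if p \<le> k \<and> k < R' 26 then 0 else M (aB + 4 * n + k)))" for R' M'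
  have pn: "0 < p" "p < n" using assms(3) by (auto simp: shifts_def)
  let ?c = "ld 24 6 26 ;; ld 25 6 29 ;;
      If 24 25 (Do (Copy 27 26)) (If 25 24 (Do (Copy 27 26))
        (st 8 26 0 ;; Do (Inc 26) ;; Do (Inc 29)))"
  have loop: "wp B (While n 26 27 ?c) (\<lambda>R' M'. I R' M' \<and> \<not> R' 26 < R' 27)
      (R(26 := p, 29 := 0, 27 := n)) M"
  proof (rule wp_while[where I = I and f = "\<lambda>R M. R 27 - R 26"])
    show "I (R(26 := p, 29 := 0, 27 := n)) M"
      using assms pn by (simp add: I_def has_W_upd_reg)
    show "(R(26 := p, 29 := 0, 27 := n)) 27 - (R(26 := p, 29 := 0, 27 := n)) 26 \<le> n" by simp
  next
    fix R' M' assume I: "I R' M'" and lt: "R' 26 < R' 27"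
    define q where "q = R' 26"
    have q: "R' 26 = q" "q < n" "R' 27 = n" "R' 29 = q - p" "p \<le> q" "has_W R' M'" "R' 21 = p"
      "\<forall>j. p \<le> j \<and> j < q \<longrightarrow> W j = W (j - p)"
      "\<forall>k\<le>n. M' (aB + 4 * n + k) = (if p \<le> k \<and> k < q then 0 else M (aB + 4 * n + k))"
      using I lt unfolding I_def q_def by auto
    note r = has_W_regs[OF q(6)]
    have Wq: "M' (aB + 2 * n + q) = W q" "M' (aB + 2 * n + (q - p)) = W (q - p)"
      using q(2,6) by (simp_all add: has_W_def)
    show "wp B ?c (\<lambda>R'' M''. I R'' M'' \<and> R'' 27 - R'' 26 < R' 27 - R' 26) R' M'"
    proof (cases "W q = W (q - p)")
      case True
      have mem: "\<forall>k\<le>n. (M'(aB + 4 * n + q := 0)) (aB + 4 * n + k) =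
          (if p \<le> k \<and> k < Suc q then 0 else M (aB + 4 * n + k))"
        using q(5,9) by (auto simp: less_Suc_eq)
      have eq: "\<forall>j. p \<le> j \<and> j < Suc q \<longrightarrow> W j = W (j - p)"
        using q(8) True by (auto simp: less_Suc_eq)
      have "I (R'(24 := a, 23 := b, 25 := e, 23 := b', 26 := Suc q, 29 := Suc (q - p)))
          (M'(aB + 4 * n + q := 0))" for a b e b'
        unfolding I_def using q(2-7) mem eq
        by (simp add: has_W_upd_reg has_W_upd_mem Suc_diff_le)
      then have "I (R'(23 := b, 24 := a, 23 := b', 25 := e, 23 := b'', 26 := Suc q, 29 := Suc (q - p)))
          (M'(aB + 4 * n + q := 0))" for a b e b' b''
        by (simp add: fun_upd_twist)
      moreover have "aB + 2 * n + (q - p) \<le> B" "n - Suc q < n - q"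
        using B q(2) by linarith+
      ultimately show ?thesis
        using r B q(1-7) Wq True by simp
    next
      case False
      have "I (R'(23 := b, 24 := a, 23 := b', 25 := e, 27 := q)) M'" for a b e b'
        unfolding I_def using q False by (simp add: has_W_upd_reg)
      moreover have "aB + 2 * n + (q - p) \<le> B"
        using B q(2) by linarith
      ultimately show ?thesis
        using r B q(1-7) Wq False by (simp add: not_less)
    qed
  qed simp
  then have "wp B (While n 26 27 ?c) (\<lambda>R' M'. has_W R' M' \<and> R' 21 = p \<and> p \<le> R' 26 \<and> R' 26 \<le> n \<and>
      (\<forall>j. p \<le> j \<and> j < R' 26 \<longrightarrow> W j = W (j - p)) \<and>
      (R' 26 < n \<longrightarrow> W (R' 26) \<noteq> W (R' 26 - p)) \<and>
      (\<forall>k\<le>n. M' (aB + 4 * n + k) = (if p \<le> k \<and> k < R' 26 then 0 else M (aB + 4 * n + k))))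
      (R(26 := p, 29 := 0, 27 := n)) M"
    by (rule wp_mono) (auto simp: I_def)
  then show ?thesis
    using has_W_regs[OF assms(1)] assms(2) by (simp only: scan_prog_def wp.simps(1,2) wp_instr.simps) simp
qed

lemma wp_fill_prog:
  assumes "has_W R M" "R 26 = q" "q \<le> n"
  shows "wp B (fill_prog n) (\<lambda>R' M'. has_W R' M' \<and> R' 21 = R 21 \<and>
      (\<forall>k\<le>n. M' (aB + 4 * n + k) = (if q \<le> k then 0 else M (aB + 4 * n + k)))) R M"
proof -
  define I where "I i R' M' \<longleftrightarrow> R' 26 = i \<and> has_W R' M' \<and> R' 21 = R 21 \<and> q \<le> i \<and>
      (\<forall>k\<le>n. M' (aB + 4 * n + k) = (if q \<le> k \<and> k < i then 0 else M (aB + 4 * n + k)))" for i R' M'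
  show ?thesis
    unfolding fill_prog_def
  proof (rule wp_for[where I = I and i = q and u = "n + 1"])
    show "I q R M" using assms by (simp add: I_def)
  next
    fix i R' M' assume "I i R' M'"
    then have i: "R' 26 = i" "has_W R' M'" "R' 21 = R 21" "q \<le> i"
      "\<forall>k\<le>n. M' (aB + 4 * n + k) = (if q \<le> k \<and> k < i then 0 else M (aB + 4 * n + k))"
      by (simp_all add: I_def)
    note r = has_W_regs[OF i(2)]
    then show "R' 26 = i \<and> R' 12 = n + 1" using i by simp
    assume lt: "i < n + 1"
    have "\<forall>k\<le>n. (M'(aB + 4 * n + i := 0)) (aB + 4 * n + k) =
        (if q \<le> k \<and> k < Suc i then 0 else M (aB + 4 * n + k))"
      using i(4,5) by (auto simp: less_Suc_eq)
    then have "I (Suc i) (R'(23 := b, 26 := Suc i)) (M'(aB + 4 * n + i := 0))" for b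
      unfolding I_def using i lt by (simp add: has_W_upd_reg has_W_upd_mem)
    then show "wp B (st 8 26 0 ;; Do (Inc 26)) (I (Suc i)) R' M'"
      using i r B lt by simp
  next
    fix R' M' assume "I (n + 1) R' M'"
    then show "has_W R' M' \<and> R' 21 = R 21 \<and>
      (\<forall>k\<le>n. M' (aB + 4 * n + k) = (if q \<le> k then 0 else M (aB + 4 * n + k)))"
      by (auto simp: I_def)
  qed (use assms in simp_all)
qed

lemma wp_build_prog:
  assumes "has_W R M" "R 26 = q"
  shows "wp B (build_prog n) (\<lambda>R' M'. has_W R' M' \<and> R' 21 = R 21 \<and> R' 26 = q \<and>
      (\<forall>k\<le>n. M' (aB + 4 * n + k) = M (aB + 4 * n + k)) \<and>
      (\<forall>i<n. M' (aB + 5 * n + 1 + i) = c q i)) R M"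
proof -
  define I where "I i R' M' \<longleftrightarrow> R' 20 = i \<and> has_W R' M' \<and> R' 21 = R 21 \<and> R' 26 = q \<and>
      (\<forall>k\<le>n. M' (aB + 4 * n + k) = M (aB + 4 * n + k)) \<and>
      (\<forall>j<i. M' (aB + 5 * n + 1 + j) = c q j)" for i R' M'
  have "wp B (While n 20 2
     (If 20 26 (ld 24 6 20) (If 26 20 (ld 24 5 20) (Do (Copy 24 17))) ;;
      st 9 20 24 ;; Do (Inc 20))) (\<lambda>R' M'. has_W R' M' \<and> R' 21 = R 21 \<and> R' 26 = q \<and>
      (\<forall>k\<le>n. M' (aB + 4 * n + k) = M (aB + 4 * n + k)) \<and>
      (\<forall>i<n. M' (aB + 5 * n + 1 + i) = c q i)) (R(20 := 0)) M"
  proof (rule wp_for[where I = I and i = 0 and u = n])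
    show "I 0 (R(20 := 0)) M" using assms by (simp add: I_def has_W_upd_reg)
  next
    fix i R' M' assume "I i R' M'"
    then have i: "R' 20 = i" "has_W R' M'" "R' 21 = R 21" "R' 26 = q"
      "\<forall>k\<le>n. M' (aB + 4 * n + k) = M (aB + 4 * n + k)"
      "\<forall>j<i. M' (aB + 5 * n + 1 + j) = c q j"
      by (simp_all add: I_def)
    note r = has_W_regs[OF i(2)]
    then show "R' 20 = i \<and> R' 2 = n" using i by simp
    assume lt: "i < n"
    have 1: "M' (aB + 2 * n + i) = W i" using i(2) lt by (simp add: has_W_def)
    have 2: "M' (aB + n + i) = l i" using i(2) lt M0_l unfolding has_W_def by blast
    have step: "I (Suc i) (R''(20 := Suc i)) (M'(aB + 5 * n + 1 + i := v))"
      if "has_W R'' M'" "R'' 21 = R 21" "R'' 26 = q" "v = c q i" for R'' v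
    proof -
      have "has_W R'' (M'(aB + 5 * n + 1 + i := v))"
        using that(1) lt by (intro has_W_upd_mem) simp_all
      then show ?thesis
        using that i(5,6) lt unfolding I_def by (simp add: has_W_upd_reg less_Suc_eq)
    qed
    show "wp B (If 20 26 (ld 24 6 20) (If 26 20 (ld 24 5 20) (Do (Copy 24 17))) ;;
      st 9 20 24 ;; Do (Inc 20)) (I (Suc i)) R' M'"
      using r B i(1,4) lt 1 2 step[of _ "c q i"] i(2,3)
      by (cases i q rule: linorder_cases) (simp_all add: has_W_upd_reg c_def)
  next
    fix R' M' assume "I n R' M'"
    then show "has_W R' M' \<and> R' 21 = R 21 \<and> R' 26 = q \<and>
      (\<forall>k\<le>n. M' (aB + 4 * n + k) = M (aB + 4 * n + k)) \<and>
      (\<forall>i<n. M' (aB + 5 * n + 1 + i) = c q i)"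
      by (simp add: I_def)
  qed simp_all
  then show ?thesis
    using has_W_regs[OF assms(1)] by (simp add: build_prog_def)
qed

lemma wp_compare_prog:
  assumes "has_W R M" "R 21 = p" "p \<in> shifts n d" "\<forall>i<n. M (aB + 5 * n + 1 + i) = x i"
  shows "wp B (compare_prog n) (\<lambda>R' M'. M' = M \<and> has_W R' M \<and> R' 21 = p \<and> R' 26 = R 26 \<and>
      R' 28 = of_bool (lexge n x (rot n p x))) R M"
proof -
  define I where "I R' M' \<longleftrightarrow> M' = M \<and> has_W R' M \<and> R' 21 = p \<and> R' 26 = R 26 \<and> R' 20 \<le> n \<and>
      (if R' 27 = 0 then R' 28 = of_bool (lexge n x (rot n p x))
       else R' 27 = n \<and> R' 28 = 1 \<and> (\<forall>j<R' 20. x j = rot n p x j))" for R' M'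
  let ?c = "Do (Add 30 21 20) ;; If 30 2 skip (Do (Sub 30 30 2)) ;;
      ld 24 9 20 ;; ld 25 9 30 ;;
      If 24 25 (Do (Copy 28 0) ;; Do (Copy 27 0))
        (If 25 24 (Do (Copy 27 0)) (Do (Inc 20)))"
  have pn: "0 < p" "p < n" using assms(3) by (auto simp: shifts_def)
  have loop: "wp B (While n 20 27 ?c) (\<lambda>R' M'. I R' M' \<and> \<not> R' 20 < R' 27)
      (R(20 := 0, 28 := 1, 27 := n)) M"
  proof (rule wp_while[where I = I and f = "\<lambda>R M. R 27 - R 20"])
    show "I (R(20 := 0, 28 := 1, 27 := n)) M"
      using assms pn by (simp add: I_def has_W_upd_reg)
    show "(R(20 := 0, 28 := 1, 27 := n)) 27 - (R(20 := 0, 28 := 1, 27 := n)) 20 \<le> n" by simp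
  next
    fix R' M' assume I: "I R' M'" and lt: "R' 20 < R' 27"
    define i where "i = R' 20"
    have i: "M' = M" "has_W R' M" "R' 21 = p" "R' 26 = R 26" "R' 20 = i" "i < n" "R' 27 = n"
      "R' 28 = 1" "\<forall>j<i. x j = rot n p x j"
      using I lt unfolding I_def i_def by (auto split: if_splits)
    note r = has_W_regs[OF i(2)]
    define t where "t = (if p + i < n then p + i else p + i - n)"
    have "p + i - n < n" using i(6) pn by linarith
    then have t: "t < n" by (simp add: t_def)
    have v: "M (aB + 5 * n + 1 + i) = x i" "M (aB + 5 * n + 1 + t) = rot n p x i"
      using assms(4) i(6) t by (simp_all add: rot_def t_def)
    have bound: "p + i \<le> B" "aB + 5 * n + 1 + i \<le> B" "aB + 5 * n + 1 + t \<le> B"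
      using B pn i(6) t by simp_all
    have W': "has_W R'' M" if "has_W R''' M" "R'' = R'''(k := z)" "20 \<le> k" for R'' R''' k z
      using that has_W_upd_reg by simp
    show "wp B ?c (\<lambda>R'' M''. I R'' M'' \<and> R'' 27 - R'' 20 < R' 27 - R' 20) R' M'"
    proof -
      let ?P = "\<lambda>R'' M''. I R'' M'' \<and> R'' 27 - R'' 20 < R' 27 - R' 20"
      let ?d = "ld 24 9 20 ;; ld 25 9 30 ;;
        If 24 25 (Do (Copy 28 0) ;; Do (Copy 27 0)) (If 25 24 (Do (Copy 27 0)) (Do (Inc 20)))"
      have "wp B ?d ?P R2 M" if R2: "has_W R2 M" "R2 21 = p" "R2 26 = R 26" "R2 20 = i" "R2 27 = n"
        "R2 28 = 1" "R2 30 = t" for R2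
      proof -
        note r2 = has_W_regs[OF R2(1)]
        have cmp: "lexge n x (rot n p x) \<longleftrightarrow> rot n p x i < x i" if "x i \<noteq> rot n p x i"
          using i(6,9) that by (intro lexge_first_diff) auto
        show ?thesis
        proof (cases "x i" "rot n p x i" rule: linorder_cases)
          case less
          then show ?thesis
            using r2 R2 bound v cmp i(5,6,7) pn by (simp add: I_def has_W_upd_reg)
        next
          case greater
          then show ?thesis
            using r2 R2 bound v cmp i(5,6,7) pn by (simp add: I_def has_W_upd_reg)
        next
          case equal
          then show ?thesis
            using r2 R2 bound v i(5,6,7,9) pn by (auto simp add: I_def has_W_upd_reg less_Suc_eq)
        qed
      qed
      note * = this
      have "wp B ?d ?P (R'(30 := p + i, 23 := z)) M" if "p + i < n" for z
        by (rule *) (use that i in \<open>simp_all add: has_W_upd_reg t_def\<close>)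
      moreover have "wp B ?d ?P (R'(30 := p + i)) M" if "p + i < n"
        by (rule *) (use that i in \<open>simp_all add: has_W_upd_reg t_def\<close>)
      moreover have "wp B ?d ?P (R'(30 := p + i - n)) M" if "\<not> p + i < n"
        by (rule *) (use that i in \<open>simp_all add: has_W_upd_reg t_def\<close>)
      moreover have "wp B (Do (Add 30 21 20) ;; If 30 2 skip (Do (Sub 30 30 2)) ;; D) P R' M"
        if "\<And>z. p + i < n \<Longrightarrow> wp B D P (R'(30 := p + i, 23 := z)) M"
          "p + i < n \<Longrightarrow> wp B D P (R'(30 := p + i)) M"
          "\<not> p + i < n \<Longrightarrow> wp B D P (R'(30 := p + i - n)) M" for D P
        using that r i(3,5) bound(1) by simp
      ultimately show ?thesis unfolding i(1) by blast
    qed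
  qed simp
  have "wp B (While n 20 27 ?c) (\<lambda>R' M'. M' = M \<and> has_W R' M \<and> R' 21 = p \<and> R' 26 = R 26 \<and>
      R' 28 = of_bool (lexge n x (rot n p x))) (R(20 := 0, 28 := 1, 27 := n)) M"
    using loop
  proof (rule wp_mono)
    fix R' M' assume *: "I R' M' \<and> \<not> R' 20 < R' 27"
    have "lexge n x (rot n p x)" if "\<forall>j<n. x j = rot n p x j"
      using that by (simp add: lexge_def)
    with * show "M' = M \<and> has_W R' M \<and> R' 21 = p \<and> R' 26 = R 26 \<and>
      R' 28 = of_bool (lexge n x (rot n p x))"
      by (auto simp: I_def split: if_splits)
  qed
  then show ?thesis
    using has_W_regs[OF assms(1)] by (simp only: compare_prog_def wp.simps(1,2) wp_instr.simps) simp
qed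

text \<open>These are the candidates left after all rotations below \<open>p\<close> have been
  processed. Rotations by more than \<open>k\<close> are omitted because they never violate the
  constraint.\<close>

definition good :: "nat \<Rightarrow> nat \<Rightarrow> bool" where
  "good p k \<longleftrightarrow> cand k \<and> (\<forall>q\<in>shifts n d. q < p \<longrightarrow> q \<le> k \<longrightarrow> lexge n (c k) (rot n q (c k)))"

definition has_good :: "nat \<Rightarrow> (nat \<Rightarrow> nat) \<Rightarrow> (nat \<Rightarrow> nat) \<Rightarrow> bool" where
  "has_good p R M \<longleftrightarrow> has_W R M \<and> R 21 = p \<and> (\<forall>k\<le>n. M (aB + 4 * n + k) = of_bool (good p k))"

lemma good_add:
  "p \<in> shifts n d \<Longrightarrow> good (p + d) k \<longleftrightarrow> good p k \<and> (p \<le> k \<longrightarrow> lexge n (c k) (rot n p (c k)))"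
  unfolding good_def shifts_all_add by blast

lemma wp_shift_body:
  assumes "has_good p R M" and p: "p \<in> shifts n d"
  shows "wp B (shift_body n) (has_good (p + d)) R M"
proof -
  have pn: "0 < p" "p < n" using p by (auto simp: shifts_def)
  have W: "has_W R M" "R 21 = p" "\<forall>k\<le>n. M (aB + 4 * n + k) = of_bool (good p k)"
    using assms(1) by (simp_all add: has_good_def)
  let ?fin = "Do (Add 21 21 3)"
  have fin: "wp B ?fin (has_good (p + d)) R M"
    if "has_W R M" "R 21 = p" "\<forall>k\<le>n. M (aB + 4 * n + k) = of_bool (good (p + d) k)" for R M
    using that has_W_regs[OF that(1)] pn d_le_n B by (simp add: has_good_def has_W_upd_reg)
  have rest: "wp B (Do (Copy 22 0) ;; If 26 2 (ld 22 6 26) skip ;;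
     If 0 22 (fill_prog n) (build_prog n ;; compare_prog n ;; If 28 17 (st 8 26 0) skip) ;; ?fin)
     (has_good (p + d)) R M"
    if H: "has_W R M" "R 21 = p" "p \<le> R 26" "R 26 \<le> n"
      "\<forall>j. p \<le> j \<and> j < R 26 \<longrightarrow> W j = W (j - p)" "R 26 < n \<longrightarrow> W (R 26) \<noteq> W (R 26 - p)"
      "\<forall>k\<le>n. M (aB + 4 * n + k) = (if p \<le> k \<and> k < R 26 then 0 else of_bool (good p k))" for R M
  proof -
    define q where "q = R 26"
    note H = H[folded q_def]
    note r = has_W_regs[OF H(1)]
    have before: "\<not> good (p + d) k" if "p \<le> k" "k < q" for k
    proof
      assume "good (p + d) k"
      then have "good p k" "lexge n (c k) (rot n p (c k))"
        using that by (simp_all add: good_add[OF p])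
      then have "cand k" by (simp add: good_def)
      then show False
        using not_lexge_c_before_mismatch[of k p] \<open>lexge n (c k) _\<close> pn that H(4,5) by auto
    qed
    have after: "good (p + d) k \<longleftrightarrow> good p k \<and> W q = 0" if "q < k" "k \<le> n" for k
    proof -
      have "lexge n (c k) (rot n p (c k)) \<longleftrightarrow> W q = 0"
        using H(3,5,6) pn that by (intro lexge_c_after_mismatch) auto
      then show ?thesis using H(3) that by (auto simp: good_add[OF p])
    qed
    have less: "good (p + d) k \<longleftrightarrow> good p k" if "k < p" for k
      using that by (simp add: good_add[OF p])
    let ?tail = "If 0 22 (fill_prog n) (build_prog n ;; compare_prog n ;; If 28 17 (st 8 26 0) skip) ;; ?fin"
    have tail: "wp B ?tail (has_good (p + d)) R' M"
      if R': "has_W R' M" "R' 21 = p" "R' 26 = q" "R' 22 = (if q < n then W q else 0)" for R'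
    proof (cases "0 < R' 22")
      case True
      then have q: "q < n" "W q = 1"
        using R'(4) W_le_1[of q] by (auto split: if_splits)
      have "wp B (fill_prog n) (wp B ?fin (has_good (p + d))) R' M"
        using wp_fill_prog[OF R'(1,3) H(4)]
      proof (rule wp_mono)
        fix R'' M'' assume *: "has_W R'' M'' \<and> R'' 21 = R' 21 \<and>
          (\<forall>k\<le>n. M'' (aB + 4 * n + k) = (if q \<le> k then 0 else M (aB + 4 * n + k)))"
        have "M'' (aB + 4 * n + k) = of_bool (good (p + d) k)" if "k \<le> n" for k
        proof -
          have "\<not> good p q" using q by (simp add: good_def cand_def)
          then have "\<not> good (p + d) q" by (simp add: good_add[OF p])
          then show ?thesis
            using * that H(3,7) before[of k] after[of k] less[of k] q
            by (cases "k < p"; cases k q rule: linorder_cases) auto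
        qed
        then show "wp B ?fin (has_good (p + d)) R'' M''"
          using * R'(2) by (intro fin) auto
      qed
      then show ?thesis using True has_W_regs[OF R'(1)] by simp
    next
      case False
      have q0: "W q = 0" if "q < n" using False that R'(4) by simp
      have 1: "wp B (If 28 17 (st 8 26 0) skip ;; ?fin) (has_good (p + d)) R2 M2"
        if R2: "has_W R2 M2" "R2 21 = p" "R2 26 = q" "R2 28 = of_bool (lexge n (c q) (rot n p (c q)))"
          "\<forall>k\<le>n. M2 (aB + 4 * n + k) = M (aB + 4 * n + k)" for R2 M2
      proof -
        note r2 = has_W_regs[OF R2(1)]
        have other: "M2 (aB + 4 * n + k) = of_bool (good (p + d) k)" if "k \<le> n" "k \<noteq> q" for k
          using that R2(5) H(3,7) before[of k] after[of k] less[of k] q0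
          by (cases "k < p"; cases k q rule: linorder_cases) auto
        have at: "M2 (aB + 4 * n + q) = of_bool (good p q)"
          using R2(5) H(4,7) by simp
        show ?thesis
        proof (cases "lexge n (c q) (rot n p (c q))")
          case True
          then have "good (p + d) q \<longleftrightarrow> good p q" by (simp add: good_add[OF p])
          then have "M2 (aB + 4 * n + k) = of_bool (good (p + d) k)" if "k \<le> n" for k
            using other[OF that] at by (cases "k = q") auto
          then have "wp B ?fin (has_good (p + d)) R2 M2"
            using R2 by (intro fin) simp_all
          then show ?thesis using True r2 R2(4) by simp
        next
          case False
          then have "\<not> good (p + d) q" using H(3) by (simp add: good_add[OF p])
          then have *: "(M2(aB + 4 * n + q := 0)) (aB + 4 * n + k) = of_bool (good (p + d) k)" if "k \<le> n" for k
            using other[OF that] by (cases "k = q") auto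
          have "has_W R2 (M2(aB + 4 * n + q := 0))"
            using R2(1) H(4) by (intro has_W_upd_mem) simp_all
          then have "wp B ?fin (has_good (p + d)) (R2(23 := z)) (M2(aB + 4 * n + q := 0))" for z
            using R2(2) * by (intro fin) (simp_all add: has_W_upd_reg)
          then show ?thesis using False r2 R2(3,4) B H(4) by simp
        qed
      qed
      have 2: "wp B (compare_prog n) (wp B (If 28 17 (st 8 26 0) skip ;; ?fin) (has_good (p + d))) R2 M2"
        if R2: "has_W R2 M2 \<and> R2 21 = R' 21 \<and> R2 26 = q \<and>
          (\<forall>k\<le>n. M2 (aB + 4 * n + k) = M (aB + 4 * n + k)) \<and>
          (\<forall>i<n. M2 (aB + 5 * n + 1 + i) = c q i)" for R2 M2
      proof (rule wp_mono[OF wp_compare_prog[where p = p and x = "c q"]])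
        show "has_W R2 M2" "R2 21 = p" "p \<in> shifts n d" "\<forall>i<n. M2 (aB + 5 * n + 1 + i) = c q i"
          using R2 R'(2) p by auto
        fix R3 M3 assume "M3 = M2 \<and> has_W R3 M2 \<and> R3 21 = p \<and> R3 26 = R2 26 \<and>
          R3 28 = of_bool (lexge n (c q) (rot n p (c q)))"
        then show "wp B (If 28 17 (st 8 26 0) skip ;; ?fin) (has_good (p + d)) R3 M3"
          using R2 by (intro 1) auto
      qed
      have "wp B (build_prog n) (wp B (compare_prog n)
          (wp B (If 28 17 (st 8 26 0) skip ;; ?fin) (has_good (p + d)))) R' M"
        using wp_build_prog[OF R'(1,3)] by (rule wp_mono) (rule 2)
      then show ?thesis
        using False has_W_regs[OF R'(1)] by (simp only: wp_Seq wp.simps(3) if_False)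
    qed
    have "wp B (Do (Copy 22 0) ;; If 26 2 (ld 22 6 26) skip ;; T) P R M"
      if "q < n \<Longrightarrow> wp B T P (R(23 := aB + 2 * n + q, 22 := W q)) M"
        "\<not> q < n \<Longrightarrow> wp B T P (R(22 := 0, 23 := R 23)) M" for T P
    proof (cases "q < n")
      case True
      then have "M (aB + 2 * n + q) = W q" "aB + 2 * n + q \<le> B"
        using H(1) B by (simp_all add: has_W_def)
      then show ?thesis
        using that(1)[OF True] True r q_def[symmetric] by simp
    next
      case False
      then show ?thesis
        using that(2)[OF False] r q_def[symmetric] by simp
    qed
    moreover have "wp B ?tail (has_good (p + d)) (R(23 := aB + 2 * n + q, 22 := W q)) M" if "q < n"
      by (rule tail) (use H that q_def in \<open>simp_all add: has_W_upd_reg\<close>)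
    moreover have "wp B ?tail (has_good (p + d)) (R(22 := 0, 23 := R 23)) M" if "\<not> q < n"
      by (rule tail) (use H that q_def in \<open>simp_all add: has_W_upd_reg\<close>)
    ultimately show ?thesis by blast
  qed
  show ?thesis
    unfolding shift_body_def wp.simps(2)[of B "scan_prog n"]
    using wp_scan_prog[OF W(1,2) p]
  proof (rule wp_mono)
    fix R' M' assume *: "has_W R' M' \<and> R' 21 = p \<and> p \<le> R' 26 \<and> R' 26 \<le> n \<and>
      (\<forall>j. p \<le> j \<and> j < R' 26 \<longrightarrow> W j = W (j - p)) \<and>
      (R' 26 < n \<longrightarrow> W (R' 26) \<noteq> W (R' 26 - p)) \<and>
      (\<forall>k\<le>n. M' (aB + 4 * n + k) = (if p \<le> k \<and> k < R' 26 then 0 else M (aB + 4 * n + k)))"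
    show "wp B (Do (Copy 22 0) ;; If 26 2 (ld 22 6 26) skip ;;
     If 0 22 (fill_prog n) (build_prog n ;; compare_prog n ;; If 28 17 (st 8 26 0) skip) ;; ?fin)
     (has_good (p + d)) R' M'"
      by (rule rest) (use * W(3) in auto)
  qed
qed

lemma wp_final_prog:
  assumes "has_good n R M"
  shows "wp B (final_prog n) (\<lambda>R M. base R M \<and> R 28 = of_bool (lexmax_box n d l h \<noteq> {})) R M"
proof -
  define I where "I i R' M' \<longleftrightarrow> M' = M \<and> R' 20 = i \<and> has_W R' M \<and> R' 28 = of_bool (\<exists>k<i. good n k)" for i R' M'
  have M: "has_W R M" "\<forall>k\<le>n. M (aB + 4 * n + k) = of_bool (good n k)"
    using assms by (simp_all add: has_good_def)
  let ?c = "ld 24 8 20 ;; If 0 24 (Do (Copy 28 17)) skip ;; Do (Inc 20)"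
  have "wp B (While (n + 1) 20 12 ?c)
      (\<lambda>R M. base R M \<and> R 28 = of_bool (lexmax_box n d l h \<noteq> {})) (R(28 := 0, 20 := 0)) M"
  proof (rule wp_for[where I = I and i = 0 and u = "n + 1"])
    show "I 0 (R(28 := 0, 20 := 0)) M" using M by (simp add: I_def has_W_upd_reg)
  next
    fix i R' M' assume "I i R' M'"
    then have i: "R' 20 = i" "has_W R' M" "M' = M" "R' 28 = of_bool (\<exists>k<i. good n k)"
      by (simp_all add: I_def)
    note r = has_W_regs[OF i(2)]
    then show "R' 20 = i \<and> R' 12 = n + 1" using i by simp
    assume lt: "i < n + 1"
    then have Mi: "M (aB + 4 * n + i) = of_bool (good n i)" using M by simp
    have ex: "(\<exists>k<Suc i. good n k) \<longleftrightarrow> (\<exists>k<i. good n k) \<or> good n i" by (auto simp: less_Suc_eq)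
    show "wp B ?c (I (Suc i)) R' M'"
    proof (cases "good n i")
      case True
      then show ?thesis
        unfolding I_def ex using r i B lt Mi by (simp add: has_W_upd_reg)
    next
      case False
      then show ?thesis
        unfolding I_def ex using r i B lt Mi by (simp add: has_W_upd_reg)
    qed
  next
    fix R' M' assume "I (n + 1) R' M'"
    then have "base R' M'" "R' 28 = of_bool (\<exists>k<n + 1. good n k)" by (simp_all add: I_def has_W_def)
    moreover have "(\<exists>k<n + 1. good n k) \<longleftrightarrow> lexmax_box n d l h \<noteq> {}"
      unfolding lexmax_box_nonempty_iff good_def by (auto simp: less_Suc_eq_le shifts_def)
    ultimately show "base R' M' \<and> R' 28 = of_bool (lexmax_box n d l h \<noteq> {})" by simp
  qed simp_all
  then show ?thesis
    using has_W_regs[OF M(1)] by (simp add: final_prog_def)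
qed

theorem wp_oracle_prog:
  assumes "base R M"
  shows "wp B (oracle_prog n m) (\<lambda>R M. base R M \<and> R 28 = of_bool (lexmax_box n d l h \<noteq> {})) R M"
    (is "wp B _ ?Q R M")
proof -
  have 1: "wp B (Do (Copy 21 3) ;; While m 21 2 (shift_body n)) (wp B (final_prog n) ?Q) R M"
    if "has_W R M \<and> (\<forall>k\<le>n. M (aB + 4 * n + k) = of_bool (cand k))" for R M
  proof -
    have "good d k \<longleftrightarrow> cand k" for k
      using not_shift_less_d by (auto simp: good_def)
    then have "has_good d (R(21 := d)) M"
      using that by (simp add: has_good_def has_W_upd_reg)
    then have "wp B (While m 21 2 (shift_body n)) (wp B (final_prog n) ?Q) (R(21 := d)) M"
    proof (rule wp_for_shifts[where I = has_good, OF nm d m order_refl])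
      show "R' 21 = p \<and> R' 2 = n" if "has_good p R' M'" for p R' M'
        using that has_W_regs unfolding has_good_def by blast
    qed (rule wp_shift_body wp_final_prog; assumption)+
    moreover have "R 3 = d" using that has_W_regs by blast
    ultimately show ?thesis by simp
  qed
  have 2: "wp B (cand_prog n ;; (Do (Copy 21 3) ;; While m 21 2 (shift_body n)) ;; final_prog n) ?Q R M"
    if "has_W R M" for R M
    unfolding wp.simps(2)[of B "cand_prog n"]
    using wp_cand_prog[OF that]
  proof (rule wp_mono)
    fix R M assume "has_W R M \<and> (\<forall>k\<le>n. M (aB + 4 * n + k) = of_bool (cand k))"
    from 1[OF this] show "wp B ((Do (Copy 21 3) ;; While m 21 2 (shift_body n)) ;; final_prog n) ?Q R M"
      by (simp only: wp_Seq)
  qed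
  show ?thesis
    unfolding oracle_prog_def wp.simps(2)[of B "greedy_prog n m"]
    using wp_greedy_prog[OF assms] by (rule wp_mono) (rule 2)
qed

end

section \<open>The complete program\<close>

definition regs :: "nat \<Rightarrow> nat \<Rightarrow> nat \<Rightarrow> (nat \<Rightarrow> nat) \<Rightarrow> bool" where
  "regs n d aB R \<longleftrightarrow> R 0 = 0 \<and> R 17 = 1 \<and> R 2 = n \<and> R 3 = d \<and> R 4 = aB \<and> R 5 = aB + n \<and>
     R 6 = aB + 2 * n \<and> R 7 = aB + 3 * n \<and> R 8 = aB + 4 * n \<and> R 9 = aB + 5 * n + 1 \<and>
     R 10 = aB + 6 * n + 1 \<and> R 11 = aB + 7 * n + 1 \<and> R 12 = n + 1"

definition feasible :: "nat \<Rightarrow> nat \<Rightarrow> nat \<Rightarrow> (nat \<Rightarrow> nat) \<Rightarrow> bool" where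
  "feasible n d aB M \<longleftrightarrow> lexmax_box n d (\<lambda>i. M (aB + n + i)) (\<lambda>i. 1 - M (aB + i)) \<noteq> {}"

lemma feasible_cong:
  assumes "\<And>a. a < aB + 2 * n \<Longrightarrow> M a = M' a"
  shows "feasible n d aB M \<longleftrightarrow> feasible n d aB M'"
proof -
  have "M (aB + n + i) = M' (aB + n + i) \<and> M (aB + i) = M' (aB + i)" if "i < n" for i
    using that assms by simp
  then show ?thesis unfolding feasible_def lexmax_box_def by simp
qed

lemma wp_oracle:
  assumes "n = m * d" "0 < d" "0 < m" "aB + 9 * n + 2 \<le> B"
    and "\<And>i. i < n \<Longrightarrow> M (aB + n + i) + M (aB + i) \<le> 1" and "regs n d aB R"
  shows "wp B (oracle_prog n m) (\<lambda>R' M'. regs n d aB R' \<and> R' 13 = R 13 \<and> R' 14 = R 14 \<and> R' 15 = R 15 \<and>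
     (\<forall>a. a < aB + 2 * n \<or> aB + 6 * n + 1 \<le> a \<longrightarrow> M' a = M a) \<and>
     R' 28 = of_bool (feasible n d aB M)) R M"
proof -
  interpret oracle_ctx n d m aB B R M
    by unfold_locales (use assms in auto)
  have "base R M" using assms(6) by (simp add: base_def regs_def)
  from wp_oracle_prog[OF this] show ?thesis
    by (rule wp_mono) (simp add: base_def regs_def feasible_def l_def[abs_def] h_def[abs_def])
qed

text \<open>The machine has truncated subtraction and no test for equality; the sum of both
  differences is the distance of the operands and vanishes iff they are equal.\<close>

definition gcd_step :: com where
  "gcd_step = Do (Sub 26 3 25) ;; Do (Sub 27 25 3) ;; Do (Add 26 26 27)"

text \<open>Each round decreases the sum of the two operands, which is at most \<open>2 * n\<close>
  at the start. Both stay positive, as a round is only entered with distinct operands.\<close>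

definition gcd_prog :: "nat \<Rightarrow> com" where
  "gcd_prog n = gcd_step ;;
     While (2 * n) 0 26 (If 3 25 (Do (Sub 25 25 3)) (Do (Sub 3 3 25)) ;; gcd_step)"

text \<open>Register 4 walks over the generator tables in steps of \<open>n\<close>. After the last
  one it points to the array of the entries fixed to 0, which is its final meaning.\<close>

definition setup_prog :: "nat \<Rightarrow> nat \<Rightarrow> com" where
  "setup_prog n m = Do (Const 17 1) ;; Do (Load 2 0) ;; Do (Load 16 17) ;; Do (Copy 3 2) ;; Do (Const 4 2) ;;
     While m 20 16 (Do (Load 24 4) ;; Do (Copy 25 2) ;; Do (Inc 25) ;; Do (Sub 25 25 24) ;;
       gcd_prog n ;; Do (Add 4 4 2) ;; Do (Inc 20)) ;;
     Do (Add 5 4 2) ;; Do (Add 6 5 2) ;; Do (Add 7 6 2) ;; Do (Add 8 7 2) ;; Do (Copy 12 2) ;; Do (Inc 12) ;;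
     Do (Add 9 8 12) ;; Do (Add 10 9 2) ;; Do (Add 11 10 2)"

text \<open>The test overwrites one bit of the instance in place; register \<open>r\<close> holds
  the old bit, so that it can be restored.\<close>

definition peek_prog :: "nat \<Rightarrow> nat \<Rightarrow> nat \<Rightarrow> nat \<Rightarrow> com" where
  "peek_prog n m b r = st b 13 17 ;; oracle_prog n m ;; st b 13 r ;; Do (Sub 24 17 28)"

text \<open>An entry already fixed to the opposite value is not tested, since the two bits together
  would describe an empty box. One fixed to the same value is tested like any other.\<close>

definition main_prog :: "nat \<Rightarrow> nat \<Rightarrow> com" where
  "main_prog n m = Do (Copy 13 0) ;; While n 13 2
     (ld 14 4 13 ;; ld 15 5 13 ;;
      If 14 17 (peek_prog n m 5 15) (Do (Copy 24 17)) ;; st 10 13 24 ;;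
      If 15 17 (peek_prog n m 4 14) (Do (Copy 24 17)) ;; st 11 13 24 ;;
      Do (Inc 13))"

text \<open>Emptiness needs no further test: the set is empty iff the first entry can take neither
  of the two values.\<close>

definition finish_prog :: "nat \<Rightarrow> com" where
  "finish_prog n = Do (Load 24 10) ;; Do (Load 25 11) ;;
     If 24 17 (Do (Copy 26 17)) (If 25 17 (Do (Copy 26 17)) (Do (Copy 26 0))) ;;
     If 0 26
       (Do (Store 0 17) ;; Do (Copy 20 0) ;; While n 20 2
         (ld 24 10 20 ;; Do (Copy 25 20) ;; Do (Inc 25) ;; Do (Store 25 24) ;;
          ld 24 11 20 ;; Do (Add 25 25 2) ;; Do (Store 25 24) ;; Do (Inc 20)))
       (Do (Store 0 0))"

definition fixing_prog :: "nat \<Rightarrow> nat \<Rightarrow> com" where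
  "fixing_prog n m = setup_prog n m ;; main_prog n m ;; finish_prog n"

lemma wp_gcd_prog:
  assumes "R 0 = 0" "0 < R 3" "R 3 \<le> n" "0 < R 25" "R 25 \<le> n" "2 * n \<le> B"
  shows "wp B (gcd_prog n) (\<lambda>R' M'. M' = M \<and> (\<forall>r. r \<notin> {3, 25, 26, 27} \<longrightarrow> R' r = R r) \<and>
    R' 3 = gcd (R 3) (R 25)) R M"
    (is "wp B _ ?Q R M")
proof -
  define I where "I R' M' \<longleftrightarrow> M' = M \<and> (\<forall>r. r \<notin> {3, 25, 26, 27} \<longrightarrow> R' r = R r) \<and>
    gcd (R' 3) (R' 25) = gcd (R 3) (R 25) \<and> 0 < R' 3 \<and> R' 3 \<le> n \<and> 0 < R' 25 \<and> R' 25 \<le> n \<and>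
    R' 26 = (R' 3 - R' 25) + (R' 25 - R' 3)" for R' M'
  have step: "wp B gcd_step (\<lambda>R'' M''. I R'' M'' \<and> R'' 3 = R' 3 \<and> R'' 25 = R' 25) R' M"
    if "\<forall>r. r \<notin> {3, 25, 26, 27} \<longrightarrow> R' r = R r" "gcd (R' 3) (R' 25) = gcd (R 3) (R 25)"
      "0 < R' 3" "R' 3 \<le> n" "0 < R' 25" "R' 25 \<le> n" for R'
    using that assms(6) unfolding gcd_step_def I_def by auto
  have loop: "wp B (While (2 * n) 0 26 (If 3 25 (Do (Sub 25 25 3)) (Do (Sub 3 3 25)) ;; gcd_step)) ?Q R' M'"
    if "I R' M'" for R' M'
  proof (rule wp_while[where I = I and f = "\<lambda>R M. R 3 + R 25", OF that])
    show "R' 3 + R' 25 \<le> 2 * n" using that by (simp add: I_def)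
  next
    fix R' M' assume I: "I R' M'" and "R' 0 < R' 26"
    then have ne: "R' 3 \<noteq> R' 25" using assms(1) by (auto simp: I_def)
    have M': "M' = M" using I by (simp add: I_def)
    have "wp B (If 3 25 (Do (Sub 25 25 3)) (Do (Sub 3 3 25)))
        (wp B gcd_step (\<lambda>R'' M''. I R'' M'' \<and> R'' 3 + R'' 25 < R' 3 + R' 25)) R' M'"
    proof (cases "R' 3 < R' 25")
      case True
      have "wp B gcd_step (\<lambda>R'' M''. I R'' M'' \<and> R'' 3 = R' 3 \<and> R'' 25 = R' 25 - R' 3) (R'(25 := R' 25 - R' 3)) M"
      proof -
        have "gcd (R' 3) (R' 25 - R' 3) = gcd (R' 3) (R' 25)"
          using True gcd_diff1_nat[of "R' 3" "R' 25"] by (simp add: gcd.commute)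
        moreover have "R' 25 - R' 3 \<le> n"
          using I unfolding I_def by linarith
        ultimately show ?thesis
          using step[of "R'(25 := R' 25 - R' 3)"] I True by (simp add: I_def)
      qed
      then have "wp B gcd_step (\<lambda>R'' M''. I R'' M'' \<and> R'' 3 + R'' 25 < R' 3 + R' 25) (R'(25 := R' 25 - R' 3)) M"
        by (rule wp_mono) (use True I in \<open>auto simp: I_def\<close>)
      then show ?thesis using True M' by simp
    next
      case False
      have "wp B gcd_step (\<lambda>R'' M''. I R'' M'' \<and> R'' 3 = R' 3 - R' 25 \<and> R'' 25 = R' 25) (R'(3 := R' 3 - R' 25)) M"
      proof -
        have "gcd (R' 3 - R' 25) (R' 25) = gcd (R' 3) (R' 25)"
          using False gcd_diff1_nat[of "R' 25" "R' 3"] by simp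
        moreover have "R' 3 - R' 25 \<le> n"
          using I unfolding I_def by linarith
        ultimately show ?thesis
          using step[of "R'(3 := R' 3 - R' 25)"] I False ne by (simp add: I_def)
      qed
      then have "wp B gcd_step (\<lambda>R'' M''. I R'' M'' \<and> R'' 3 + R'' 25 < R' 3 + R' 25) (R'(3 := R' 3 - R' 25)) M"
        by (rule wp_mono) (use False ne I in \<open>auto simp: I_def\<close>)
      then show ?thesis using False M' by simp
    qed
    then show "wp B (If 3 25 (Do (Sub 25 25 3)) (Do (Sub 3 3 25)) ;; gcd_step)
       (\<lambda>R'' M''. I R'' M'' \<and> R'' 3 + R'' 25 < R' 3 + R' 25) R' M'"
      by (simp only: wp_Seq)
  next
    fix R' M' assume I: "I R' M'" and "\<not> R' 0 < R' 26"
    then have "R' 3 = R' 25" using assms(1) by (simp add: I_def)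
    then show "?Q R' M'" using I by (simp add: I_def)
  qed
  have "wp B gcd_step (wp B (While (2 * n) 0 26 (If 3 25 (Do (Sub 25 25 3)) (Do (Sub 3 3 25)) ;; gcd_step)) ?Q) R M"
    by (rule wp_mono[OF step[of R]]) (use assms loop in auto)
  then show ?thesis by (simp only: gcd_prog_def wp_Seq)
qed

lemma wp_setup_prog:
  assumes "1 \<le> n" "M 0 = n" "M 1 = g" "g \<le> m" "2 + n * g + 9 * n + 2 \<le> B"
    and gs: "\<And>r. r < g \<Longrightarrow> M (2 + n * r) = (gs ! r) 1 \<and> 1 \<le> (gs ! r) 1 \<and> (gs ! r) 1 \<le> n"
  shows "wp B (setup_prog n m) (\<lambda>R' M'. M' = M \<and> regs n (period n gs g) (2 + n * g) R') (\<lambda>_. 0) M"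
    (is "wp B _ ?Q _ _")
proof -
  define I where "I r R' M' \<longleftrightarrow> R' 20 = r \<and> M' = M \<and> R' 16 = g \<and> R' 0 = 0 \<and> R' 17 = 1 \<and> R' 2 = n \<and>
     R' 3 = period n gs r \<and> R' 4 = 2 + n * r" for r :: nat and R' :: "nat \<Rightarrow> nat" and M'
  let ?body = "Do (Load 24 4) ;; Do (Copy 25 2) ;; Do (Inc 25) ;; Do (Sub 25 25 24) ;;
       gcd_prog n ;; Do (Add 4 4 2) ;; Do (Inc 20)"
  let ?tail = "Do (Add 5 4 2) ;; Do (Add 6 5 2) ;; Do (Add 7 6 2) ;; Do (Add 8 7 2) ;; Do (Copy 12 2) ;; Do (Inc 12) ;;
     Do (Add 9 8 12) ;; Do (Add 10 9 2) ;; Do (Add 11 10 2)"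
  have "wp B (While m 20 16 ?body) (wp B ?tail ?Q) ((\<lambda>_. 0)(17 := 1, 2 := n, 16 := g, 3 := n, 4 := 2)) M"
  proof (rule wp_for[where I = I and i = 0 and u = g])
    show "I 0 ((\<lambda>_. 0)(17 := 1, 2 := n, 16 := g, 3 := n, 4 := 2)) M" by (simp add: I_def)
  next
    fix r R' M' assume I: "I r R' M'"
    then show "R' 20 = r \<and> R' 16 = g" by (simp add: I_def)
    assume r: "r < g"
    let ?R = "R'(24 := (gs ! r) 1, 25 := n + 1 - (gs ! r) 1)"
    have per: "0 < period n gs r" "period n gs r \<le> n"
      using period_dvd_n[of n gs r] assms(1) by (auto intro: Nat.gr0I dvd_imp_le)
    have "wp B (gcd_prog n) (wp B (Do (Add 4 4 2) ;; Do (Inc 20)) (I (Suc r))) ?R M"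
    proof (rule wp_mono[OF wp_gcd_prog])
      show "?R 0 = 0" "0 < ?R 3" "?R 3 \<le> n" "0 < ?R 25" "?R 25 \<le> n" "2 * n \<le> B"
        using I per gs[OF r] assms(5) unfolding I_def
        by (simp, simp, simp, simp add: less_diff_conv, simp add: le_diff_conv, linarith)
    next
      fix R2 M2 assume *: "M2 = M \<and> (\<forall>q. q \<notin> {3, 25, 26, 27} \<longrightarrow> R2 q = ?R q) \<and> R2 3 = gcd (?R 3) (?R 25)"
      have "n * Suc r \<le> n * g" using r by (intro mult_le_mono2) simp
      then have "2 + n * r + n \<le> B" using assms(5) by simp
      then show "wp B (Do (Add 4 4 2) ;; Do (Inc 20)) (I (Suc r)) R2 M2"
        using * I by (simp add: I_def)
    qed
    then show "wp B ?body (I (Suc r)) R' M'"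
      using I gs[OF r] by (simp add: I_def wp_Seq del: wp.simps(2))
  next
    fix R' M' assume "I g R' M'"
    then show "wp B ?tail ?Q R' M'"
      using assms(5) by (simp add: I_def regs_def)
  qed (use assms in simp_all)
  then show ?thesis
    using assms by (simp add: setup_prog_def wp_Seq del: wp.simps(2))
qed

section \<open>The \<open>2 n\<close> emptiness tests\<close>

definition never1 :: "nat \<Rightarrow> nat \<Rightarrow> nat \<Rightarrow> (nat \<Rightarrow> nat) \<Rightarrow> nat \<Rightarrow> bool" where
  "never1 n d aB M j \<longleftrightarrow> \<not> (M (aB + j) = 0 \<and> feasible n d aB (M(aB + n + j := 1)))"

definition never0 :: "nat \<Rightarrow> nat \<Rightarrow> nat \<Rightarrow> (nat \<Rightarrow> nat) \<Rightarrow> nat \<Rightarrow> bool" where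
  "never0 n d aB M j \<longleftrightarrow> \<not> (M (aB + n + j) = 0 \<and> feasible n d aB (M(aB + j := 1)))"

context
  fixes n m d aB B :: nat and M0 :: "nat \<Rightarrow> nat"
  assumes nm: "n = m * d" and d: "0 < d" and m: "0 < m" and B: "aB + 9 * n + 2 \<le> B"
    and bits: "\<And>i. i < n \<Longrightarrow> M0 (aB + n + i) + M0 (aB + i) \<le> 1"
begin

text \<open>Two counters are needed because the result arrays are extended in turn. Between the two
  tests for entry \<open>j\<close>, register 13 is still \<open>j\<close>; there the invariant is
  stated for the registers with 13 set to \<open>Suc j\<close>.\<close>

private definition J :: "nat \<Rightarrow> nat \<Rightarrow> (nat \<Rightarrow> nat) \<Rightarrow> (nat \<Rightarrow> nat) \<Rightarrow> bool" where
  "J j k R M \<longleftrightarrow> regs n d aB R \<and> R 13 = j \<and> (\<forall>a<aB + 2 * n. M a = M0 a) \<and>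
     (\<forall>i<j. M (aB + 6 * n + 1 + i) = of_bool (never1 n d aB M0 i)) \<and>
     (\<forall>i<k. M (aB + 7 * n + 1 + i) = of_bool (never0 n d aB M0 i))"

private lemma regs_upd: "regs n d aB R \<Longrightarrow> r = 14 \<or> r = 15 \<or> r \<ge> 20 \<Longrightarrow> regs n d aB (R(r := v))"
  by (auto simp: regs_def)

private lemma wp_peek:
  assumes J: "regs n d aB R" "R 13 = j" "\<forall>a<aB + 2 * n. M a = M0 a" "j < n"
    and b: "R b = e" "e = aB \<or> e = aB + n" "b = 4 \<or> b = 5" "r = 14 \<or> r = 15" "R r = M0 (e + j)"
    and zero: "e = aB + n \<Longrightarrow> M0 (aB + j) = 0"
    and zero': "e = aB \<Longrightarrow> M0 (aB + n + j) = 0"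
  shows "wp B (peek_prog n m b r) (\<lambda>R' M'. regs n d aB R' \<and> R' 13 = j \<and> R' 14 = R 14 \<and> R' 15 = R 15 \<and>
      (\<forall>a. a < aB + 2 * n \<or> aB + 6 * n + 1 \<le> a \<longrightarrow> M' a = M a) \<and>
      R' 24 = of_bool (\<not> feasible n d aB (M0(e + j := 1)))) R M"
    (is "wp B _ ?Q R M")
proof -
  let ?M = "M(e + j := 1)" and ?R = "R(23 := e + j)"
  have ej: "e + j < aB + 2 * n" "e + j \<le> B" using b(2) J(4) B by auto
  have r: "R 0 = 0" "R 17 = 1" using J(1) by (simp_all add: regs_def)
  have eq: "feasible n d aB ?M \<longleftrightarrow> feasible n d aB (M0(e + j := 1))"
    by (rule feasible_cong) (use J(3) in simp)
  \<comment> \<open>The opposite bit of entry \<open>j\<close> is 0, by the guard in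
    \<open>main_prog\<close>, so the modified instance is still consistent.\<close>
  have bits': "?M (aB + n + i) + ?M (aB + i) \<le> 1" if "i < n" for i
  proof (cases "i = j")
    case True
    then show ?thesis using zero zero' b(2) J(3,4) bits[OF that] by auto
  next
    case False
    have "M (aB + n + i) = M0 (aB + n + i)" "M (aB + i) = M0 (aB + i)" using J(3) that by simp_all
    then show ?thesis using False b(2) J(4) bits[OF that] that by auto
  qed
  have restore: "wp B (st b 13 r ;; Do (Sub 24 17 28)) ?Q R' M'"
    if *: "regs n d aB R' \<and> R' 13 = ?R 13 \<and> R' 14 = ?R 14 \<and> R' 15 = ?R 15 \<and>
     (\<forall>a. a < aB + 2 * n \<or> aB + 6 * n + 1 \<le> a \<longrightarrow> M' a = ?M a) \<and>
     R' 28 = of_bool (feasible n d aB ?M)" for R' M'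
  proof -
    have "R' b = R b" using b(3) * J(1) by (auto simp: regs_def)
    then have addr: "R' b + R' 13 = e + j" using * J(2) b(1) by simp
    have "M0 (e + j) = M (e + j)" using J(3) ej by simp
    then have val: "R' r = M (e + j)" using b(4,5) * by auto
    have one: "R' 17 = 1" using * by (simp add: regs_def)
    have "r \<noteq> 23" using b(4) by auto
    have upd: "(R'(23 := e + j)) 17 = 1" "(R'(23 := e + j)) 28 = R' 28" using one by simp_all
    have iff: "wp B (st b 13 r ;; Do (Sub 24 17 28)) ?Q R' M' \<longleftrightarrow>
        e + j \<le> B \<and> ?Q (R'(23 := e + j, 24 := 1 - R' 28)) (M'(e + j := M (e + j)))"
      unfolding wp_Seq[of B "_ ;; _"] wp_st[OF \<open>r \<noteq> 23\<close>] addr val wp.simps(1) wp_instr.simps upd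
      by (rule refl)
    have parts: "R' 13 = j" "R' 14 = R 14" "R' 15 = R 15" "R' 28 = of_bool (feasible n d aB ?M)"
      using * J(2) by simp_all
    have Q: "?Q (R'(23 := e + j, 24 := 1 - R' 28)) (M'(e + j := M (e + j)))"
    proof (intro conjI)
      show "regs n d aB (R'(23 := e + j, 24 := 1 - R' 28))"
        using * by (simp add: regs_upd)
      show "\<forall>a. a < aB + 2 * n \<or> aB + 6 * n + 1 \<le> a \<longrightarrow> (M'(e + j := M (e + j))) a = M a"
        using * by simp
    qed (simp_all add: parts(1-3), simp only: parts(4) eq fun_upd_same, simp)
    show ?thesis by (rule iffD2[OF iff conjI[OF ej(2) Q]])
  qed
  have "wp B (oracle_prog n m) (wp B (st b 13 r ;; Do (Sub 24 17 28)) ?Q) ?R ?M"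
    using wp_oracle[OF nm d m B bits' regs_upd[OF J(1)]] by (rule wp_mono) (assumption, simp, erule restore)
  moreover have "wp B (st b 13 17 ;; c) P R M" if "wp B c P ?R ?M" for c P
    using that b(1) J(2) r ej by simp
  ultimately show ?thesis
    unfolding peek_prog_def by (simp only: wp_Seq)
qed

lemma wp_main_prog:
  assumes "regs n d aB R" "\<forall>a<aB + 2 * n. M a = M0 a"
  shows "wp B (main_prog n m) (\<lambda>R M. regs n d aB R \<and>
     (\<forall>i<n. M (aB + 6 * n + 1 + i) = of_bool (never1 n d aB M0 i)) \<and>
     (\<forall>i<n. M (aB + 7 * n + 1 + i) = of_bool (never0 n d aB M0 i))) R M"
    (is "wp B _ ?Q R M")
proof -
  let ?c1 = "If 14 17 (peek_prog n m 5 15) (Do (Copy 24 17)) ;; st 10 13 24"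
  let ?c2 = "If 15 17 (peek_prog n m 4 14) (Do (Copy 24 17)) ;; st 11 13 24 ;; Do (Inc 13)"
  have store: "wp B (st 10 13 24) (\<lambda>R M. J (Suc j) j (R(13 := Suc j)) M \<and> R 13 = j \<and>
        R 14 = M0 (aB + j) \<and> R 15 = M0 (aB + n + j)) R M"
    if "J j j R M" "j < n" "R 24 = of_bool (never1 n d aB M0 j)" "R 14 = M0 (aB + j)" "R 15 = M0 (aB + n + j)"
    for R M j
    using that B by (auto simp: J_def regs_def less_Suc_eq)
  have first: "wp B ?c1 (\<lambda>R M. J (Suc j) j (R(13 := Suc j)) M \<and> R 13 = j \<and>
        R 14 = M0 (aB + j) \<and> R 15 = M0 (aB + n + j)) R M"
    if J: "J j j R M" "j < n" "R 14 = M0 (aB + j)" "R 15 = M0 (aB + n + j)" for j R M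
  proof (cases "M0 (aB + j) = 0")
    case True
    have J': "regs n d aB R" "R 13 = j" "\<forall>a<aB + 2 * n. M a = M0 a" "R 5 = aB + n" "R 17 = 1"
      using J(1) by (simp_all add: J_def regs_def)
    have "wp B (peek_prog n m 5 15) (wp B (st 10 13 24) (\<lambda>R M. J (Suc j) j (R(13 := Suc j)) M \<and> R 13 = j \<and>
        R 14 = M0 (aB + j) \<and> R 15 = M0 (aB + n + j))) R M"
    proof (rule wp_mono[OF wp_peek[OF J'(1-3) J(2) J'(4)]])
      fix R' M' assume *: "regs n d aB R' \<and> R' 13 = j \<and> R' 14 = R 14 \<and> R' 15 = R 15 \<and>
        (\<forall>a. a < aB + 2 * n \<or> aB + 6 * n + 1 \<le> a \<longrightarrow> M' a = M a) \<and>
        R' 24 = of_bool (\<not> feasible n d aB (M0(aB + n + j := 1)))"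
      have "J j j R' M'" using * J(1) by (simp add: J_def)
      moreover have "R' 24 = of_bool (never1 n d aB M0 j)" using * True by (simp add: never1_def)
      ultimately show "wp B (st 10 13 24) (\<lambda>R M. J (Suc j) j (R(13 := Suc j)) M \<and> R 13 = j \<and>
        R 14 = M0 (aB + j) \<and> R 15 = M0 (aB + n + j)) R' M'"
        using * J by (intro store) auto
    qed (use J True in auto)
    then show ?thesis using True J'(5) J(3) by (simp add: wp_Seq del: wp.simps(2))
  next
    case False
    then have "wp B (st 10 13 24) (\<lambda>R M. J (Suc j) j (R(13 := Suc j)) M \<and> R 13 = j \<and>
        R 14 = M0 (aB + j) \<and> R 15 = M0 (aB + n + j)) (R(24 := 1)) M"
      using J by (intro store) (auto simp: J_def regs_upd never1_def)
    moreover have "R 17 = 1" "R 13 = j" using J(1) by (simp_all add: J_def regs_def)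
    ultimately show ?thesis using False J(3) by (simp add: wp_Seq del: wp.simps(2))
  qed
  have store': "wp B (st 11 13 24 ;; Do (Inc 13)) (\<lambda>R M. J (Suc j) (Suc j) R M) R M"
    if "J (Suc j) j (R(13 := Suc j)) M" "R 13 = j" "j < n" "R 24 = of_bool (never0 n d aB M0 j)" for R M j
    using that B by (auto simp: J_def regs_def less_Suc_eq)
  have second: "wp B ?c2 (\<lambda>R M. J (Suc j) (Suc j) R M) R M"
    if J: "J (Suc j) j (R(13 := Suc j)) M" "R 13 = j" "j < n"
      "R 14 = M0 (aB + j)" "R 15 = M0 (aB + n + j)" for j R M
  proof (cases "M0 (aB + n + j) = 0")
    case True
    have J': "regs n d aB R" "\<forall>a<aB + 2 * n. M a = M0 a" "R 4 = aB" "R 17 = 1"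
      using J(1) by (simp_all add: J_def regs_def)
    have "wp B (peek_prog n m 4 14) (wp B (st 11 13 24 ;; Do (Inc 13)) (\<lambda>R M. J (Suc j) (Suc j) R M)) R M"
    proof (rule wp_mono[OF wp_peek[OF J'(1) J(2) J'(2) J(3) J'(3)]])
      fix R' M' assume *: "regs n d aB R' \<and> R' 13 = j \<and> R' 14 = R 14 \<and> R' 15 = R 15 \<and>
        (\<forall>a. a < aB + 2 * n \<or> aB + 6 * n + 1 \<le> a \<longrightarrow> M' a = M a) \<and>
        R' 24 = of_bool (\<not> feasible n d aB (M0(aB + j := 1)))"
      have "J (Suc j) j (R'(13 := Suc j)) M'" using * J(1) by (simp add: J_def regs_def)
      moreover have "R' 24 = of_bool (never0 n d aB M0 j)" using * True by (simp add: never0_def)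
      ultimately show "wp B (st 11 13 24 ;; Do (Inc 13)) (\<lambda>R M. J (Suc j) (Suc j) R M) R' M'"
        using * J by (intro store') auto
    qed (use J True in auto)
    then show ?thesis using True J'(4) J(5) by (simp add: wp_Seq del: wp.simps(2))
  next
    case False
    then have "wp B (st 11 13 24 ;; Do (Inc 13)) (\<lambda>R M. J (Suc j) (Suc j) R M) (R(24 := 1)) M"
      using J by (intro store') (auto simp: J_def regs_def never0_def)
    moreover have "R 17 = 1" using J(1) by (simp add: J_def regs_def)
    ultimately show ?thesis using False J(5) by (simp add: wp_Seq del: wp.simps(2))
  qed
  have "wp B (While n 13 2 (ld 14 4 13 ;; ld 15 5 13 ;;
      If 14 17 (peek_prog n m 5 15) (Do (Copy 24 17)) ;; st 10 13 24 ;; ?c2)) ?Q (R(13 := 0)) M"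
  proof (rule wp_for[where I = "\<lambda>j. J j j" and i = 0 and u = n])
    show "J 0 0 (R(13 := 0)) M" using assms by (simp add: J_def regs_def)
  next
    fix j R M assume J: "J j j R M"
    then show "R 13 = j \<and> R 2 = n" by (simp add: J_def regs_def)
    assume j: "j < n"
    have "wp B (?c1 ;; ?c2) (J (Suc j) (Suc j)) (R(14 := M0 (aB + j), 23 := aB + n + j, 15 := M0 (aB + n + j))) M"
    proof -
      have "J j j (R(14 := M0 (aB + j), 23 := aB + n + j, 15 := M0 (aB + n + j))) M"
        using J by (simp add: J_def regs_upd)
      from first[OF this j] have "wp B ?c1 (wp B ?c2 (J (Suc j) (Suc j)))
          (R(14 := M0 (aB + j), 23 := aB + n + j, 15 := M0 (aB + n + j))) M"
      proof (rule wp_mono)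
        fix R' M' assume "J (Suc j) j (R'(13 := Suc j)) M' \<and> R' 13 = j \<and>
          R' 14 = M0 (aB + j) \<and> R' 15 = M0 (aB + n + j)"
        then show "wp B ?c2 (J (Suc j) (Suc j)) R' M'" using second[OF _ _ j] by blast
      qed simp_all
      then show ?thesis by (simp only: wp_Seq)
    qed
    moreover have "wp B (ld 14 4 13 ;; ld 15 5 13 ;; c) P R M"
      if "wp B c P (R(14 := M0 (aB + j), 23 := aB + n + j, 15 := M0 (aB + n + j))) M" for c P
      using that J j B by (simp add: J_def regs_def fun_upd_twist)
    ultimately show "wp B (ld 14 4 13 ;; ld 15 5 13 ;;
      If 14 17 (peek_prog n m 5 15) (Do (Copy 24 17)) ;; st 10 13 24 ;; ?c2) (J (Suc j) (Suc j)) R M"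
      by (simp only: wp_Seq)
  next
    fix R M assume "J n n R M"
    then show "?Q R M" by (simp add: J_def)
  qed simp_all
  moreover have "R 0 = 0" using assms(1) by (simp add: regs_def)
  ultimately show ?thesis by (simp add: main_prog_def)
qed

end

section \<open>Writing the output\<close>

lemma wp_finish_prog:
  assumes "regs n d aB R" "0 < n" "aB + 9 * n + 2 \<le> B" "2 \<le> aB"
    and F: "\<forall>i<n. M (aB + 6 * n + 1 + i) = of_bool (f i)" "\<forall>i<n. M (aB + 7 * n + 1 + i) = of_bool (g i)"
  shows "wp B (finish_prog n) (\<lambda>R' M'. if f 0 \<and> g 0 then M' 0 = 0
    else M' 0 = 1 \<and> (\<forall>i<n. M' (1 + i) = of_bool (f i) \<and> M' (n + 1 + i) = of_bool (g i))) R M"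
    (is "wp B _ ?Q R M")
proof -
  have r: "R 0 = 0" "R 17 = 1" "R 2 = n" "R 10 = aB + 6 * n + 1" "R 11 = aB + 7 * n + 1"
    using assms(1) by (simp_all add: regs_def)
  have F0: "M (aB + 6 * n + 1) = of_bool (f 0)" "M (aB + 7 * n + 1) = of_bool (g 0)"
    using F assms(2) by (metis add_0_right)+
  \<comment> \<open>The output occupies the addresses 0 to \<open>2 * n\<close> and the results
    start at \<open>aB + 6 * n + 1\<close>. Copying therefore overwrites nothing that is still to be
    read.\<close>
  define I where "I i R' M' \<longleftrightarrow> R' 20 = i \<and> R' 2 = n \<and> R' 10 = aB + 6 * n + 1 \<and> R' 11 = aB + 7 * n + 1 \<and>
     M' 0 = 1 \<and> (\<forall>a\<ge>2 * n + 1. M' a = M a) \<and>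
     (\<forall>j<i. M' (1 + j) = of_bool (f j) \<and> M' (n + 1 + j) = of_bool (g j))" for i :: nat and R' M' :: "nat \<Rightarrow> nat"
  let ?c = "ld 24 10 20 ;; Do (Copy 25 20) ;; Do (Inc 25) ;; Do (Store 25 24) ;;
          ld 24 11 20 ;; Do (Add 25 25 2) ;; Do (Store 25 24) ;; Do (Inc 20)"
  have loop: "wp B (While n 20 2 ?c) ?Q (R'(20 := 0)) (M(0 := 1))"
    if not: "\<not> (f 0 \<and> g 0)" and R': "R' 2 = n" "R' 10 = aB + 6 * n + 1" "R' 11 = aB + 7 * n + 1" for R'
  proof (rule wp_for[where I = I and i = 0 and u = n])
    show "I 0 (R'(20 := 0)) (M(0 := 1))" using R' by (simp add: I_def)
  next
    fix i R2 M2 assume I: "I i R2 M2"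
    then show "R2 20 = i \<and> R2 2 = n" by (simp add: I_def)
    assume i: "i < n"
    have "M2 (aB + 6 * n + 1 + i) = of_bool (f i)" "M2 (aB + 7 * n + 1 + i) = of_bool (g i)"
      using I F i by (simp_all add: I_def)
    moreover have "aB + 6 * n + 1 + i \<le> B" "aB + 7 * n + 1 + i \<le> B" "i + 1 + n \<le> B"
      using assms(3) i by simp_all
    moreover have "R2 20 = i" "R2 2 = n" "R2 10 = aB + 6 * n + 1" "R2 11 = aB + 7 * n + 1" "M2 0 = 1"
      "\<forall>a\<ge>2 * n + 1. M2 a = M a" "\<forall>j<i. M2 (1 + j) = of_bool (f j) \<and> M2 (n + 1 + j) = of_bool (g j)"
      using I by (simp_all add: I_def)
    ultimately show "wp B ?c (I (Suc i)) R2 M2"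
      using i by (simp add: I_def less_Suc_eq)
  next
    fix R2 M2 assume "I n R2 M2"
    then show "?Q R2 M2" using not by (simp add: I_def)
  qed simp_all
  have loop': "wp B (While n 20 2 ?c) ?Q (R(24 := x, 25 := y, 26 := 1, 20 := 0)) (M(0 := 1))"
    if "\<not> (f 0 \<and> g 0)" for x y
    using loop[OF that, of "R(24 := x, 25 := y, 26 := 1)"] r by simp
  have start: "wp B (Do (Load 24 10) ;; Do (Load 25 11) ;;
     If 24 17 (Do (Copy 26 17)) (If 25 17 (Do (Copy 26 17)) (Do (Copy 26 0))) ;; T) P R M"
    if "wp B T P (R(24 := of_bool (f 0), 25 := of_bool (g 0), 26 := of_bool (\<not> (f 0 \<and> g 0)))) M" for T P
    using that r F0 by (cases "f 0"; cases "g 0") simp_all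
  show ?thesis
    unfolding finish_prog_def
  proof (rule start)
    show "wp B (If 0 26 (Do (Store 0 17) ;; Do (Copy 20 0) ;; While n 20 2 ?c) (Do (Store 0 0))) ?Q
       (R(24 := of_bool (f 0), 25 := of_bool (g 0), 26 := of_bool (\<not> (f 0 \<and> g 0)))) M"
    proof (cases "f 0 \<and> g 0")
      case True
      then show ?thesis using r by simp
    next
      case False
      then have "(of_bool (\<not> (f 0 \<and> g 0)) :: nat) = 1" by simp
      then show ?thesis
        using r loop'[OF False, of "of_bool (f 0)" "of_bool (g 0)"]
        by (simp only: wp.simps(1-3) wp_instr.simps) simp
    qed
  qed
qed

section \<open>Running time and encoding\<close>

lemma strip_fixing_prog: "strip (fixing_prog n m) = strip (fixing_prog 0 0)"
  by (simp add: fixing_prog_def setup_prog_def main_prog_def finish_prog_def gcd_prog_def gcd_step_def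
    peek_prog_def oracle_prog_def greedy_prog_def cand_prog_def shift_body_def final_prog_def act_init_def
    greedy_max_def greedy_drop_def scan_prog_def fill_prog_def build_prog_def compare_prog_def)

text \<open>Two nests of loops reach the order \<open>n * m\<close>: the \<open>m\<close> rotations
  within the \<open>n\<close> positions of the greedy word, and the linear work on the candidates
  for each of the \<open>m\<close> rotations.\<close>

lemma cost_oracle_prog:
  assumes "1 \<le> n" "1 \<le> m"
  shows "cost (oracle_prog n m) \<le> 300 * (n * m)"
proof -
  have "cost (oracle_prog n m) \<le> 100 * (n * m) + 40 * m + 40 * n + 40"
    by (simp add: oracle_prog_def greedy_prog_def cand_prog_def shift_body_def final_prog_def act_init_def
      greedy_max_def greedy_drop_def scan_prog_def fill_prog_def build_prog_def compare_prog_def algebra_simps)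
  moreover have "n \<le> n * m" "m \<le> n * m" "1 \<le> n * m" using assms by simp_all
  ultimately show ?thesis by linarith
qed

text \<open>Two tests per entry contribute \<open>600 * (n ^ 2 * m)\<close>, and everything else
  adds up to at most \<open>196 * (n ^ 2 * m)\<close>.\<close>

lemma cost_fixing_prog:
  assumes "1 \<le> n" "1 \<le> m"
  shows "cost (fixing_prog n m) \<le> 1000 * (n ^ 2 * m)"
proof -
  let ?o = "cost (oracle_prog n m)"
  have nn: "n \<le> n ^ 2" using assms(1) by (simp add: power2_eq_square)
  have le: "n * m \<le> n ^ 2 * m" "n \<le> n * m" "m \<le> n * m" "1 \<le> n * m"
    using nn assms by simp_all
  have "n * ?o \<le> n * (300 * (n * m))"
    by (intro mult_le_mono2 cost_oracle_prog assms)
  then have o: "n * ?o \<le> 300 * (n ^ 2 * m)" by (simp add: power2_eq_square algebra_simps)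
  have "cost (setup_prog n m) \<le> 16 * (n * m) + 20 * m + 20"
    by (simp add: setup_prog_def gcd_prog_def gcd_step_def algebra_simps)
  moreover have "cost (main_prog n m) \<le> n * (2 * ?o + 40) + 40"
    by (simp add: main_prog_def peek_prog_def algebra_simps)
  moreover have "cost (finish_prog n) \<le> 30 * n + 30"
    by (simp add: finish_prog_def algebra_simps)
  ultimately show ?thesis
    using o le unfolding fixing_prog_def cost.simps distrib_left by linarith
qed

section \<open>Layout of the encoded instance\<close>

lemma nth_concat_tables:
  assumes "r < length gs" "i < n"
  shows "concat (map (\<lambda>g. map g [1..<Suc n]) gs) ! (n * r + i) = (gs ! r) (Suc i)"
  using assms(1)
proof (induction gs arbitrary: r)
  case (Cons g gs)
  show ?case
  proof (cases r)
    case 0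
    then show ?thesis using assms(2) by (simp add: nth_append)
  next
    case (Suc r')
    then show ?thesis using Cons.IH[of r'] Cons.prems by (simp add: nth_append add.assoc)
  qed
qed simp

lemma length_concat_tables: "length (concat (map (\<lambda>g. map g [1..<Suc n]) gs)) = n * length gs"
  by (induction gs) simp_all

lemma length_char_list [simp]: "length (char_list n I) = n"
  by (simp add: char_list_def)

lemma nth_char_list [simp]: "i < n \<Longrightarrow> char_list n I ! i = of_bool (Suc i \<in> I)"
  by (simp add: char_list_def)

lemma length_encode_instance: "length (encode_instance n gs I0 I1) = 2 + n * length gs + 2 * n"
  unfolding encode_instance_def length_append length_concat_tables length_char_list by simp

lemma nth_encode_instance:
  "encode_instance n gs I0 I1 ! 0 = n"
  "encode_instance n gs I0 I1 ! 1 = length gs"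
  "r < length gs \<Longrightarrow> i < n \<Longrightarrow> encode_instance n gs I0 I1 ! (2 + n * r + i) = (gs ! r) (Suc i)"
  "i < n \<Longrightarrow> encode_instance n gs I0 I1 ! (2 + n * length gs + i) = of_bool (Suc i \<in> I0)"
  "i < n \<Longrightarrow> encode_instance n gs I0 I1 ! (2 + n * length gs + n + i) = of_bool (Suc i \<in> I1)"
proof -
  let ?t = "concat (map (\<lambda>g. map g [1..<Suc n]) gs)"
  have split: "encode_instance n gs I0 I1 ! (2 + k) = (?t @ char_list n I0 @ char_list n I1) ! k" for k
    by (simp add: encode_instance_def)
  show "encode_instance n gs I0 I1 ! 0 = n" "encode_instance n gs I0 I1 ! 1 = length gs"
    by (simp_all add: encode_instance_def)
  show "encode_instance n gs I0 I1 ! (2 + n * r + i) = (gs ! r) (Suc i)" if "r < length gs" "i < n"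
  proof -
    have "n * r + i < n * Suc r" using that(2) by simp
    also have "\<dots> \<le> n * length gs" using that(1) by (intro mult_le_mono2) simp
    finally have "n * r + i < length ?t" by (simp only: length_concat_tables)
    then have "(?t @ char_list n I0 @ char_list n I1) ! (n * r + i) = ?t ! (n * r + i)"
      by (simp only: nth_append if_True)
    then show ?thesis using split[of "n * r + i"] nth_concat_tables[OF that] by (simp only: add.assoc)
  qed
  show "encode_instance n gs I0 I1 ! (2 + n * length gs + i) = of_bool (Suc i \<in> I0)" if "i < n"
  proof -
    have "(?t @ char_list n I0 @ char_list n I1) ! (length ?t + i) = of_bool (Suc i \<in> I0)"
      using that by (simp only: nth_append_length_plus) (simp add: nth_append)
    then show ?thesis
      using split[of "n * length gs + i"] by (simp only: length_concat_tables add.assoc)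
  qed
  show "encode_instance n gs I0 I1 ! (2 + n * length gs + n + i) = of_bool (Suc i \<in> I1)" if "i < n"
  proof -
    have "(char_list n I0 @ char_list n I1) ! (n + i) = of_bool (Suc i \<in> I1)"
      using that nth_append_length_plus[of "char_list n I0" "char_list n I1" i] by simp
    then have "(?t @ char_list n I0 @ char_list n I1) ! (length ?t + (n + i)) = of_bool (Suc i \<in> I1)"
      by (simp only: nth_append_length_plus)
    then show ?thesis
      using split[of "n * length gs + (n + i)"] by (simp only: length_concat_tables add.assoc)
  qed
qed

lemma set_encode_instance:
  assumes "v \<in> set (encode_instance n gs I0 I1)"
  shows "v = n \<or> v = length gs \<or> v \<le> 1 \<or> (\<exists>g\<in>set gs. \<exists>i\<in>{1..n}. v = g i)"
  using assms by (auto simp: encode_instance_def char_list_def atLeastLessThanSuc_atLeastAtMost)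

section \<open>From words back to vectors of the cube\<close>

lemma lexge_cong:
  assumes "\<And>i. i < n \<Longrightarrow> x i = x' i" "\<And>i. i < n \<Longrightarrow> y i = y' i"
  shows "lexge n x y \<longleftrightarrow> lexge n x' y'"
proof -
  have "(\<forall>j<i. x j = y j) \<longleftrightarrow> (\<forall>j<i. x' j = y' j)" if "i < n" for i
    using assms that by simp
  then show ?thesis unfolding lexge_def using assms by auto
qed

text \<open>The index sets are arbitrary because a test enlarges \<open>I0\<close> or
  \<open>I1\<close> by the entry under consideration.\<close>

lemma feasible_iff:
  assumes n: "1 \<le> n" and subgroup: "subgroup \<Gamma> (sym_group n)"
    and cyclic: "\<Gamma> \<subseteq> generate (sym_group n) {full_cycle n}"
    and gen: "generate (sym_group n) (set gs) = \<Gamma>"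
    and A: "A0 \<subseteq> {1..n}" "A1 \<subseteq> {1..n}"
    and M: "\<And>i. i < n \<Longrightarrow> M (aB + i) = of_bool (Suc i \<in> A0)"
      "\<And>i. i < n \<Longrightarrow> M (aB + n + i) = of_bool (Suc i \<in> A1)"
  shows "feasible n (period n gs (length gs)) aB M \<longleftrightarrow> X_group n \<Gamma> \<inter> face n A0 A1 \<noteq> {}"
proof
  let ?d = "period n gs (length gs)"
  note X_iff = X_group_iff[OF n subgroup cyclic gen]
  assume "X_group n \<Gamma> \<inter> face n A0 A1 \<noteq> {}"
  then obtain x where x: "x \<in> X_group n \<Gamma>" "x \<in> face n A0 A1" by blast
  then have cube: "x \<in> binary_cube n" by (simp add: face_def)
  have "M (aB + n + i) \<le> x (Suc i) \<and> x (Suc i) \<le> 1 - M (aB + i)" if "i < n" for i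
  proof -
    have "x (Suc i) \<in> {0, 1}"
      using PiE_mem[of x "{1..n}" "\<lambda>_. {0, 1}" "Suc i"] cube that by (simp add: binary_cube_def)
    then show ?thesis using x(2) M[OF that] by (auto simp: face_def)
  qed
  then have "(\<lambda>i. x (Suc i)) \<in> lexmax_box n ?d (\<lambda>i. M (aB + n + i)) (\<lambda>i. 1 - M (aB + i))"
    using iffD1[OF X_iff[OF cube] x(1)] unfolding lexmax_box_def by simp
  then show "feasible n ?d aB M" unfolding feasible_def by blast
next
  let ?d = "period n gs (length gs)"
  note X_iff = X_group_iff[OF n subgroup cyclic gen]
  assume "feasible n ?d aB M"
  then obtain x where "x \<in> lexmax_box n ?d (\<lambda>i. M (aB + n + i)) (\<lambda>i. 1 - M (aB + i))"
    unfolding feasible_def by blast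
  then have x: "\<And>i. i < n \<Longrightarrow> M (aB + n + i) \<le> x i \<and> x i \<le> 1 - M (aB + i)"
      "\<And>p. p \<in> shifts n ?d \<Longrightarrow> lexge n x (rot n p x)"
    unfolding lexmax_box_def by simp_all
  \<comment> \<open>Words are indexed from 0 and arbitrary from \<open>n\<close> on, whereas vectors
    of the cube are indexed from 1 and extensional.\<close>
  define z where "z = (\<lambda>i\<in>{1..n}. x (i - 1))"
  have z: "z (Suc i) = x i" if "i < n" for i using that by (simp add: z_def)
  have cube: "z \<in> binary_cube n"
    unfolding binary_cube_def
  proof (rule PiE_I)
    fix i assume "i \<in> {1..n}"
    then have "i - 1 < n" by auto
    from x(1)[OF this] have "x (i - 1) \<le> 1" by linarith
    with \<open>i \<in> {1..n}\<close> show "z i \<in> {0, 1}" by (auto simp: z_def)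
  qed (auto simp: z_def)
  have "lexge n (\<lambda>i. z (Suc i)) (rot n p (\<lambda>i. z (Suc i)))" if p: "p \<in> shifts n ?d" for p
  proof -
    have rot: "rot n p (\<lambda>i. z (Suc i)) i = rot n p x i" if "i < n" for i
    proof -
      have "p + i - n < n" using p that by (auto simp: shifts_def)
      then show ?thesis using z by (simp add: rot_def)
    qed
    have "lexge n (\<lambda>i. z (Suc i)) (rot n p (\<lambda>i. z (Suc i))) \<longleftrightarrow> lexge n x (rot n p x)"
      by (rule lexge_cong) (simp_all only: z rot)
    then show ?thesis using x(2)[OF p] by (rule iffD2)
  qed
  then have "z \<in> X_group n \<Gamma>" by (intro iffD2[OF X_iff[OF cube]] ballI)
  moreover have "z \<in> face n A0 A1"
  proof -
    have "z i = 0" if "i \<in> A0" for i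
    proof -
      have "i \<in> {1..n}" using A that by blast
      then have "M (aB + (i - 1)) = 1" "i - 1 < n" using M(1)[of "i - 1"] that by auto
      then have "x (i - 1) \<le> 0" using x(1)[of "i - 1"] by linarith
      then show ?thesis using \<open>i \<in> {1..n}\<close> by (simp add: z_def)
    qed
    moreover have "z i = 1" if "i \<in> A1" for i
    proof -
      have "i \<in> {1..n}" using A that by blast
      then have "M (aB + n + (i - 1)) = 1" "i - 1 < n" using M(2)[of "i - 1"] that by auto
      then have "1 \<le> x (i - 1)" "x (i - 1) \<le> 1"
        using x(1)[of "i - 1"] by linarith+
      then show ?thesis using \<open>i \<in> {1..n}\<close> by (simp add: z_def)
    qed
    ultimately show ?thesis using cube by (simp add: face_def)
  qed
  ultimately show "X_group n \<Gamma> \<inter> face n A0 A1 \<noteq> {}" by blast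
qed

lemma mem_face_insert:
  "X \<inter> face n I0 (insert i I1) \<noteq> {} \<longleftrightarrow> (\<exists>x\<in>X \<inter> face n I0 I1. x i = 1)"
  "X \<inter> face n (insert i I0) I1 \<noteq> {} \<longleftrightarrow> (\<exists>x\<in>X \<inter> face n I0 I1. x i = 0)"
  unfolding face_def by blast+

lemma never_iff:
  assumes n: "1 \<le> n" and subgroup: "subgroup \<Gamma> (sym_group n)"
    and cyclic: "\<Gamma> \<subseteq> generate (sym_group n) {full_cycle n}"
    and gen: "generate (sym_group n) (set gs) = \<Gamma>"
    and I: "I0 \<subseteq> {1..n}" "I1 \<subseteq> {1..n}"
    and M: "\<And>i. i < n \<Longrightarrow> M (aB + i) = of_bool (Suc i \<in> I0)"
      "\<And>i. i < n \<Longrightarrow> M (aB + n + i) = of_bool (Suc i \<in> I1)"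
    and j: "j < n"
  defines "S \<equiv> X_group n \<Gamma> \<inter> face n I0 I1"
  shows "never1 n (period n gs (length gs)) aB M j \<longleftrightarrow> (\<forall>x\<in>S. x (Suc j) = 0)"
    and "never0 n (period n gs (length gs)) aB M j \<longleftrightarrow> (\<forall>x\<in>S. x (Suc j) = 1)"
proof -
  note iff = feasible_iff[OF n subgroup cyclic gen]
  have bit: "x (Suc j) = 0 \<or> x (Suc j) = 1" if "x \<in> S" for x
  proof -
    have "x \<in> {1..n} \<rightarrow>\<^sub>E {0, 1}" using that by (simp add: S_def face_def binary_cube_def)
    then have "x (Suc j) \<in> {0, 1}" by (rule PiE_mem) (use j in simp)
    then show ?thesis by simp
  qed
  have 1: "feasible n (period n gs (length gs)) aB (M(aB + n + j := 1)) \<longleftrightarrow> (\<exists>x\<in>S. x (Suc j) = 1)"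
    unfolding S_def mem_face_insert(1)[symmetric]
  proof (rule iff)
    fix i assume i: "i < n"
    show "(M(aB + n + j := 1)) (aB + i) = of_bool (Suc i \<in> I0)"
      using M(1)[OF i] i by simp
    show "(M(aB + n + j := 1)) (aB + n + i) = of_bool (Suc i \<in> insert (Suc j) I1)"
      using M(2)[OF i] by (cases "i = j") simp_all
  qed (use I j in simp_all)
  have 0: "feasible n (period n gs (length gs)) aB (M(aB + j := 1)) \<longleftrightarrow> (\<exists>x\<in>S. x (Suc j) = 0)"
    unfolding S_def mem_face_insert(2)[symmetric]
  proof (rule iff)
    fix i assume i: "i < n"
    show "(M(aB + j := 1)) (aB + i) = of_bool (Suc i \<in> insert (Suc j) I0)"
      using M(1)[OF i] by (cases "i = j") simp_all
    show "(M(aB + j := 1)) (aB + n + i) = of_bool (Suc i \<in> I1)"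
      using M(2)[OF i] j by simp
  qed (use I j in simp_all)
  have bits: "(\<forall>x\<in>S. x (Suc j) = 0) \<longleftrightarrow> \<not> (\<exists>x\<in>S. x (Suc j) = 1)"
    "(\<forall>x\<in>S. x (Suc j) = 1) \<longleftrightarrow> \<not> (\<exists>x\<in>S. x (Suc j) = 0)"
    using bit by (metis zero_neq_one)+
  \<comment> \<open>Here the entry is fixed to 0 and the program skips the test; its default answer
    is correct.\<close>
  have "\<not> (\<exists>x\<in>S. x (Suc j) = 1)" if "M (aB + j) \<noteq> 0"
    using that M(1)[OF j] by (auto simp: S_def face_def)
  then show "never1 n (period n gs (length gs)) aB M j \<longleftrightarrow> (\<forall>x\<in>S. x (Suc j) = 0)"
    unfolding never1_def 1 bits by blast
  have "\<not> (\<exists>x\<in>S. x (Suc j) = 0)" if "M (aB + n + j) \<noteq> 0"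
    using that M(2)[OF j] by (auto simp: S_def face_def)
  then show "never0 n (period n gs (length gs)) aB M j \<longleftrightarrow> (\<forall>x\<in>S. x (Suc j) = 1)"
    unfolding never0_def 0 bits by blast
qed

lemma outputs_encode_result:
  assumes n: "1 \<le> n" and S: "S \<subseteq> binary_cube n"
    and f: "\<And>i. i < n \<Longrightarrow> f i \<longleftrightarrow> (\<forall>x\<in>S. x (Suc i) = 0)"
    and g: "\<And>i. i < n \<Longrightarrow> g i \<longleftrightarrow> (\<forall>x\<in>S. x (Suc i) = 1)"
    and M: "if f 0 \<and> g 0 then mem cfg 0 = 0
      else mem cfg 0 = 1 \<and> (\<forall>i<n. mem cfg (1 + i) = of_bool (f i) \<and> mem cfg (n + 1 + i) = of_bool (g i))"
  shows "outputs cfg (encode_result n S)"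
proof (cases "S = {}")
  case True
  then have "f 0 \<and> g 0" using f[of 0] g[of 0] n by simp
  then show ?thesis using M True by (simp add: outputs_def encode_result_def)
next
  case False
  then obtain x where "x \<in> S" by blast
  then have "\<not> (f 0 \<and> g 0)" using f[of 0] g[of 0] n by force
  then have M': "mem cfg 0 = 1" "\<And>i. i < n \<Longrightarrow> mem cfg (1 + i) = of_bool (f i)"
    "\<And>i. i < n \<Longrightarrow> mem cfg (n + 1 + i) = of_bool (g i)"
    using M by (simp_all split: if_splits)
  let ?l = "char_list n (fixings n 0 S) @ char_list n (fixings n 1 S)"
  have "mem cfg (Suc b) = ?l ! b" if "b < 2 * n" for b
  proof (cases "b < n")
    case True
    then show ?thesis using M'(2)[of b] f[of b] by (simp add: nth_append fixings_def)
  next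
    case F: False
    then have "b - n < n" "n + 1 + (b - n) = Suc b" using that by auto
    then show ?thesis using F M'(3)[of "b - n"] g[of "b - n"] by (simp add: nth_append fixings_def)
  qed
  then have "mem cfg a = (1 # ?l) ! a" if "a < Suc (2 * n)" for a
    using that M'(1) by (cases a) auto
  then show ?thesis using False by (simp add: outputs_def encode_result_def)
qed

section \<open>One program and one constant for all instances\<close>

theorem mainTheorem5:
  shows "\<exists>(P :: instr list) (C :: nat).
    \<forall>(n :: nat) (\<Gamma> :: (nat \<Rightarrow> nat) set) (gs :: (nat \<Rightarrow> nat) list) (I0 :: nat set) (I1 :: nat set).
      1 \<le> n \<longrightarrow>
      subgroup \<Gamma> (sym_group n) \<longrightarrow>
      \<Gamma> \<subseteq> generate (sym_group n) {full_cycle n} \<longrightarrow>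
      distinct gs \<longrightarrow>
      generate (sym_group n) (set gs) = \<Gamma> \<longrightarrow>
      I0 \<subseteq> {1..n} \<longrightarrow> I1 \<subseteq> {1..n} \<longrightarrow> I0 \<inter> I1 = {} \<longrightarrow>
      (let c0 = init_config (encode_instance n gs I0 I1)
       in \<exists>t \<le> C * (n ^ 2 * card \<Gamma>).
            halted P (run P t c0) \<and>
            (\<forall>s \<le> t. words_le (C * n ^ C) (run P s c0)) \<and>
            outputs (run P t c0) (encode_result n (X_group n \<Gamma> \<inter> face n I0 I1)))"
proof -
  let ?P = "compile 0 (strip (fixing_prog 0 0))"
  \<comment> \<open>The running time accounts for 1000, and the initial word bound \<open>B\<close>
    for at most \<open>14 * n ^ 3\<close>. The same \<open>C\<close> serves as factor and as
    exponent; it stays a variable, so \<open>n ^ C\<close> never becomes a power with a large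
    numeral.\<close>
  obtain C :: nat where C: "1020 \<le> C" by blast
  show ?thesis
  proof (intro exI[of _ ?P] exI[of _ C] allI impI)
  fix n :: nat and \<Gamma> :: "(nat \<Rightarrow> nat) set" and gs :: "(nat \<Rightarrow> nat) list" and I0 I1 :: "nat set"
  assume n: "1 \<le> n" and subgroup: "subgroup \<Gamma> (sym_group n)"
    and cyclic: "\<Gamma> \<subseteq> generate (sym_group n) {full_cycle n}"
    and "distinct gs" and gen: "generate (sym_group n) (set gs) = \<Gamma>"
    and I: "I0 \<subseteq> {1..n}" "I1 \<subseteq> {1..n}" "I0 \<inter> I1 = {}"
  define xs where "xs = encode_instance n gs I0 I1"
  define m where "m = card \<Gamma>"
  define d where "d = period n gs (length gs)"
  define M where "M = mem (init_config xs)"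
  define aB where "aB = 2 + n * length gs"
  \<comment> \<open>This exceeds all addresses in use and all input words, which are at most
    \<open>n\<close> since the generators permute \<open>{1..n}\<close>.\<close>
  define B where "B = aB + 9 * n + 2"
  define S where "S = X_group n \<Gamma> \<inter> face n I0 I1"
  have nm: "n = m * d"
    using card_group[OF n subgroup cyclic gen] by (simp add: m_def d_def)
  have pos: "0 < m" "0 < d" using nm n by (auto intro: Nat.gr0I)
  have m_le: "m \<le> n" using nm pos by simp
  have g_le: "length gs \<le> m"
    unfolding m_def by (rule length_le_card[OF n subgroup cyclic gen \<open>distinct gs\<close>])
  have M_nth: "M a = xs ! a" if "a < aB + 2 * n" for a
    using that by (simp add: M_def init_config_def xs_def length_encode_instance aB_def)
  have M01: "M 0 = n" "M 1 = length gs"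
    using M_nth[of 0] M_nth[of 1] nth_encode_instance(1,2) by (simp_all add: aB_def xs_def)
  have Mg: "M (2 + n * r) = (gs ! r) 1" if "r < length gs" for r
  proof -
    have "n * r \<le> n * length gs" using that by (intro mult_le_mono2) simp
    then have "2 + n * r < aB + 2 * n" using n unfolding aB_def by linarith
    then show ?thesis using M_nth nth_encode_instance(3)[OF that, of 0] n by (simp add: xs_def)
  qed
  have M0: "M (aB + i) = of_bool (Suc i \<in> I0)" if "i < n" for i
  proof -
    have "M (aB + i) = xs ! (aB + i)" using that by (intro M_nth) simp
    then show ?thesis unfolding xs_def aB_def nth_encode_instance(4)[OF that] .
  qed
  have M1: "M (aB + n + i) = of_bool (Suc i \<in> I1)" if "i < n" for i
  proof -
    have "M (aB + n + i) = xs ! (aB + n + i)" using that by (intro M_nth) simp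
    then show ?thesis unfolding xs_def aB_def nth_encode_instance(5)[OF that] .
  qed
  have bits: "M (aB + n + i) + M (aB + i) \<le> 1" if "i < n" for i
    using M0[OF that] M1[OF that] I(3) by auto
  have aB: "aB + 9 * n + 2 \<le> B" "2 \<le> aB" by (simp_all add: B_def aB_def)
  let ?Q = "\<lambda>R' M'. if never1 n d aB M 0 \<and> never0 n d aB M 0 then M' 0 = 0
    else M' 0 = 1 \<and> (\<forall>i<n. M' (1 + i) = of_bool (never1 n d aB M i) \<and> M' (n + 1 + i) = of_bool (never0 n d aB M i))"
  have finish: "wp B (finish_prog n) ?Q R' M'" if "regs n d aB R' \<and>
     (\<forall>i<n. M' (aB + 6 * n + 1 + i) = of_bool (never1 n d aB M i)) \<and>
     (\<forall>i<n. M' (aB + 7 * n + 1 + i) = of_bool (never0 n d aB M i))" for R' M'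
    using that n aB by (intro wp_finish_prog[where aB = aB and d = d]) auto
  have main: "wp B (main_prog n m) (wp B (finish_prog n) ?Q) R' M'" if "M' = M \<and> regs n d aB R'" for R' M'
    by (rule wp_mono[OF wp_main_prog[OF nm pos(2,1) aB(1) bits, of R' M']]) (use that finish in auto)
  have "wp B (setup_prog n m) (\<lambda>R' M'. M' = M \<and> regs n d aB R') (\<lambda>_. 0) M"
    unfolding d_def aB_def
  proof (rule wp_setup_prog[OF n M01 g_le])
    show "2 + n * length gs + 9 * n + 2 \<le> B" by (simp add: B_def aB_def)
    show "M (2 + n * r) = (gs ! r) 1 \<and> 1 \<le> (gs ! r) 1 \<and> (gs ! r) 1 \<le> n" if "r < length gs" for r
      using Mg[OF that] generator_image_bounds[OF n subgroup cyclic gen that] by simp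
  qed
  then have "wp B (setup_prog n m) (wp B (main_prog n m) (wp B (finish_prog n) ?Q)) (\<lambda>_. 0) M"
    by (rule wp_mono) (rule main)
  then have wp: "wp B (fixing_prog n m) ?Q (\<lambda>_. 0) M"
    by (simp only: fixing_prog_def wp_Seq)
  have P: "?P = compile 0 (fixing_prog n m)"
    using strip_fixing_prog[of n m] compile_strip by metis
  have code: "code_at ?P 0 (compile 0 (fixing_prog n m))"
    unfolding P code_at_def by (intro exI[of _ "[]"]) simp
  have M_le: "M a \<le> B" for a
  proof (cases "a < length xs")
    case True
    then have "xs ! a \<in> set xs" by simp
    then consider "xs ! a = n" | "xs ! a = length gs" | "xs ! a \<le> 1"
      | g i where "g \<in> set gs" "i \<in> {1..n}" "xs ! a = g i"
      using set_encode_instance unfolding xs_def by blast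
    then have "xs ! a \<le> n"
    proof cases
      case 4
      then have "g \<in> carrier (sym_group n)"
        using generate.incl[of g "set gs"] gen subgroup.mem_carrier[OF subgroup] by blast
      then have "g permutes {1..n}" by (simp add: sym_group_carrier)
      then show ?thesis using 4 permutes_in_image[of g "{1..n}" i] by simp
    qed (use n g_le m_le in auto)
    then show ?thesis using True by (simp add: M_def init_config_def B_def)
  qed (simp add: M_def init_config_def)
  let ?c0 = "init_config xs"
  have c0: "?c0 = \<lparr>pc = 0, reg = (\<lambda>_. 0), mem = M\<rparr>"
    by (simp add: M_def init_config_def)
  have "words_le B \<lparr>pc = 0, reg = (\<lambda>_. 0), mem = M\<rparr>" using M_le by simp
  from wp_sound[OF wp code order_refl this] obtain t R' M' where t: "t \<le> cost (fixing_prog n m)"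
    and Q: "?Q R' M'"
    and r: "reaches ?P B t ?c0 \<lparr>pc = 0 + clen (fixing_prog n m), reg = R', mem = M'\<rparr>"
    unfolding c0 by blast
  have t_le: "t \<le> 1000 * (n ^ 2 * m)"
    using t cost_fixing_prog[of n m] n pos by simp
  have "n * length gs \<le> n ^ 2" using g_le m_le by (simp add: power2_eq_square)
  moreover have "n ^ 2 \<le> n ^ 3" "n \<le> n ^ 3" "1 \<le> n ^ 3" using n by (simp_all add: power_increasing self_le_power)
  moreover have "n ^ 2 * m \<le> n ^ 3" using m_le by (simp add: power2_eq_square power3_eq_cube)
  ultimately have bound: "B + t \<le> 1020 * n ^ 3"
    using t_le unfolding B_def aB_def by linarith
  have "n ^ 3 \<le> n ^ C" using n C by (intro power_increasing) linarith+
  with C have "1020 * n ^ 3 \<le> C * n ^ C" by (rule mult_le_mono)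
  with bound have bound': "B + t \<le> C * n ^ C" by (rule le_trans)
  have run: "run ?P t ?c0 = \<lparr>pc = clen (fixing_prog n m), reg = R', mem = M'\<rparr>"
    using r by (simp add: reaches_def)
  have "length ?P = clen (fixing_prog n m)" unfolding P by simp
  then have "halted ?P (run ?P t ?c0)"
    unfolding run halted_def config.select_convs by (rule eq_imp_le)
  moreover have "words_le (C * n ^ C) (run ?P s ?c0)" if "s \<le> t" for s
  proof (rule words_le_mono)
    show "words_le (B + s) (run ?P s ?c0)" using r that by (simp add: reaches_def)
    show "B + s \<le> C * n ^ C" using bound' that by linarith
  qed
  moreover have "outputs (run ?P t ?c0) (encode_result n S)"
  proof (rule outputs_encode_result[OF n])
    show "S \<subseteq> binary_cube n" by (auto simp: S_def face_def)
    show "never1 n d aB M i \<longleftrightarrow> (\<forall>x\<in>S. x (Suc i) = 0)" if "i < n" for i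
      unfolding d_def S_def by (rule never_iff(1)[OF n subgroup cyclic gen I(1,2) M0 M1 that])
    show "never0 n d aB M i \<longleftrightarrow> (\<forall>x\<in>S. x (Suc i) = 1)" if "i < n" for i
      unfolding d_def S_def by (rule never_iff(2)[OF n subgroup cyclic gen I(1,2) M0 M1 that])
    show "if never1 n d aB M 0 \<and> never0 n d aB M 0 then mem (run ?P t ?c0) 0 = 0
      else mem (run ?P t ?c0) 0 = 1 \<and> (\<forall>i<n. mem (run ?P t ?c0) (1 + i) = of_bool (never1 n d aB M i) \<and>
        mem (run ?P t ?c0) (n + 1 + i) = of_bool (never0 n d aB M i))"
      unfolding run config.select_convs using Q .
  qed
  moreover have "1000 * (n ^ 2 * m) \<le> C * (n ^ 2 * m)" using C by (intro mult_le_mono1) linarith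
  with t_le have "t \<le> C * (n ^ 2 * m)" by (rule le_trans)
  ultimately show "let c0 = init_config (encode_instance n gs I0 I1)
       in \<exists>t \<le> C * (n ^ 2 * card \<Gamma>).
            halted ?P (run ?P t c0) \<and>
            (\<forall>s \<le> t. words_le (C * n ^ C) (run ?P s c0)) \<and>
            outputs (run ?P t c0) (encode_result n (X_group n \<Gamma> \<inter> face n I0 I1))"
    unfolding Let_def xs_def[symmetric] m_def[symmetric] S_def[symmetric]
    by (intro exI[of _ t] conjI allI impI)
  qed
qed

end
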